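(* There is a randomized (Monte-Carlo) algorithm for the Dominating Matching Problem and for the Dominating f-factor Problem with the following properties. Its running time is bounded by a polynomial in $n$, the number of vertices of the input graph, whenever $\prod_{j=1}^{k}(m_j+1)=O(p(n))$ for some polynomial $p$ (which holds in particular if the number $k$ of prescribed edge sets stays bounded as $n$ grows). If the algorithm returns TRUE, then the sought-after subgraph (a perfect matching, respectively a subgraph with the prescribed degrees) satisfying all the lower bounds exists. If the algorithm returns FALSE, then with high probability no such subgraph exists; that is, if a solution exists, the algorithm returns TRUE with high probability.
   Context: Dominating Matching Problem: given a finite simple graph $G$, pairwise disjoint edge subsets $E'_1,\dots,E'_k\subseteq E(G)$ and nonnegative integers $m_1,\dots,m_k$, decide whether $G$ has a perfect matching $M$ with $|M\cap E'_j|\ge m_j$ for every $j=1,\dots,k$. Dominating f-factor Problem: given a finite simple graph $G$ on vertices $v_1,\dots,v_n$, pairwise disjoint edge subsets $E_1,\dots,E_k\subseteq E(G)$, nonnegative integers $m_1,\dots,m_k$, and nonnegative integers $d_1,\dots,d_n$, decide whether there is a spanning subgraph $G'$ of $G$ in which $v_i$ has degree $d_i$ for every $i$ and which contains at least $m_j$ edges of $E_j$ for every $j=1,\dots,k$. "With high probability" means with probability tending to $1$ as $n\to\infty$.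
   Formalization: The remark that bounded k makes the product of the m_j+1 polynomially bounded fails for k=1, m_1=2^n; it is proved assuming every m_j is at most |E(G)|, while polynomial running time for bounded k is proved without this cap. The input lists only the positive m_j. *)

theory Defs
  imports
    "HOL-Probability.Probability"
    "HOL-Computational_Algebra.Polynomial"
    "HOL-Library.Landau_Symbols"
begin

section \<open>Randomized random-access machines\<close>

text \<open>
  Programs act on registers and on a memory, both indexed by and holding natural numbers.
  Every step costs one unit.  The only arithmetic is addition, truncated subtraction and
  halving: since the expressions of a fixed program have constant size, a step lengthens the
  numbers in use by at most a constant number of bits, so polynomial unit-cost time is
  polynomial time in the Turing machine sense (unit-cost multiplication would spoil this).
  Randomness comes from fair coin flips.
\<close>

datatype aexp =
    Const nat
  | Reg nat
  | Mem aexp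
  | Plus aexp aexp
  | Minus aexp aexp
  | Half aexp

datatype com =
    Skip
  | Assign nat aexp
  | Store aexp aexp
  | Flip nat
  | Seq com com
  | Cond aexp com com
  | While aexp com

type_synonym state = "(nat \<Rightarrow> nat) \<times> (nat \<Rightarrow> nat)"
type_synonym config = "com \<times> state"

primrec aval :: "aexp \<Rightarrow> state \<Rightarrow> nat" where
  "aval (Const c) s = c"
| "aval (Reg r) s = fst s r"
| "aval (Mem a) s = snd s (aval a s)"
| "aval (Plus a b) s = aval a s + aval b s"
| "aval (Minus a b) s = aval a s - aval b s"
| "aval (Half a) s = aval a s div 2"

primrec step :: "com \<Rightarrow> state \<Rightarrow> config pmf" where
  "step Skip s = return_pmf (Skip, s)"
| "step (Assign r a) s = return_pmf (Skip, (fst s)(r := aval a s), snd s)"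
| "step (Store a b) s = return_pmf (Skip, fst s, (snd s)(aval a s := aval b s))"
| "step (Flip r) s =
     map_pmf (\<lambda>b. (Skip, (fst s)(r := of_bool b), snd s)) (bernoulli_pmf (1 / 2))"
| "step (Seq c d) s =
     (if c = Skip then return_pmf (d, s)
      else map_pmf (\<lambda>(c', s'). (Seq c' d, s')) (step c s))"
| "step (Cond a c d) s = return_pmf (if aval a s \<noteq> 0 then c else d, s)"
| "step (While a c) s =
     return_pmf (if aval a s \<noteq> 0 then Seq c (While a c) else Skip, s)"

primrec run :: "nat \<Rightarrow> config \<Rightarrow> config pmf" where
  "run 0 cfg = return_pmf cfg"
| "run (Suc t) cfg = bind_pmf (step (fst cfg) (snd cfg)) (run t)"

definition start :: "com \<Rightarrow> nat list \<Rightarrow> config" where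
  "start A w = (A, (\<lambda>_. 0), (\<lambda>i. if i < length w then w ! i else 0))"

definition halted :: "config \<Rightarrow> bool" where
  "halted cfg \<longleftrightarrow> fst cfg = Skip"

text \<open>A halted program has returned TRUE if register 0 is nonzero, and FALSE otherwise.\<close>

definition returned_true :: "config \<Rightarrow> bool" where
  "returned_true cfg \<longleftrightarrow> halted cfg \<and> fst (snd cfg) 0 \<noteq> 0"

text \<open>Running time is worst case over the coin flips.\<close>

definition halts_within :: "com \<Rightarrow> nat list \<Rightarrow> nat \<Rightarrow> bool" where
  "halts_within A w t \<longleftrightarrow> (\<forall>cfg \<in> set_pmf (run t (start A w)). halted cfg)"

definition can_return_true :: "com \<Rightarrow> nat list \<Rightarrow> bool" where
  "can_return_true A w \<longleftrightarrow> (\<exists>t. \<exists>cfg \<in> set_pmf (run t (start A w)). returned_true cfg)"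

text \<open>Halted configurations persist, so the probabilities below increase with the time.\<close>

definition prob_true :: "com \<Rightarrow> nat list \<Rightarrow> real" where
  "prob_true A w =
     (SUP t. measure_pmf.prob (run t (start A w)) {cfg. returned_true cfg})"


section \<open>The two problems\<close>

text \<open>The vertex set is \<open>{..<nverts I}\<close>; the edge subsets and the bounds are indexed from 0.\<close>

record dm_instance =
  nverts :: nat
  edges :: "nat set set"
  esets :: "nat set set list"
  bounds :: "nat list"

record df_instance = dm_instance +
  degs :: "nat list"

definition dm_wf :: "'a dm_instance_scheme \<Rightarrow> bool" where
  "dm_wf I \<longleftrightarrow>
     edges I \<subseteq> {e. e \<subseteq> {..<nverts I} \<and> card e = 2} \<and>
     length (esets I) = length (bounds I) \<and>
     (\<forall>j < length (esets I). esets I ! j \<subseteq> edges I) \<and>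
     disjoint_family_on (\<lambda>j. esets I ! j) {..<length (esets I)}"

definition df_wf :: "df_instance \<Rightarrow> bool" where
  "df_wf I \<longleftrightarrow> dm_wf I \<and> length (degs I) = nverts I"

definition meets_bounds :: "'a dm_instance_scheme \<Rightarrow> nat set set \<Rightarrow> bool" where
  "meets_bounds I F \<longleftrightarrow> (\<forall>j < length (bounds I). bounds I ! j \<le> card (F \<inter> esets I ! j))"

definition perfect_matching :: "'a dm_instance_scheme \<Rightarrow> nat set set \<Rightarrow> bool" where
  "perfect_matching I M \<longleftrightarrow> M \<subseteq> edges I \<and> (\<forall>v < nverts I. \<exists>!e. e \<in> M \<and> v \<in> e)"

text \<open>A spanning subgraph is given by its edge set.\<close>

definition f_factor :: "df_instance \<Rightarrow> nat set set \<Rightarrow> bool" where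
  "f_factor I F \<longleftrightarrow> F \<subseteq> edges I \<and> (\<forall>v < nverts I. card {e \<in> F. v \<in> e} = degs I ! v)"

definition dm_solvable :: "dm_instance \<Rightarrow> bool" where
  "dm_solvable I \<longleftrightarrow> (\<exists>M. perfect_matching I M \<and> meets_bounds I M)"

definition df_solvable :: "df_instance \<Rightarrow> bool" where
  "df_solvable I \<longleftrightarrow> (\<exists>F. f_factor I F \<and> meets_bounds I F)"

text \<open>
  An instance is stored as: the number of vertices, the number of edge subsets, the number of
  positive bounds, the positive bounds \<open>m\<close> each as a pair \<open>j, m\<close>, and the adjacency
  matrix row by row (0: no edge; 1: edge in none of the subsets; \<open>j + 2\<close>: edge in the
  subset with index \<open>j\<close>).  Listing only the positive bounds matters: arbitrarily many subsets
  may have bound 0 while the product of all \<open>m + 1\<close> stays small, and merely reading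
  those zeros would not be polynomial in the number of vertices.
\<close>

definition edge_entry :: "'a dm_instance_scheme \<Rightarrow> nat \<Rightarrow> nat \<Rightarrow> nat" where
  "edge_entry I u v =
     (if {u, v} \<notin> edges I then 0
      else if \<exists>j < length (esets I). {u, v} \<in> esets I ! j
      then (THE j. j < length (esets I) \<and> {u, v} \<in> esets I ! j) + 2
      else 1)"

definition positive_bounds :: "'a dm_instance_scheme \<Rightarrow> nat list" where
  "positive_bounds I = filter (\<lambda>j. 0 < bounds I ! j) [0..<length (bounds I)]"

definition dm_encode :: "'a dm_instance_scheme \<Rightarrow> nat list" where
  "dm_encode I =
     [nverts I, length (bounds I), length (positive_bounds I)] @
     concat (map (\<lambda>j. [j, bounds I ! j]) (positive_bounds I)) @
     concat (map (\<lambda>u. map (\<lambda>v. edge_entry I u v) [0..<nverts I]) [0..<nverts I])"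

definition df_encode :: "df_instance \<Rightarrow> nat list" where
  "df_encode I = dm_encode I @ degs I"

definition bound_prod :: "'a dm_instance_scheme \<Rightarrow> nat" where
  "bound_prod I = (\<Prod>j < length (bounds I). bounds I ! j + 1)"


section \<open>Properties of the algorithm\<close>

text \<open>
  For every class of instances on which \<open>bound_prod\<close> is \<open>O(p(n))\<close>, witnessed by a function
  \<open>B\<close> of the number \<open>n\<close> of vertices, the running time on that class is polynomial in \<open>n\<close>.
\<close>

definition poly_time_small_prod ::
    "('a dm_instance_scheme \<Rightarrow> bool) \<Rightarrow> ('a dm_instance_scheme \<Rightarrow> nat list) \<Rightarrow> com \<Rightarrow> bool" where
  "poly_time_small_prod valid enc A \<longleftrightarrow>
     (\<forall>(p :: real poly) (B :: nat \<Rightarrow> real). B \<in> O(\<lambda>n. poly p (real n)) \<longrightarrow>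
       (\<exists>q :: nat poly. \<forall>I. valid I \<and> real (bound_prod I) \<le> B (nverts I) \<longrightarrow>
          halts_within A (enc I) (poly q (nverts I))))"

definition poly_time_few_sets ::
    "('a dm_instance_scheme \<Rightarrow> bool) \<Rightarrow> ('a dm_instance_scheme \<Rightarrow> nat list) \<Rightarrow> com \<Rightarrow> bool" where
  "poly_time_few_sets valid enc A \<longleftrightarrow>
     (\<forall>K. \<exists>q :: nat poly. \<forall>I. valid I \<and> length (esets I) \<le> K \<longrightarrow>
        halts_within A (enc I) (poly q (nverts I)))"

text \<open>
  If the number of edge subsets is bounded, the product is polynomially bounded.  A bound
  exceeding the number of edges makes the instance trivially infeasible and is excluded here,
  as it would make the product arbitrarily large.
\<close>

definition small_prod_few_sets :: "('a dm_instance_scheme \<Rightarrow> bool) \<Rightarrow> bool" where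
  "small_prod_few_sets valid \<longleftrightarrow>
     (\<forall>K. \<exists>p :: nat poly. \<forall>I. valid I \<and> length (esets I) \<le> K \<and>
        (\<forall>m \<in> set (bounds I). m \<le> card (edges I)) \<longrightarrow>
        bound_prod I \<le> poly p (nverts I))"

definition true_is_correct ::
    "('a dm_instance_scheme \<Rightarrow> bool) \<Rightarrow> ('a dm_instance_scheme \<Rightarrow> nat list) \<Rightarrow>
     ('a dm_instance_scheme \<Rightarrow> bool) \<Rightarrow> com \<Rightarrow> bool" where
  "true_is_correct valid enc solvable A \<longleftrightarrow>
     (\<forall>I. valid I \<and> can_return_true A (enc I) \<longrightarrow> solvable I)"

definition solvable_true_whp ::
    "('a dm_instance_scheme \<Rightarrow> bool) \<Rightarrow> ('a dm_instance_scheme \<Rightarrow> nat list) \<Rightarrow>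
     ('a dm_instance_scheme \<Rightarrow> bool) \<Rightarrow> com \<Rightarrow> bool" where
  "solvable_true_whp valid enc solvable A \<longleftrightarrow>
     (\<exists>\<delta> :: nat \<Rightarrow> real. \<delta> \<longlonglongrightarrow> 1 \<and>
        (\<forall>I. valid I \<and> solvable I \<longrightarrow> \<delta> (nverts I) \<le> prob_true A (enc I)))"

end

theory Submission
  imports
    Defs
    "Jordan_Normal_Form.Determinant"
    "HOL-Computational_Algebra.Formal_Power_Series"
    "HOL-Library.Poly_Mapping"
    "HOL-Library.Z2"
begin

text \<open>
  A perfect matching is an \<open>f\<close>-factor with \<open>f = 1\<close>, and the \<open>f\<close>-factors of a graph correspond to the
  perfect matchings, with loops allowed, of a gadget graph of polynomial size.  In characteristic 2
  the determinant of a symmetric matrix is a sum over the involutions only, since a permutation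
  cancels against its inverse; so the determinant of the matrix that has one variable for
  each edge of the gadget enumerates the matchings of the gadget, without signs.

  The determinant is computed without divisions: if \<open>P\<^sub>h\<close> is \<open>det (1 - t A)\<close> for the leading
  \<open>h \<times> h\<close> block of \<open>A\<close>, then \<open>P\<^sub>h\<^sub>+\<^sub>1\<close> arises from \<open>P\<^sub>h\<close> by a recurrence along walks (Cramer's rule),
  and \<open>det A\<close> is the top coefficient.  Every monomial is replaced by its class, namely
  the total weight of its variables under random weights and, for each prescribed edge set, the
  number of its edges capped at the bound.  The number of classes is polynomial because the product
  of the bounds is.  The program counts walks by class with natural numbers and finally
  looks at parities in the classes where all bounds are attained.  An odd count proves
  that a solution exists.  Conversely, by the isolation lemma the solution of minimum weight is unique with high
  probability, and then its class has an odd count.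
\<close>

section \<open>Counting-loop programs\<close>

text \<open>A factor with degrees \<open>f v\<close> corresponds to as many pairings as the product
  of the \<open>f v!\<close>, usually an even number, so one variable per edge of the graph would
  make it vanish in characteristic 2. Hence the variables sit on the gadget edges between an end and
  a slot: they tell all pairings apart (\<open>used_inj\<close>), and isolating one pairing
  suffices. Merging monomials into classes is harmless because the class of a product with a
  variable depends only on the class of the other factor (\<open>trans_var\<close>). The tables of
  class counts admit no division, hence a recurrence by additions; this also suits a machine without
  multiplication. Each matched gadget edge is met from both of its ends, so its variable occurs
  squared: the origin of the factor 2 in caps and weights. There are \<open>n^3\<close> variables;
  weights below a power of two that is at least \<open>n^4\<close> isolate with failure probability
  at most \<open>1/n\<close>. Capping a bound at \<open>n * n + 1\<close>, more than any number of
  edges, keeps infeasible bounds infeasible and the number of classes polynomial when there are few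
  edge sets.\<close>

datatype prog =
    PNop
  | PAsg nat aexp
  | PSto aexp aexp
  | PFlip nat
  | PSeq prog prog
  | PIf aexp prog prog
  | PFor nat nat prog

primrec mods :: "prog \<Rightarrow> nat set" where
  "mods PNop = {}"
| "mods (PAsg r a) = {r}"
| "mods (PSto a b) = {}"
| "mods (PFlip r) = {r}"
| "mods (PSeq p q) = mods p \<union> mods q"
| "mods (PIf a p q) = mods p \<union> mods q"
| "mods (PFor r b p) = insert r (mods p)"

text \<open>The compiled guard rereads \<open>b\<close> and \<open>r\<close> in every round, whereas
  \<open>psem\<close> fixes the number of rounds on entry. Forbidding the body to touch either
  register makes the two agree.\<close>

primrec wf_prog :: "prog \<Rightarrow> bool" where
  "wf_prog PNop = True"
| "wf_prog (PAsg r a) = True"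
| "wf_prog (PSto a b) = True"
| "wf_prog (PFlip r) = True"
| "wf_prog (PSeq p q) = (wf_prog p \<and> wf_prog q)"
| "wf_prog (PIf a p q) = (wf_prog p \<and> wf_prog q)"
| "wf_prog (PFor r b p) = (r \<noteq> b \<and> r \<notin> mods p \<and> b \<notin> mods p \<and> wf_prog p)"

primrec flip_free :: "prog \<Rightarrow> bool" where
  "flip_free PNop = True"
| "flip_free (PAsg r a) = True"
| "flip_free (PSto a b) = True"
| "flip_free (PFlip r) = False"
| "flip_free (PSeq p q) = (flip_free p \<and> flip_free q)"
| "flip_free (PIf a p q) = (flip_free p \<and> flip_free q)"
| "flip_free (PFor r b p) = flip_free p"

primrec compile :: "prog \<Rightarrow> com" where
  "compile PNop = Skip"
| "compile (PAsg r a) = Assign r a"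
| "compile (PSto a b) = Store a b"
| "compile (PFlip r) = Flip r"
| "compile (PSeq p q) = Seq (compile p) (compile q)"
| "compile (PIf a p q) = Cond a (compile p) (compile q)"
| "compile (PFor r b p) =
     Seq (Assign r (Const 0))
       (While (Minus (Reg b) (Reg r)) (Seq (compile p) (Assign r (Plus (Reg r) (Const 1)))))"

definition upd :: "nat \<Rightarrow> nat \<Rightarrow> state \<Rightarrow> state" where
  "upd r v s = ((fst s)(r := v), snd s)"

lemma upd_simps [simp]: "fst (upd r v s) = (fst s)(r := v)" "snd (upd r v s) = snd s"
  by (simp_all add: upd_def)

primrec loop :: "(state \<Rightarrow> state pmf) \<Rightarrow> nat \<Rightarrow> nat \<Rightarrow> state \<Rightarrow> state pmf" where
  "loop f r 0 s = return_pmf s"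
| "loop f r (Suc k) s = bind_pmf (f s) (\<lambda>s'. loop f r k (upd r (Suc (fst s' r)) s'))"

primrec psem :: "prog \<Rightarrow> state \<Rightarrow> state pmf" where
  "psem PNop s = return_pmf s"
| "psem (PAsg r a) s = return_pmf (upd r (aval a s) s)"
| "psem (PSto a b) s = return_pmf (fst s, (snd s)(aval a s := aval b s))"
| "psem (PFlip r) s = map_pmf (\<lambda>b. upd r (of_bool b) s) (bernoulli_pmf (1 / 2))"
| "psem (PSeq p q) s = bind_pmf (psem p s) (psem q)"
| "psem (PIf a p q) s = (if aval a s \<noteq> 0 then psem p s else psem q s)"
| "psem (PFor r b p) s = loop (psem p) r (fst s b) (upd r 0 s)"

primrec wp_loop :: "((state \<Rightarrow> bool) \<Rightarrow> state \<Rightarrow> bool) \<Rightarrow> nat \<Rightarrow> nat \<Rightarrow> (state \<Rightarrow> bool) \<Rightarrow> state \<Rightarrow> bool"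
where
  "wp_loop w r 0 Q s = Q s"
| "wp_loop w r (Suc k) Q s = w (\<lambda>s'. wp_loop w r k Q (upd r (Suc (fst s' r)) s')) s"

text \<open>Besides the postcondition, \<open>wp X\<close> demands that no loop makes more than \<open>X\<close> iterations; this is
  what makes \<open>time_bound X\<close> a bound on the running time.\<close>

primrec wp :: "nat \<Rightarrow> prog \<Rightarrow> (state \<Rightarrow> bool) \<Rightarrow> state \<Rightarrow> bool" where
  "wp X PNop Q s = Q s"
| "wp X (PAsg r a) Q s = Q (upd r (aval a s) s)"
| "wp X (PSto a b) Q s = Q (fst s, (snd s)(aval a s := aval b s))"
| "wp X (PFlip r) Q s = (Q (upd r 0 s) \<and> Q (upd r 1 s))"
| "wp X (PSeq p q) Q s = wp X p (wp X q Q) s"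
| "wp X (PIf a p q) Q s = (if aval a s \<noteq> 0 then wp X p Q s else wp X q Q s)"
| "wp X (PFor r b p) Q s = (fst s b \<le> X \<and> wp_loop (wp X p) r (fst s b) Q (upd r 0 s))"

text \<open>In each round of a loop the guard, the increment and the two steps by which
  \<open>Seq\<close> discards a finished \<open>Skip\<close> add 4 to the body. The final 3 are the
  initialisation, its \<open>Seq\<close> step and the failing guard.\<close>

primrec time_bound :: "nat \<Rightarrow> prog \<Rightarrow> nat" where
  "time_bound X PNop = 0"
| "time_bound X (PAsg r a) = 1"
| "time_bound X (PSto a b) = 1"
| "time_bound X (PFlip r) = 1"
| "time_bound X (PSeq p q) = time_bound X p + time_bound X q + 1"
| "time_bound X (PIf a p q) = time_bound X p + time_bound X q + 1"
| "time_bound X (PFor r b p) = X * (time_bound X p + 4) + 3"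

lemma time_bound_poly: "\<exists>q :: nat poly. \<forall>X. time_bound X p = poly q X"
proof (induction p)
  case (PSeq p1 p2)
  then obtain q1 q2 :: "nat poly" where "\<And>X. time_bound X p1 = poly q1 X" "\<And>X. time_bound X p2 = poly q2 X"
    by blast
  then show ?case by (intro exI[of _ "q1 + q2 + 1"]) simp
next
  case (PIf a p1 p2)
  then obtain q1 q2 :: "nat poly" where "\<And>X. time_bound X p1 = poly q1 X" "\<And>X. time_bound X p2 = poly q2 X"
    by blast
  then show ?case by (intro exI[of _ "q1 + q2 + 1"]) simp
next
  case (PFor r b p)
  then obtain q :: "nat poly" where "\<And>X. time_bound X p = poly q X"
    by blast
  then show ?case by (intro exI[of _ "[:0, 1:] * (q + [:4:]) + [:3:]"]) simp
next
  case PNop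
  show ?case by (rule exI[of _ 0]) simp
qed (rule exI[of _ 1], simp)+

lemma wp_loop_conseq:
  assumes "\<And>Q Q' s. w Q s \<Longrightarrow> (\<And>s'. Q s' \<Longrightarrow> (\<forall>x. x \<notin> A \<longrightarrow> fst s' x = fst s x) \<Longrightarrow> Q' s') \<Longrightarrow> w Q' s"
    and "wp_loop w r k Q s"
    and "\<And>s'. Q s' \<Longrightarrow> (\<forall>x. x \<notin> insert r A \<longrightarrow> fst s' x = fst s x) \<Longrightarrow> Q' s'"
  shows "wp_loop w r k Q' s"
  using assms(2,3)
proof (induction k arbitrary: s)
  case (Suc k)
  show ?case
    using Suc.prems(1)
    apply simp
    apply (erule assms(1))
    apply (erule Suc.IH)
    using Suc.prems(2) by auto
qed auto

text \<open>The frame property is built into the consequence rule: whatever registers a program does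
  not modify are known afterwards for free, so postconditions and invariants need not list
  them.\<close>

lemma wp_conseq:
  assumes "wp X p Q s"
    and "\<And>s'. Q s' \<Longrightarrow> (\<forall>x. x \<notin> mods p \<longrightarrow> fst s' x = fst s x) \<Longrightarrow> Q' s'"
  shows "wp X p Q' s"
  using assms
proof (induction p arbitrary: Q Q' s)
  case (PSeq p1 p2)
  show ?case
    using PSeq.prems(1) apply simp
    apply (erule PSeq.IH(1))
    apply (erule PSeq.IH(2))
    using PSeq.prems(2) by auto
next
  case (PIf a p1 p2)
  show ?case
  proof (cases "aval a s = 0")
    case True
    then show ?thesis using PIf.prems PIf.IH(2)[of Q s Q'] by simp
  next
    case False
    then show ?thesis using PIf.prems PIf.IH(1)[of Q s Q'] by simp
  qed
next
  case (PFor r b p)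
  have "wp_loop (wp X p) r (fst s b) Q' (upd r 0 s)"
  proof (rule wp_loop_conseq[where A = "mods p" and Q = Q, OF PFor.IH])
    show "wp_loop (wp X p) r (fst s b) Q (upd r 0 s)" using PFor.prems(1) by simp
    show "Q' s'" if "Q s'" "\<forall>x. x \<notin> insert r (mods p) \<longrightarrow> fst s' x = fst (upd r 0 s) x" for s'
      using that by (intro PFor.prems(2)) auto
  qed
  then show ?case using PFor.prems(1) by simp
qed simp_all

text \<open>\<open>wp_loop\<close> recurses on the rounds still to go, while an invariant is indexed
  by the rounds done; hence \<open>N - k\<close>. The function \<open>f\<close> keeps the registers
  on entry, so that the frame property spans all rounds.\<close>

lemma wp_loop_inv:
  assumes "r \<notin> mods p"
    and "\<And>i s'. i < N \<Longrightarrow> Inv i s' \<Longrightarrow> fst s' r = i \<Longrightarrow> (\<forall>x. x \<notin> insert r (mods p) \<longrightarrow> fst s' x = f x)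
          \<Longrightarrow> wp X p (\<lambda>s''. Inv (Suc i) (upd r (Suc i) s'')) s'"
    and "\<And>s'. Inv N s' \<Longrightarrow> fst s' r = N \<Longrightarrow> (\<forall>x. x \<notin> insert r (mods p) \<longrightarrow> fst s' x = f x) \<Longrightarrow> Q s'"
    and "k \<le> N" "Inv (N - k) s" "fst s r = N - k" "\<forall>x. x \<notin> insert r (mods p) \<longrightarrow> fst s x = f x"
  shows "wp_loop (wp X p) r k Q s"
  using assms(4-)
proof (induction k arbitrary: s)
  case 0
  then show ?case using assms(3) by simp
next
  case (Suc k)
  have *: "wp X p (\<lambda>s''. Inv (Suc (N - Suc k)) (upd r (Suc (N - Suc k)) s'')) s"
    using Suc.prems by (intro assms(2)) auto
  have eq: "Suc (N - Suc k) = N - k" using Suc.prems by auto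
  show ?case
    unfolding wp_loop.simps
  proof (rule wp_conseq[OF *])
    fix s' assume s': "Inv (Suc (N - Suc k)) (upd r (Suc (N - Suc k)) s')"
      "\<forall>x. x \<notin> mods p \<longrightarrow> fst s' x = fst s x"
    have r: "fst s' r = N - Suc k" using s'(2) assms(1) Suc.prems by auto
    show "wp_loop (wp X p) r k Q (upd r (Suc (fst s' r)) s')"
      unfolding r eq using s' Suc.prems by (intro Suc.IH) (auto simp: eq)
  qed
qed

lemma wp_For:
  assumes "wf_prog (PFor r b p)" "fst s b = N" "N \<le> X" "Inv 0 (upd r 0 s)"
    and "\<And>i s'. i < N \<Longrightarrow> Inv i s' \<Longrightarrow> fst s' r = i \<Longrightarrow> (\<forall>x. x \<notin> insert r (mods p) \<longrightarrow> fst s' x = fst s x)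
          \<Longrightarrow> wp X p (\<lambda>s''. Inv (Suc i) (upd r (Suc i) s'')) s'"
    and "\<And>s'. Inv N s' \<Longrightarrow> fst s' r = N \<Longrightarrow> (\<forall>x. x \<notin> insert r (mods p) \<longrightarrow> fst s' x = fst s x) \<Longrightarrow> Q s'"
  shows "wp X (PFor r b p) Q s"
proof -
  have "wp_loop (wp X p) r (fst s b) Q (upd r 0 s)"
  proof (rule wp_loop_inv[where N = N and Inv = Inv and f = "fst s", OF _ assms(5,6)])
    show "\<forall>x. x \<notin> insert r (mods p) \<longrightarrow> fst (upd r 0 s) x = fst s x" by simp
  qed (use assms(1-4) in simp_all)
  then show ?thesis using assms(2,3) by simp
qed

lemma wp_Seq:
  assumes "wp X p Q s"
    and "\<And>s'. Q s' \<Longrightarrow> (\<forall>x. x \<notin> mods p \<longrightarrow> fst s' x = fst s x) \<Longrightarrow> wp X q Q' s'"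
  shows "wp X (PSeq p q) Q' s"
  using assms by (auto intro: wp_conseq)

text \<open>Repeated addition, with register 1 reserved as its counter. Only the first factor
  \<open>a\<close> costs time and has to respect the iteration bound; \<open>b\<close> may be
  arbitrarily large.\<close>

definition PMul :: "nat \<Rightarrow> nat \<Rightarrow> nat \<Rightarrow> prog" where
  "PMul d a b = PSeq (PAsg d (Const 0)) (PFor 1 a (PAsg d (Plus (Reg d) (Reg b))))"

lemma mods_PMul [simp]: "mods (PMul d a b) = {1, d}"
  by (auto simp: PMul_def)

lemma wf_PMul [simp]: "wf_prog (PMul d a b) \<longleftrightarrow> d \<noteq> 1 \<and> a \<noteq> 1 \<and> a \<noteq> d"
  by (auto simp: PMul_def)

lemma flip_free_PMul [simp]: "flip_free (PMul d a b)"
  by (simp add: PMul_def)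

lemma wp_PMul:
  assumes "d \<noteq> 1" "a \<noteq> 1" "b \<noteq> 1" "d \<noteq> a" "d \<noteq> b" "fst s a \<le> X"
    and "Q (upd 1 (fst s a) (upd d (fst s a * fst s b) s))"
  shows "wp X (PMul d a b) Q s"
  unfolding PMul_def wp.simps(5) wp.simps(2)
proof (rule wp_For[where N = "fst s a" and Inv = "\<lambda>i s'. snd s' = snd s \<and> fst s' d = i * fst s b"])
  fix s' assume *: "snd s' = snd s \<and> fst s' d = fst s a * fst s b" "fst s' 1 = fst s a"
    "\<forall>x. x \<notin> insert 1 (mods (PAsg d (Plus (Reg d) (Reg b)))) \<longrightarrow>
      fst s' x = fst (upd d (aval (Const 0) s) s) x"
  have "s' = upd 1 (fst s a) (upd d (fst s a * fst s b) s)"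
    using * by (intro prod_eqI) (auto simp: fun_eq_iff)
  then show "Q s'" using assms(7) by simp
qed (use assms in auto)

section \<open>Compiled programs follow their distribution semantics within the time bound\<close>

lemma run_Skip [simp]: "run t (Skip, s) = return_pmf (Skip, s)"
  by (induction t) (auto simp: bind_return_pmf)

text \<open>Different coin flips may end \<open>c\<close> at different times, so \<open>d\<close>
  starts with varying time left. This does no harm because \<open>E\<close> is the distribution of
  \<open>d\<close> for every remaining time from \<open>t2\<close> on; the extra 1 is the step that
  drops the finished \<open>Skip\<close>.\<close>

lemma run_Seq:
  assumes "\<forall>cfg \<in> set_pmf (run t (c, s)). fst cfg = Skip"
    and "\<And>cfg t'. cfg \<in> set_pmf (run t (c, s)) \<Longrightarrow> t' \<ge> t2 \<Longrightarrow> run t' (d, snd cfg) = E (snd cfg)"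
    and "t' \<ge> t + t2 + 1"
  shows "run t' (Seq c d, s) = bind_pmf (run t (c, s)) (\<lambda>cfg. E (snd cfg))"
  using assms
proof (induction t arbitrary: c s t')
  case 0
  then obtain t'' where "t' = Suc t''" "t'' \<ge> t2" by (cases t') auto
  with 0 show ?case by (auto simp: bind_return_pmf)
next
  case (Suc t)
  from Suc.prems(3) obtain t'' where t'': "t' = Suc t''" "t'' \<ge> t + t2 + 1" by (cases t') auto
  show ?case
  proof (cases "c = Skip")
    case True
    then show ?thesis using Suc.prems(2)[of "(Skip, s)" t''] t'' by (auto simp: bind_return_pmf)
  next
    case False
    have *: "run t'' (Seq (fst cfg) d, snd cfg) = bind_pmf (run t cfg) (\<lambda>cfg. E (snd cfg))"
      if cfg: "cfg \<in> set_pmf (step c s)" for cfg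
    proof -
      have "run t'' (Seq (fst cfg) d, snd cfg) = bind_pmf (run t (fst cfg, snd cfg)) (\<lambda>cfg. E (snd cfg))"
      proof (rule Suc.IH)
        show "\<forall>cfg'\<in>set_pmf (run t (fst cfg, snd cfg)). fst cfg' = Skip"
          using Suc.prems(1) cfg by auto
        show "run t' (d, snd cfg') = E (snd cfg')"
          if "cfg' \<in> set_pmf (run t (fst cfg, snd cfg))" "t2 \<le> t'" for cfg' t'
          using that cfg by (intro Suc.prems(2)) auto
      qed (fact t'')
      then show ?thesis by simp
    qed
    have "run t' (Seq c d, s) = bind_pmf (step c s) (\<lambda>cfg. run t'' (Seq (fst cfg) d, snd cfg))"
      using False t'' by (auto simp: bind_map_pmf case_prod_beta)
    also have "\<dots> = bind_pmf (step c s) (\<lambda>cfg. bind_pmf (run t cfg) (\<lambda>cfg. E (snd cfg)))"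
      by (intro bind_pmf_cong refl *) 
    finally show ?thesis by (simp add: bind_assoc_pmf)
  qed
qed

text \<open>Demanding the final distribution at all later times as well is what lets time bounds be
  rounded up, and composed although branches end at different moments.\<close>

definition execs :: "com \<Rightarrow> state \<Rightarrow> nat \<Rightarrow> state pmf \<Rightarrow> bool" where
  "execs c s t D \<longleftrightarrow> (\<forall>t' \<ge> t. run t' (c, s) = map_pmf (Pair Skip) D)"

lemma execs_mono: "execs c s t D \<Longrightarrow> t \<le> t' \<Longrightarrow> execs c s t' D"
  by (auto simp: execs_def)

lemma execs_Seq:
  assumes "execs c s t D" and "\<And>s'. s' \<in> set_pmf D \<Longrightarrow> execs d s' t2 (E s')"
  shows "execs (Seq c d) s (t + t2 + 1) (bind_pmf D E)"
  unfolding execs_def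
proof (intro allI impI)
  fix t' assume t': "t + t2 + 1 \<le> t'"
  have "run t' (Seq c d, s) = bind_pmf (run t (c, s)) (\<lambda>cfg. map_pmf (Pair Skip) (E (snd cfg)))"
    using assms t' by (intro run_Seq[where ?t2.0 = t2]) (auto simp: execs_def)
  also have "\<dots> = map_pmf (Pair Skip) (bind_pmf D E)"
    using assms(1) by (simp add: execs_def bind_map_pmf map_bind_pmf)
  finally show "run t' (Seq c d, s) = map_pmf (Pair Skip) (bind_pmf D E)" .
qed

lemma execs_step:
  assumes "step c s = return_pmf (c', s')" and "execs c' s' t D"
  shows "execs c s (Suc t) D"
  unfolding execs_def
proof (intro allI impI)
  fix t' assume "Suc t \<le> t'"
  then obtain t'' where "t' = Suc t''" "t'' \<ge> t" by (cases t') auto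
  with assms show "run t' (c, s) = map_pmf (Pair Skip) D" by (simp add: execs_def bind_return_pmf)
qed

lemma execs_Skip: "execs Skip s 0 (return_pmf s)"
  by (simp add: execs_def)

lemma execs_Assign: "execs (Assign r a) s 1 (return_pmf (upd r (aval a s) s))"
  using execs_step[of "Assign r a" s, OF _ execs_Skip] by (simp add: upd_def)

lemma execs_While:
  assumes IH: "\<And>Q s. wp X p Q s \<Longrightarrow> execs (compile p) s t (psem p s) \<and> (\<forall>s' \<in> set_pmf (psem p s). Q s')"
    and "r \<noteq> b" "r \<notin> mods p" "b \<notin> mods p"
    and "wp_loop (wp X p) r k Q s" "fst s b - fst s r = k"
  shows "execs (While (Minus (Reg b) (Reg r)) (Seq (compile p) (Assign r (Plus (Reg r) (Const 1))))) s
           (k * (t + 4) + 1) (loop (psem p) r k s)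
         \<and> (\<forall>s' \<in> set_pmf (loop (psem p) r k s). Q s')"
  using assms(5,6)
proof (induction k arbitrary: s)
  case 0
  then show ?case using execs_step[OF _ execs_Skip, of _ s s] by simp
next
  case (Suc k)
  let ?W = "While (Minus (Reg b) (Reg r)) (Seq (compile p) (Assign r (Plus (Reg r) (Const 1))))"
  \<comment> \<open>Besides the rest of the loop, the postcondition of the body records that the
    guard will allow exactly \<open>k\<close> further rounds; the frame property supplies
    this.\<close>
  have w: "wp X p (\<lambda>s'. wp_loop (wp X p) r k Q (upd r (Suc (fst s' r)) s') \<and>
             fst s' b - Suc (fst s' r) = k) s"
    using Suc.prems(1) unfolding wp_loop.simps
    by (rule wp_conseq) (use Suc.prems(2) assms(2-4) in auto)
  note 1 = IH[OF w]
  have body: "execs (Seq (compile p) (Assign r (Plus (Reg r) (Const 1)))) s (t + 1 + 1)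
     (bind_pmf (psem p s) (\<lambda>s'. return_pmf (upd r (Suc (fst s' r)) s')))"
    using 1 execs_Assign[of r "Plus (Reg r) (Const 1)"] by (intro execs_Seq) auto
  have "execs (Seq (Seq (compile p) (Assign r (Plus (Reg r) (Const 1)))) ?W) s
     (t + 1 + 1 + (k * (t + 4) + 1) + 1)
     (bind_pmf (bind_pmf (psem p s) (\<lambda>s'. return_pmf (upd r (Suc (fst s' r)) s'))) (loop (psem p) r k))"
  proof (intro execs_Seq[OF body])
    fix s2 assume "s2 \<in> set_pmf (bind_pmf (psem p s) (\<lambda>s'. return_pmf (upd r (Suc (fst s' r)) s')))"
    then obtain s' where s': "s' \<in> set_pmf (psem p s)" "s2 = upd r (Suc (fst s' r)) s'"
      unfolding set_bind_pmf set_return_pmf by blast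
    show "execs ?W s2 (k * (t + 4) + 1) (loop (psem p) r k s2)"
      using 1 s' assms(2) Suc.IH[of s2] by simp
  qed
  then have "execs ?W s (Suc (t + 1 + 1 + (k * (t + 4) + 1) + 1)) (loop (psem p) r (Suc k) s)"
    using Suc.prems(2) by (intro execs_step) (auto simp: bind_assoc_pmf bind_return_pmf)
  moreover have "Suc (t + 1 + 1 + (k * (t + 4) + 1) + 1) = Suc k * (t + 4) + 1" by simp
  moreover have "\<forall>s' \<in> set_pmf (loop (psem p) r (Suc k) s). Q s'"
  proof
    fix s2 assume "s2 \<in> set_pmf (loop (psem p) r (Suc k) s)"
    then obtain s' where s': "s' \<in> set_pmf (psem p s)"
        "s2 \<in> set_pmf (loop (psem p) r k (upd r (Suc (fst s' r)) s'))"
      unfolding loop.simps set_bind_pmf by blast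
    then show "Q s2" using 1 assms(2) Suc.IH[of "upd r (Suc (fst s' r)) s'"] by simp
  qed
  ultimately show ?case by metis
qed

text \<open>Running time and postcondition are proved together: the postcondition on the support of
  a first part is what provides the loop bounds, and so the time, of the part that follows.\<close>

theorem compile_correct:
  assumes "wf_prog p" "wp X p Q s"
  shows "execs (compile p) s (time_bound X p) (psem p s) \<and> (\<forall>s' \<in> set_pmf (psem p s). Q s')"
  using assms
proof (induction p arbitrary: Q s)
  case PNop
  then show ?case by (simp add: execs_Skip)
next
  case (PAsg r a)
  then show ?case using execs_Assign[of r a s] by simp
next
  case (PSto a b)
  then show ?case using execs_step[of "Store a b" s, OF _ execs_Skip] by simp
next
  case (PFlip r)
  have "run t' (Flip r, s) = map_pmf (Pair Skip) (psem (PFlip r) s)" if "t' \<ge> 1" for t'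
    using that by (cases t') (auto simp: upd_def map_pmf_def bind_assoc_pmf bind_return_pmf)
  moreover have "\<forall>s' \<in> set_pmf (psem (PFlip r) s). Q s'"
    using PFlip.prems(2) by auto
  ultimately show ?case unfolding execs_def compile.simps time_bound.simps by blast
next
  case (PSeq p q)
  then have wf: "wf_prog p" "wf_prog q" and w: "wp X p (wp X q Q) s" by simp_all
  note 1 = PSeq.IH(1)[OF wf(1) w]
  have 2: "execs (compile q) s' (time_bound X q) (psem q s') \<and> (\<forall>s'' \<in> set_pmf (psem q s'). Q s'')"
    if "s' \<in> set_pmf (psem p s)" for s'
    using 1 that by (intro PSeq.IH(2)[OF wf(2)]) blast
  have "execs (Seq (compile p) (compile q)) s (time_bound X p + time_bound X q + 1)
    (bind_pmf (psem p s) (psem q))"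
    by (rule execs_Seq) (use 1 2 in blast)+
  moreover have "\<forall>s' \<in> set_pmf (bind_pmf (psem p s) (psem q)). Q s'"
    unfolding set_bind_pmf using 2 by blast
  ultimately show ?case unfolding compile.simps psem.simps time_bound.simps by blast
next
  case (PIf a p q)
  show ?case
  proof (cases "aval a s = 0")
    case True
    have 1: "execs (compile q) s (time_bound X q) (psem q s) \<and> (\<forall>s' \<in> set_pmf (psem q s). Q s')"
      by (rule PIf.IH(2)) (use PIf.prems True in simp_all)
    have "execs (Cond a (compile p) (compile q)) s (Suc (time_bound X q)) (psem q s)"
      by (rule execs_step[of _ _ "compile q" s]) (use 1 True in simp_all)
    from execs_mono[OF this, of "time_bound X (PIf a p q)"] 1 True show ?thesis by simp
  next
    case False
    have 1: "execs (compile p) s (time_bound X p) (psem p s) \<and> (\<forall>s' \<in> set_pmf (psem p s). Q s')"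
      by (rule PIf.IH(1)) (use PIf.prems False in simp_all)
    have "execs (Cond a (compile p) (compile q)) s (Suc (time_bound X p)) (psem p s)"
      by (rule execs_step[of _ _ "compile p" s]) (use 1 False in simp_all)
    from execs_mono[OF this, of "time_bound X (PIf a p q)"] 1 False show ?thesis by simp
  qed
next
  case (PFor r b p)
  then have *: "r \<noteq> b" "r \<notin> mods p" "b \<notin> mods p" "wp_loop (wp X p) r (fst s b) Q (upd r 0 s)"
    "fst s b \<le> X" by auto
  let ?W = "While (Minus (Reg b) (Reg r)) (Seq (compile p) (Assign r (Plus (Reg r) (Const 1))))"
  have W: "execs ?W (upd r 0 s) (fst s b * (time_bound X p + 4) + 1)
        (loop (psem p) r (fst s b) (upd r 0 s))
      \<and> (\<forall>s' \<in> set_pmf (loop (psem p) r (fst s b) (upd r 0 s)). Q s')"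
  proof (rule execs_While[OF _ *(1-4)])
    show "execs (compile p) s (time_bound X p) (psem p s) \<and> (\<forall>s' \<in> set_pmf (psem p s). Q s')"
      if "wp X p Q s" for Q s
      using PFor.prems(1) by (intro PFor.IH[OF _ that]) simp
  qed (use *(1) in simp)
  have "execs (Seq (Assign r (Const 0)) ?W) s (1 + (fst s b * (time_bound X p + 4) + 1) + 1)
     (bind_pmf (return_pmf (upd r 0 s)) (\<lambda>s'. loop (psem p) r (fst s b) s'))"
    using W execs_Assign[of r "Const 0" s] by (intro execs_Seq) simp_all
  then have A: "execs (compile (PFor r b p)) s (1 + (fst s b * (time_bound X p + 4) + 1) + 1)
      (psem (PFor r b p) s)"
    by (simp add: bind_return_pmf)
  have B: "1 + (fst s b * (time_bound X p + 4) + 1) + 1 \<le> time_bound X (PFor r b p)"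
    using mult_le_mono1[OF *(5), of "time_bound X p + 4"] by simp
  show ?case using execs_mono[OF A B] W unfolding psem.simps by blast
qed

lemma loop_flip_free:
  assumes "\<And>s. \<exists>s'. f s = return_pmf s'"
  shows "\<exists>s'. loop f r k s = return_pmf s'"
proof (induction k arbitrary: s)
  case 0
  show ?case unfolding loop.simps by blast
next
  case (Suc k)
  obtain s1 where s1: "f s = return_pmf s1" using assms by blast
  show ?case unfolding loop.simps s1 bind_return_pmf by (rule Suc.IH)
qed

text \<open>All randomness lies in drawing the weights. The other parts act as functions on states,
  so only one distribution ever has to be computed.\<close>

lemma psem_flip_free:
  assumes "flip_free p"
  shows "\<exists>s'. psem p s = return_pmf s'"
  using assms
proof (induction p arbitrary: s)
  case (PSeq p q)
  obtain s1 where s1: "psem p s = return_pmf s1" using PSeq.IH(1) PSeq.prems unfolding flip_free.simps by meson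
  show ?case unfolding psem.simps s1 bind_return_pmf using PSeq by simp
next
  case (PIf a p q)
  show ?case using PIf.IH(1)[of s] PIf.IH(2)[of s] PIf.prems
    by (cases "aval a s = 0") (simp_all del: split_paired_Ex)
next
  case (PFor r b p)
  show ?case unfolding psem.simps by (rule loop_flip_free) (use PFor in simp)
qed (unfold psem.simps flip_free.simps, blast+)

section \<open>Characteristic series and walks\<close>

text \<open>The polynomial \<open>det (1 - t A)\<close> is treated as a power series because its
  constant term 1 then makes it a unit, over any commutative ring.\<close>

definition char_fps :: "(nat \<Rightarrow> nat \<Rightarrow> 'a::comm_ring_1) \<Rightarrow> nat \<Rightarrow> 'a fps" where
  "char_fps A k = Determinant.det (Matrix.mat k k
     (\<lambda>(i, j). fps_const (if i = j then 1 else 0) - fps_X * fps_const (A i j)))"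

text \<open>The generating function of \<open>walks A h _ u\<close> is \<open>char_fps A h\<close>
  times that of the weighted walks from \<open>u\<close> to \<open>h\<close> whose inner vertices
  lie below \<open>h\<close>. For \<open>u = h\<close> these are the first returns to
  \<open>h\<close>.\<close>

primrec walks :: "(nat \<Rightarrow> nat \<Rightarrow> 'a::comm_ring_1) \<Rightarrow> nat \<Rightarrow> nat \<Rightarrow> nat \<Rightarrow> 'a" where
  "walks A h 0 u = 0"
| "walks A h (Suc l) u = (\<Sum>x<h. A u x * walks A h l x) + A u h * fps_nth (char_fps A h) l"

text \<open>The coefficient ring is not assumed to be a domain, so cancellation rests on
  \<open>f\<close> being a unit.\<close>

lemma fps_mult_left_cancel_unit:
  fixes f g h :: "'a::comm_ring_1 fps"
  assumes "fps_nth f 0 = 1" "f * g = f * h"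
  shows "g = h"
proof -
  have "fps_left_inverse f 1 * f = 1" using assms(1) by (intro fps_left_inverse) simp
  then have "g = fps_left_inverse f 1 * (f * g)" "h = fps_left_inverse f 1 * (f * h)"
    by (simp_all add: mult.assoc[symmetric])
  with assms(2) show ?thesis by metis
qed

lemma char_fps_0: "char_fps A 0 = 1"
  by (simp add: char_fps_def)

text \<open>Cramer's rule for the last unknown of a linear system whose solution \<open>y\<close> is
  known beforehand. The hypothesis on the constant term allows the factor \<open>P\<close> to be
  cancelled; \<open>char_fps_nth_0\<close> removes it by induction.\<close>

lemma char_fps_Suc_aux:
  assumes "fps_nth (char_fps A h) 0 = 1"
  shows "char_fps A (Suc h) = char_fps A h - Abs_fps (\<lambda>l. walks A h l h)"
proof -
  define W where "W = (\<lambda>u. Abs_fps (\<lambda>l. walks A h l u))"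
  define a where "a = (\<lambda>i j. fps_const (A i j))"
  define P where "P = char_fps A h"
  have W: "W u = fps_X * ((\<Sum>x<h. a u x * W x) + a u h * P)" for u
  proof (rule fps_ext)
    fix l show "fps_nth (W u) l = fps_nth (fps_X * ((\<Sum>x<h. a u x * W x) + a u h * P)) l"
      by (cases l) (simp_all add: W_def a_def P_def fps_sum_nth)
  qed
  define B where "B = Matrix.mat (Suc h) (Suc h)
     (\<lambda>(i, j). fps_const (if i = j then 1 else 0) - fps_X * a i j)"
  \<comment> \<open>Chosen so that the entries of \<open>B y\<close> with index less than
    \<open>h\<close> vanish: there the system is the recurrence \<open>W\<close> of the
    walks.\<close>
  define y where "y = Matrix.vec (Suc h) (\<lambda>u. if u < h then W u else P)"
  have B: "B \<in> carrier_mat (Suc h) (Suc h)" and y: "y \<in> carrier_vec (Suc h)"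
    by (simp_all add: B_def y_def)
  have By: "vec_index (B *\<^sub>v y) u = (if u < h then 0 else P - W h)" if u: "u < Suc h" for u
  proof -
    have "vec_index (B *\<^sub>v y) u = (\<Sum>j<Suc h. (fps_const (if u = j then 1 else 0) - fps_X * a u j) * vec_index y j)"
      using u by (simp add: B_def y_def scalar_prod_def mult_mat_vec_def Matrix.row_def atLeast0LessThan
          del: sum.lessThan_Suc cong: sum.cong_simp)
    also have "\<dots> = (\<Sum>j<h. (fps_const (if u = j then 1 else 0) - fps_X * a u j) * W j)
        + (fps_const (if u = h then 1 else 0) - fps_X * a u h) * P"
      by (simp add: y_def)
    also have "(\<Sum>j<h. (fps_const (if u = j then 1 else 0) - fps_X * a u j) * W j)
      = (\<Sum>j<h. if u = j then W j else 0) - fps_X * (\<Sum>j<h. a u j * W j)"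
    proof -
      have "(fps_const (if u = j then 1 else 0) - fps_X * a u j) * W j
        = (if u = j then W j else 0) - fps_X * (a u j * W j)" for j
        by (simp add: left_diff_distrib mult.assoc)
      then show ?thesis by (simp add: sum_subtractf sum_distrib_left)
    qed
    also have "(\<Sum>j<h. if u = j then W j else 0) = (if u < h then W u else 0)"
      by (simp add: sum.delta)
    finally show ?thesis
      using u W[of u] by (auto simp: algebra_simps less_Suc_eq)
  qed
  define C where "C = Matrix.mat 1 h (\<lambda>(i, j). - (fps_X * a h j))"
  define M where "M = Matrix.mat h h (\<lambda>(i, j). fps_const (if i = j then 1 else 0) - fps_X * a i j)"
  \<comment> \<open>Only the last entry of \<open>B y\<close> survives, so the new matrix is block
    triangular with determinant \<open>P * (P - W h)\<close>.\<close>
  have "replace_col B (B *\<^sub>v y) h = four_block_mat M (0\<^sub>m h 1) C (Matrix.mat 1 1 (\<lambda>_. P - W h))"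
    unfolding replace_col_def
    by (rule eq_matI) (auto simp: C_def M_def B_def four_block_mat_def By[unfolded B_def] less_Suc_eq
        simp del: index_mult_mat_vec)
  then have "Determinant.det (replace_col B (B *\<^sub>v y) h)
     = Determinant.det M * Determinant.det (Matrix.mat 1 1 (\<lambda>_. P - W h))"
    by (simp add: det_four_block_mat_upper_right_zero_col[where n = h] C_def M_def)
  moreover have "Determinant.det (replace_col B (B *\<^sub>v y) h) = vec_index y h * Determinant.det B"
    by (rule cramer_lemma_mat[OF B y]) simp
  moreover have "Determinant.det M = P" by (simp add: M_def P_def char_fps_def a_def)
  moreover have "Determinant.det (Matrix.mat 1 1 (\<lambda>_. P - W h)) = P - W h"
    by (subst det_single) auto
  moreover have "Determinant.det B = char_fps A (Suc h)" by (simp add: B_def char_fps_def a_def)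
  moreover have "vec_index y h = P" by (simp add: y_def)
  ultimately have "P * char_fps A (Suc h) = P * (P - W h)" by simp
  then have "char_fps A (Suc h) = P - W h"
    using assms unfolding P_def by (rule fps_mult_left_cancel_unit[rotated])
  then show ?thesis by (simp add: P_def W_def)
qed

lemma char_fps_nth_0: "fps_nth (char_fps A h) 0 = 1"
  by (induction h) (simp_all add: char_fps_0 char_fps_Suc_aux)

lemma char_fps_Suc:
  "fps_nth (char_fps A (Suc h)) l = fps_nth (char_fps A h) l - walks A h l h"
  by (simp add: char_fps_Suc_aux[OF char_fps_nth_0])

text \<open>Each factor has degree at most 1 in \<open>fps_X\<close>. The vanishing of higher
  coefficients is part of the claim because the induction step for the top coefficient uses
  it.\<close>

lemma fps_nth_prod_linear:
  fixes c d :: "'i \<Rightarrow> 'a::comm_ring_1"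
  assumes "finite S"
  shows "(\<forall>k > card S. fps_nth (\<Prod>i\<in>S. fps_const (c i) - fps_X * fps_const (d i)) k = 0) \<and>
         fps_nth (\<Prod>i\<in>S. fps_const (c i) - fps_X * fps_const (d i)) (card S) = (\<Prod>i\<in>S. - d i)"
  using assms
proof (induction S rule: finite_induct)
  case (insert x S)
  let ?P = "\<Prod>i\<in>S. fps_const (c i) - fps_X * fps_const (d i)"
  have *: "fps_nth ((fps_const (c x) - fps_X * fps_const (d x)) * ?P) (Suc k) =
     c x * fps_nth ?P (Suc k) - d x * fps_nth ?P k" for k
    by (simp add: left_diff_distrib mult.assoc)
  have "fps_nth ((fps_const (c x) - fps_X * fps_const (d x)) * ?P) k = 0" if "k > Suc (card S)" for k
    using that insert.IH * by (cases k) auto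
  then show ?case using insert * by simp
qed auto

lemma char2_minus:
  fixes a :: "'a::comm_ring_1"
  assumes "(1 + 1 :: 'a) = 0"
  shows "- a = a"
proof -
  have "a + a = a * (1 + 1)" by (simp add: distrib_left)
  then have "a + a = 0" using assms by simp
  then show ?thesis by (rule minus_unique)
qed

text \<open>The top coefficient is \<open>det (- A)\<close>. In characteristic 2 neither the signs
  of the permutations nor those of the entries matter, and the permanent remains.\<close>

lemma char_fps_nth_top:
  fixes A :: "nat \<Rightarrow> nat \<Rightarrow> 'a::comm_ring_1"
  assumes char2: "(1 + 1 :: 'a) = 0"
  shows "fps_nth (char_fps A N) N = (\<Sum>p | p permutes {..<N}. \<Prod>i<N. A i (p i))"
proof -
  have "(1 + 1 :: 'a fps) = fps_const (1 + 1)" by simp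
  also have "\<dots> = 0" using char2 by simp
  finally have 2: "(1 + 1 :: 'a fps) = 0" .
  have sgn: "(signof p :: 'a fps) = 1" for p :: "nat \<Rightarrow> nat"
    using char2_minus[OF 2, of 1] by (auto simp: sign_def)
  have "char_fps A N = (\<Sum>p | p permutes {..<N}.
      \<Prod>i<N. fps_const (if i = p i then 1 else 0) - fps_X * fps_const (A i (p i)))"
    unfolding char_fps_def
    by (subst det_def'[of _ N])
       (auto simp: sgn atLeast0LessThan intro!: sum.cong prod.cong dest: permutes_in_image)
  also have "fps_nth \<dots> N = (\<Sum>p | p permutes {..<N}. \<Prod>i<N. - A i (p i))"
  proof -
    have "fps_nth (\<Prod>i<N. fps_const (c i) - fps_X * fps_const (d i)) N = (\<Prod>i<N. - d i)"
      for c d :: "nat \<Rightarrow> 'a"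
      using fps_nth_prod_linear[of "{..<N}" c d] by simp
    then show ?thesis by (simp only: fps_sum_nth)
  qed
  finally show ?thesis by (simp add: char2_minus[OF char2])
qed

text \<open>Removing one orbit \<open>{x, f x}\<close> at a time changes the sum by
  \<open>g x + g x = 0\<close>.\<close>

lemma sum_involution_char2:
  fixes g :: "'b \<Rightarrow> 'a::comm_ring_1"
  assumes "(1 + 1 :: 'a) = 0" "finite S"
    and "\<And>x. x \<in> S \<Longrightarrow> f x \<in> S \<and> f (f x) = x \<and> f x \<noteq> x \<and> g (f x) = g x"
  shows "sum g S = 0"
  using assms(2,3)
proof (induction "card S" arbitrary: S rule: less_induct)
  case less
  show ?case
  proof (cases "S = {}")
    case False
    then obtain x where x: "x \<in> S" by blast
    let ?T = "S - {x, f x}"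
    have fx: "f x \<in> S" "f x \<noteq> x" "g (f x) = g x" "f (f x) = x" using less.prems(2)[OF x] by auto
    have "sum g ?T = 0"
    proof (rule less.hyps)
      show "card ?T < card S" using x less.prems(1) by (intro psubset_card_mono) auto
      show "f y \<in> ?T \<and> f (f y) = y \<and> f y \<noteq> y \<and> g (f y) = g y" if "y \<in> ?T" for y
        using less.prems(2)[of y] that fx by auto
    qed (use less.prems in simp)
    moreover have "sum g S = sum g ?T + (g x + g (f x))"
    proof -
      have "sum g S = sum g ?T + sum g {x, f x}"
        using x fx less.prems(1) by (intro sum.subset_diff) auto
      then show ?thesis using fx by simp
    qed
    moreover have "g x + g x = 0"
      using char2_minus[OF assms(1), of "g x"] by (metis add.right_inverse)
    ultimately show ?thesis using fx by simp
  qed simp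
qed

lemma permanent_symmetric_char2:
  fixes A :: "'b \<Rightarrow> 'b \<Rightarrow> 'a::comm_ring_1"
  assumes "(1 + 1 :: 'a) = 0" "finite S" and sym: "\<And>i j. i \<in> S \<Longrightarrow> j \<in> S \<Longrightarrow> A i j = A j i"
  shows "(\<Sum>p | p permutes S. \<Prod>i\<in>S. A i (p i)) =
         (\<Sum>p | p permutes S \<and> (\<forall>x. p (p x) = x). \<Prod>i\<in>S. A i (p i))"
proof -
  let ?U = "{p. p permutes S}" and ?V = "{p. p permutes S \<and> (\<forall>x. p (p x) = x)}"
  have fin: "finite ?U" by (rule finite_permutations) fact
  have "(\<Sum>p\<in>?U - ?V. \<Prod>i\<in>S. A i (p i)) = 0"
  proof (rule sum_involution_char2[where f = "inv_into UNIV"])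
    fix p assume "p \<in> ?U - ?V"
    then have p: "p permutes S" and np: "\<exists>x. p (p x) \<noteq> x" by auto
    have ip: "inv_into UNIV p permutes S" and ii: "inv_into UNIV (inv_into UNIV p) = p"
      using p by (auto simp: permutes_inv permutes_inv_inv)
    have inj: "p (inv_into UNIV p x) = x" "inv_into UNIV p (p x) = x" for x using permutes_inverses[OF p] by auto
    have ne: "inv_into UNIV p \<noteq> p" using np inj(2) by metis
    have "\<exists>x. inv_into UNIV p (inv_into UNIV p x) \<noteq> x" using np inj by metis
    moreover have "(\<Prod>i\<in>S. A i (inv_into UNIV p i)) = (\<Prod>i\<in>S. A i (p i))"
    proof -
      have "(\<Prod>i\<in>S. A i (inv_into UNIV p i)) = (\<Prod>i\<in>S. A (p i) (inv_into UNIV p (p i)))"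
        using prod.permute[OF p, of "\<lambda>i. A i (inv_into UNIV p i)"] by (simp add: o_def)
      also have "\<dots> = (\<Prod>i\<in>S. A i (p i))"
        using p by (intro prod.cong refl) (simp add: inj sym permutes_in_image)
      finally show ?thesis .
    qed
    ultimately show "inv_into UNIV p \<in> ?U - ?V \<and> inv_into UNIV (inv_into UNIV p) = p \<and> inv_into UNIV p \<noteq> p \<and>
        (\<Prod>i\<in>S. A i (inv_into UNIV p i)) = (\<Prod>i\<in>S. A i (p i))"
      using ip ii ne by auto
  qed (use assms fin in auto)
  then show ?thesis using sum.subset_diff[of ?V ?U "\<lambda>p. \<Prod>i\<in>S. A i (p i)"] fin by auto
qed

section \<open>Polynomials over the two-element field\<close>

text \<open>Multisets of variable indices under addition are the monomials, so this is the
  polynomial ring over the two-element field in infinitely many variables.\<close>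

type_synonym mring = "nat multiset \<Rightarrow>\<^sub>0 bit"

definition coeff_at :: "(nat multiset \<Rightarrow> nat) \<Rightarrow> mring \<Rightarrow> nat \<Rightarrow> bit" where
  "coeff_at \<pi> r q = (\<Sum>m\<in>Poly_Mapping.keys r. if \<pi> m = q then Poly_Mapping.lookup r m else 0)"

lemma mring_char2: "(1 + 1 :: mring) = 0"
proof -
  have "(1 + 1 :: mring) = Poly_Mapping.single 0 (1 + 1)"
    by (simp only: single_add single_one)
  then show ?thesis by simp
qed

lemma coeff_at_superset:
  assumes "finite K" "Poly_Mapping.keys r \<subseteq> K"
  shows "coeff_at \<pi> r q = (\<Sum>m\<in>K. if \<pi> m = q then Poly_Mapping.lookup r m else 0)"
  unfolding coeff_at_def using assms by (intro sum.mono_neutral_left) (auto simp: in_keys_iff)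

lemma coeff_at_add: "coeff_at \<pi> (r + r') q = coeff_at \<pi> r q + coeff_at \<pi> r' q"
proof -
  let ?K = "Poly_Mapping.keys r \<union> Poly_Mapping.keys r'"
  have "Poly_Mapping.keys (r + r') \<subseteq> ?K" by (rule keys_add)
  then have "coeff_at \<pi> (r + r') q =
      (\<Sum>m\<in>?K. if \<pi> m = q then Poly_Mapping.lookup (r + r') m else 0)"
    by (intro coeff_at_superset) auto
  also have "\<dots> = (\<Sum>m\<in>?K. (if \<pi> m = q then Poly_Mapping.lookup r m else 0) +
      (if \<pi> m = q then Poly_Mapping.lookup r' m else 0))"
    by (intro sum.cong refl) (simp only: lookup_add add_0 split: if_split, blast)
  also have "\<dots> = coeff_at \<pi> r q + coeff_at \<pi> r' q"
    unfolding sum.distrib by (intro arg_cong2[of _ _ _ _ "(+)"] coeff_at_superset[symmetric]) auto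
  finally show ?thesis .
qed

lemma coeff_at_0: "coeff_at \<pi> 0 q = 0"
  by (simp add: coeff_at_def)

lemma coeff_at_single: "coeff_at \<pi> (Poly_Mapping.single m c) q = (if \<pi> m = q then c else 0)"
  using coeff_at_superset[of "{m}" "Poly_Mapping.single m c"] by auto

lemma coeff_at_sum: "coeff_at \<pi> (\<Sum>i\<in>I. r i) q = (\<Sum>i\<in>I. coeff_at \<pi> (r i) q)"
  by (induction I rule: infinite_finite_induct) (simp_all add: coeff_at_add coeff_at_0)

lemma mring_sum_singles:
  fixes r :: mring
  shows "r = (\<Sum>m\<in>Poly_Mapping.keys r. Poly_Mapping.single m (Poly_Mapping.lookup r m))"
  by (rule poly_mapping_eqI)
     (auto simp: lookup_sum lookup_single when_def in_keys_iff sum.delta')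

text \<open>This makes computing with classes sound: the class of \<open>m0 + m\<close> is a
  function \<open>tr\<close> of the class of \<open>m\<close>, so multiplication by a monomial moves
  whole classes, possibly merging several. By linearity it is enough to look at single
  monomials.\<close>

lemma coeff_at_monom_mult:
  assumes tr: "\<And>m. \<pi> (m0 + m) = tr (\<pi> m)" and Q: "\<And>m. \<pi> m < Q"
  shows "coeff_at \<pi> (Poly_Mapping.single m0 1 * r) q' =
    (\<Sum>q<Q. if tr q = q' then coeff_at \<pi> r q else 0)"
proof -
  have single: "coeff_at \<pi> (Poly_Mapping.single m0 1 * Poly_Mapping.single m c) q' =
    (\<Sum>q<Q. if tr q = q' then coeff_at \<pi> (Poly_Mapping.single m c) q else 0)" for m c
  proof -
    have "(\<Sum>q<Q. if tr q = q' then coeff_at \<pi> (Poly_Mapping.single m c) q else 0)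
      = (\<Sum>q<Q. if \<pi> m = q then (if tr q = q' then c else 0) else 0)"
      by (intro sum.cong refl) (simp add: coeff_at_single)
    also have "\<dots> = (if tr (\<pi> m) = q' then c else 0)" using Q by (simp add: sum.delta)
    finally show ?thesis by (simp add: mult_single coeff_at_single tr)
  qed
  have "coeff_at \<pi> (Poly_Mapping.single m0 1 * (\<Sum>m\<in>K. Poly_Mapping.single m (c m))) q' =
    (\<Sum>q<Q. if tr q = q' then coeff_at \<pi> (\<Sum>m\<in>K. Poly_Mapping.single m (c m)) q else 0)" for K and c
  proof -
    have "coeff_at \<pi> (Poly_Mapping.single m0 1 * (\<Sum>m\<in>K. Poly_Mapping.single m (c m))) q'
      = (\<Sum>m\<in>K. \<Sum>q<Q. if tr q = q' then coeff_at \<pi> (Poly_Mapping.single m (c m)) q else 0)"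
      by (simp add: sum_distrib_left coeff_at_sum single)
    also have "\<dots> = (\<Sum>q<Q. \<Sum>m\<in>K. if tr q = q' then coeff_at \<pi> (Poly_Mapping.single m (c m)) q else 0)"
      by (rule sum.swap)
    also have "\<dots> = (\<Sum>q<Q. if tr q = q' then coeff_at \<pi> (\<Sum>m\<in>K. Poly_Mapping.single m (c m)) q else 0)"
      by (intro sum.cong refl) (simp add: coeff_at_sum)
    finally show ?thesis .
  qed
  from this[where K = "Poly_Mapping.keys r" and c = "Poly_Mapping.lookup r"] show ?thesis
    unfolding mring_sum_singles[symmetric] .
qed

text \<open>The program stores natural numbers and adds them; only their parities carry
  meaning.\<close>

definition represents :: "nat \<Rightarrow> (nat multiset \<Rightarrow> nat) \<Rightarrow> (nat \<Rightarrow> nat) \<Rightarrow> mring \<Rightarrow> bool" where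
  "represents Q \<pi> v r \<longleftrightarrow> (\<forall>q<Q. of_nat (v q) = coeff_at \<pi> r q)"

lemma represents_add:
  "represents Q \<pi> v r \<Longrightarrow> represents Q \<pi> v' r' \<Longrightarrow> represents Q \<pi> (\<lambda>q. v q + v' q) (r + r')"
  by (simp add: represents_def coeff_at_add)

lemma represents_0: "represents Q \<pi> (\<lambda>_. 0) 0"
  by (simp add: represents_def coeff_at_0)

lemma represents_1:
  assumes "\<pi> {#} = 0"
  shows "represents Q \<pi> (\<lambda>q. if q = 0 then 1 else 0) 1"
  using assms coeff_at_single[of \<pi> 0 1] by (auto simp: represents_def)

lemma represents_monom_mult:
  assumes "represents Q \<pi> v r" "\<And>m. \<pi> (m0 + m) = tr (\<pi> m)" "\<And>m. \<pi> m < Q"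
  shows "represents Q \<pi> (\<lambda>q'. \<Sum>q<Q. if tr q = q' then v q else 0) (Poly_Mapping.single m0 1 * r)"
  unfolding represents_def coeff_at_monom_mult[where \<pi> = \<pi> and tr = tr and Q = Q, OF assms(2,3)]
proof (intro allI impI)
  fix q'
  show "(of_nat (\<Sum>q<Q. if tr q = q' then v q else 0) :: bit) =
     (\<Sum>q<Q. if tr q = q' then coeff_at \<pi> r q else 0)"
    unfolding of_nat_sum using assms(1) by (intro sum.cong refl) (auto simp: represents_def)
qed

lemma of_nat_bit_eq_1: "(of_nat k = (1::bit)) \<longleftrightarrow> odd k"
  by (induction k) (auto)

lemma represents_sum_monoms:
  assumes "represents Q \<pi> v (\<Sum>p\<in>S. Poly_Mapping.single (M p) 1)" "q < Q" "finite S"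
  shows "odd (v q) \<longleftrightarrow> odd (card {p \<in> S. \<pi> (M p) = q})"
proof -
  have "(of_nat (v q) :: bit) = (\<Sum>p\<in>S. if \<pi> (M p) = q then 1 else 0)"
    using assms(1,2) by (simp add: represents_def coeff_at_sum coeff_at_single)
  also have "\<dots> = of_nat (card {p \<in> S. \<pi> (M p) = q})"
    using assms(3) by (simp add: sum.If_cases Int_def)
  finally show ?thesis by (metis of_nat_bit_eq_1)
qed

section \<open>The gadget graph\<close>

text \<open>
  The vertex \<open>pv v u\<close> is the end at \<open>v\<close> of the potential edge \<open>{v, u}\<close>, and \<open>cv v i\<close>, for \<open>i < f v\<close>, is
  a slot of \<open>v\<close>.  Either the two ends of an edge are matched with each other and the edge is not
  chosen, or each end takes a slot.  Slots with \<open>f v \<le> i\<close> and the vertices \<open>pv v v\<close> carry only a loop.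
  If \<open>n \<le> f v\<close> then \<open>v\<close> has \<open>n\<close> slots but fewer than \<open>n\<close> ends, so such degrees need no separate treatment.
\<close>

locale gadget =
  fixes n :: nat and f :: "nat \<Rightarrow> nat" and E :: "nat \<Rightarrow> nat \<Rightarrow> bool"
  assumes E_sym: "E u v \<Longrightarrow> E v u" and E_irrefl: "\<not> E v v"
begin

definition pv :: "nat \<Rightarrow> nat \<Rightarrow> nat" where "pv v u = v * n + u"
definition cv :: "nat \<Rightarrow> nat \<Rightarrow> nat" where "cv v i = n * n + (v * n + i)"
definition var :: "nat \<Rightarrow> nat \<Rightarrow> nat \<Rightarrow> nat" where "var v u i = (v * n + u) * n + i"
definition nv :: nat where "nv = n * n + n * n"

text \<open>Every gadget edge is listed in both orientations and every loop once, in the order in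
  which the program visits them. The arc from \<open>pv v u\<close> to \<open>pv u v\<close> is
  present even without an edge of the graph: it is then the only choice for these two
  vertices.\<close>

definition arcs_at :: "nat \<Rightarrow> nat \<Rightarrow> (nat \<times> nat \<times> nat multiset) list" where
  "arcs_at v u = [(pv v u, pv u v, {#})] @ (if f v \<le> u then [(cv v u, cv v u, {#})] else []) @
     (if E v u then concat (map (\<lambda>i. if i < f v then
         [(pv v u, cv v i, {#var v u i#}), (cv v i, pv v u, {#var v u i#})] else []) [0..<n]) else [])"

definition arcs :: "(nat \<times> nat \<times> nat multiset) list" where
  "arcs = concat (map (\<lambda>v. concat (map (arcs_at v) [0..<n])) [0..<n])"

text \<open>Target first: an arc from \<open>x\<close> to \<open>y\<close> contributes to
  \<open>adj y x\<close>, so that row \<open>y\<close> collects what flows into \<open>y\<close>, in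
  accordance with the recurrence of \<open>walks\<close>.\<close>

definition adj :: "nat \<Rightarrow> nat \<Rightarrow> mring" where
  "adj y x = (\<Sum>(x', y', m) \<leftarrow> arcs. if x' = x \<and> y' = y then Poly_Mapping.single m 1 else 0)"

lemma row_lt: "v < n \<Longrightarrow> u < n \<Longrightarrow> v * n + u < n * n"
proof -
  assume "v < n" "u < n"
  then have "v * n + u < Suc v * n" by simp
  also have "\<dots> \<le> n * n" using \<open>v < n\<close> by (intro mult_le_mono1) simp
  finally show ?thesis .
qed

lemma row_inj: "u < n \<Longrightarrow> u' < n \<Longrightarrow> v * n + u = v' * n + u' \<longleftrightarrow> v = v' \<and> u = u'"
proof -
  assume *: "u < n" "u' < n"
  then have "(v * n + u) div n = v" "(v * n + u) mod n = u" "(v' * n + u') div n = v'" "(v' * n + u') mod n = u'"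
    by auto
  then show ?thesis by metis
qed

lemma pv_inj: "u < n \<Longrightarrow> u' < n \<Longrightarrow> pv v u = pv v' u' \<longleftrightarrow> v = v' \<and> u = u'"
  by (simp add: pv_def row_inj)

lemma cv_inj: "u < n \<Longrightarrow> u' < n \<Longrightarrow> cv v u = cv v' u' \<longleftrightarrow> v = v' \<and> u = u'"
  by (simp add: cv_def row_inj)

lemma var_inj: "u < n \<Longrightarrow> u' < n \<Longrightarrow> i < n \<Longrightarrow> i' < n \<Longrightarrow>
   var v u i = var v' u' i' \<longleftrightarrow> v = v' \<and> u = u' \<and> i = i'"
  by (auto simp add: var_def row_inj)

lemma pv_neq_cv: "v < n \<Longrightarrow> u < n \<Longrightarrow> pv v u \<noteq> cv v' i" "v < n \<Longrightarrow> u < n \<Longrightarrow> cv v' i \<noteq> pv v u"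
  using row_lt[of v u] by (auto simp: pv_def cv_def)

lemma pv_lt: "v < n \<Longrightarrow> u < n \<Longrightarrow> pv v u < nv"
  using row_lt[of v u] by (auto simp: pv_def nv_def)

lemma cv_lt: "v < n \<Longrightarrow> u < n \<Longrightarrow> cv v u < nv"
  using row_lt[of v u] by (auto simp: cv_def nv_def)

lemma row_cases:
  assumes "x < n * n"
  obtains v u where "v < n" "u < n" "x = v * n + u"
proof (rule that)
  have "n > 0" using assms by (cases n) auto
  show "x div n < n" using assms by (simp add: less_mult_imp_div_less)
  show "x mod n < n" using \<open>n > 0\<close> by simp
qed simp

lemma vertex_cases:
  assumes "x < nv"
  obtains v u where "v < n" "u < n" "x = pv v u" | v i where "v < n" "i < n" "x = cv v i"
proof (cases "x < n * n")
  case True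
  then show ?thesis by (rule row_cases) (auto simp: pv_def intro: that(1))
next
  case False
  then have "x - n * n < n * n" using assms by (auto simp: nv_def)
  then obtain v i where "v < n" "i < n" "x - n * n = v * n + i" by (rule row_cases)
  with False have "x = cv v i" by (auto simp: cv_def)
  with \<open>v < n\<close> \<open>i < n\<close> show ?thesis by (rule that(2))
qed

lemma sum_list_arcs:
  fixes g :: "nat \<times> nat \<times> nat multiset \<Rightarrow> 'b::comm_monoid_add"
  shows "sum_list (map g arcs) = (\<Sum>v<n. \<Sum>u<n. g (pv v u, pv u v, {#}) +
     ((if f v \<le> u then g (cv v u, cv v u, {#}) else 0) +
      (if E v u then \<Sum>i<n. if i < f v then g (pv v u, cv v i, {#var v u i#}) +
           g (cv v i, pv v u, {#var v u i#}) else 0 else 0)))"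
proof -
  have *: "sum_list (map g (concat (map h [0..<k]))) = (\<Sum>i<k. sum_list (map g (h i)))" for h k
    by (induction k) simp_all
  show ?thesis
    unfolding arcs_def * arcs_at_def
    by (intro sum.cong refl) (auto simp: * if_distrib[of "\<lambda>l. sum_list (map g l)"] cong: if_cong)
qed

lemma sum2_delta:
  fixes h :: "nat \<Rightarrow> nat \<Rightarrow> 'b::comm_monoid_add"
  shows "(\<Sum>v<n. \<Sum>u<n. if v = a \<and> u = b then h v u else 0) = (if a < n \<and> b < n then h a b else 0)"
proof -
  have "(\<Sum>u<n. if v = a \<and> u = b then h v u else 0) = (if v = a then (if b < n then h a b else 0) else 0)" for v
    by (simp add: sum.delta)
  then show ?thesis by (simp add: sum.delta)
qed

lemma adj_pp:
  assumes "v0 < n" "u0 < n" "v1 < n" "u1 < n"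
  shows "adj (pv v1 u1) (pv v0 u0) = (if v1 = u0 \<and> u1 = v0 then 1 else 0)"
proof -
  have "adj (pv v1 u1) (pv v0 u0) =
     (\<Sum>v<n. \<Sum>u<n. if v = v0 \<and> u = u0 then (if v1 = u \<and> u1 = v then 1 else 0) else 0)"
    unfolding adj_def sum_list_arcs
  proof (intro sum.cong refl, unfold prod.case, goal_cases)
    case (1 v u)
    then have vu: "v < n" "u < n" by simp_all
    have e1: "(pv v u = pv v0 u0 \<and> pv u v = pv v1 u1) \<longleftrightarrow> (v = v0 \<and> u = u0) \<and> (v1 = u \<and> u1 = v)"
      by (simp only: pv_inj vu assms) blast
    have e2: "(cv v i = pv v0 u0) = False" "(cv v i = pv v1 u1) = False" for v i
      using assms by (simp_all add: pv_neq_cv)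
    show ?case unfolding e1 e2
      by (simp only: simp_thms if_False sum.neutral_const add_0_right single_one if_cancel split: if_split) blast
  qed
  also have "\<dots> = (if v1 = u0 \<and> u1 = v0 then 1 else 0)"
    unfolding sum2_delta using assms by simp
  finally show ?thesis .
qed

lemma adj_cc:
  assumes "v0 < n" "u0 < n" "v1 < n" "u1 < n"
  shows "adj (cv v1 u1) (cv v0 u0) = (if v1 = v0 \<and> u1 = u0 \<and> f v0 \<le> u0 then 1 else 0)"
proof -
  have "adj (cv v1 u1) (cv v0 u0) =
     (\<Sum>v<n. \<Sum>u<n. if v = v0 \<and> u = u0 then (if v1 = v \<and> u1 = u \<and> f v \<le> u then 1 else 0) else 0)"
    unfolding adj_def sum_list_arcs
  proof (intro sum.cong refl, unfold prod.case, goal_cases)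
    case (1 v u)
    then have vu: "v < n" "u < n" by simp_all
    have e1: "(cv v u = cv v0 u0 \<and> cv v u = cv v1 u1) \<longleftrightarrow> (v = v0 \<and> u = u0) \<and> (v1 = v \<and> u1 = u)"
      by (simp only: cv_inj vu assms) blast
    have e2: "(pv v u = cv v0 u0) = False" "(pv v u = cv v1 u1) = False"
      using vu by (simp_all add: pv_neq_cv)
    show ?case unfolding e1 e2
      by (simp only: simp_thms if_False sum.neutral_const add_0_right add_0_left single_one if_cancel split: if_split) blast
  qed
  also have "\<dots> = (if v1 = v0 \<and> u1 = u0 \<and> f v0 \<le> u0 then 1 else 0)"
    unfolding sum2_delta using assms by simp
  finally show ?thesis .
qed

lemma adj_cp:
  assumes "v0 < n" "u0 < n" "v1 < n" "i1 < n"
  shows "adj (cv v1 i1) (pv v0 u0) =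
    (if v1 = v0 \<and> E v0 u0 \<and> i1 < f v0 then Poly_Mapping.single {#var v0 u0 i1#} 1 else 0)"
proof -
  have inner: "(\<Sum>i<n. if i < f v then (if pv v u = pv v0 u0 \<and> cv v i = cv v1 i1 then g i else 0) +
        (if cv v i = pv v0 u0 \<and> pv v u = cv v1 i1 then g i else 0) else 0) =
      (if v = v0 \<and> u = u0 \<and> v1 = v \<and> i1 < f v then g i1 else 0)" (is "?L = ?R")
    if "v < n" "u < n" for v u and g :: "nat \<Rightarrow> mring"
  proof -
    have "?L = (\<Sum>i<n. if i = i1 then ?R else 0)"
    proof (intro sum.cong refl, goal_cases)
      case (1 i)
      then have i: "i < n" by simp
      have e1: "(pv v u = pv v0 u0 \<and> cv v i = cv v1 i1) \<longleftrightarrow> v = v0 \<and> u = u0 \<and> v1 = v \<and> i = i1"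
        by (simp only: pv_inj cv_inj that assms i) blast
      have e2: "(cv v i = pv v0 u0) = False" by (simp only: pv_neq_cv that assms)
      show ?case unfolding e1 e2
        by (cases "i = i1") (simp_all only: simp_thms if_True if_False add_0_right if_cancel split: if_split, blast)
    qed
    then show ?thesis using assms by (simp add: sum.delta)
  qed
  have "adj (cv v1 i1) (pv v0 u0) =
     (\<Sum>v<n. \<Sum>u<n. if v = v0 \<and> u = u0 then
       (if v1 = v \<and> E v u \<and> i1 < f v then Poly_Mapping.single {#var v u i1#} 1 else 0) else 0)"
    unfolding adj_def sum_list_arcs
  proof (intro sum.cong refl, unfold prod.case, goal_cases)
    case (1 v u)
    then have vu: "v < n" "u < n" by simp_all
    have e: "(pv u v = cv v1 i1) = False" "(cv v u = pv v0 u0) = False"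
      by (simp_all only: pv_neq_cv vu assms)
    show ?case unfolding inner[OF vu] e
      by (simp only: simp_thms if_False add_0_right add_0_left if_cancel split: if_split) blast
  qed
  also have "\<dots> = (if v1 = v0 \<and> E v0 u0 \<and> i1 < f v0 then Poly_Mapping.single {#var v0 u0 i1#} 1 else 0)"
    unfolding sum2_delta using assms by simp
  finally show ?thesis .
qed

lemma adj_pc:
  assumes "v0 < n" "i0 < n" "v1 < n" "u1 < n"
  shows "adj (pv v1 u1) (cv v0 i0) =
    (if v1 = v0 \<and> E v0 u1 \<and> i0 < f v0 then Poly_Mapping.single {#var v0 u1 i0#} 1 else 0)"
proof -
  have inner: "(\<Sum>i<n. if i < f v then (if pv v u = cv v0 i0 \<and> cv v i = pv v1 u1 then g i else 0) +
        (if cv v i = cv v0 i0 \<and> pv v u = pv v1 u1 then g i else 0) else 0) =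
      (if v = v1 \<and> u = u1 \<and> v0 = v \<and> i0 < f v then g i0 else 0)" (is "?L = ?R")
    if "v < n" "u < n" for v u and g :: "nat \<Rightarrow> mring"
  proof -
    have "?L = (\<Sum>i<n. if i = i0 then ?R else 0)"
    proof (intro sum.cong refl, goal_cases)
      case (1 i)
      then have i: "i < n" by simp
      have e1: "(cv v i = cv v0 i0 \<and> pv v u = pv v1 u1) \<longleftrightarrow> v = v1 \<and> u = u1 \<and> v0 = v \<and> i = i0"
        by (simp only: pv_inj cv_inj that assms i) blast
      have e2: "(pv v u = cv v0 i0) = False" by (simp only: pv_neq_cv that assms)
      show ?case unfolding e1 e2
        by (cases "i = i0") (simp_all only: simp_thms if_True if_False add_0_left if_cancel split: if_split, blast)
    qed
    then show ?thesis using assms by (simp add: sum.delta)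
  qed
  have "adj (pv v1 u1) (cv v0 i0) =
     (\<Sum>v<n. \<Sum>u<n. if v = v1 \<and> u = u1 then
       (if v0 = v \<and> E v u \<and> i0 < f v then Poly_Mapping.single {#var v u i0#} 1 else 0) else 0)"
    unfolding adj_def sum_list_arcs
  proof (intro sum.cong refl, unfold prod.case, goal_cases)
    case (1 v u)
    then have vu: "v < n" "u < n" by simp_all
    have e: "(pv v u = cv v0 i0) = False" "(cv v u = pv v1 u1) = False"
      by (simp_all only: pv_neq_cv vu assms)
    have i: "(\<Sum>i<n. if i < f v then (if False \<and> cv v i = pv v1 u1 then g i else 0) +
        (if cv v i = cv v0 i0 \<and> pv v u = pv v1 u1 then g i else 0) else 0) =
      (if v = v1 \<and> u = u1 \<and> v0 = v \<and> i0 < f v then g i0 else 0)" for g :: "nat \<Rightarrow> mring"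
      using inner[OF vu, of g] unfolding e .
    show ?case unfolding e i
      by (simp only: simp_thms if_False add_0_right add_0_left if_cancel split: if_split) blast
  qed
  also have "\<dots> = (if v1 = v0 \<and> E v0 u1 \<and> i0 < f v0 then Poly_Mapping.single {#var v0 u1 i0#} 1 else 0)"
    unfolding sum2_delta using assms by auto
  finally show ?thesis .
qed

lemma adj_sym:
  assumes "x < nv" "y < nv"
  shows "adj x y = adj y x"
  using assms
  by (elim vertex_cases; simp only: adj_pp adj_cc adj_cp adj_pc; metis)

section \<open>Pairings of the gadget and their monomials\<close>

definition pairings :: "(nat \<Rightarrow> nat) set" where
  "pairings = {p. p permutes {..<nv} \<and> (\<forall>x. p (p x) = x) \<and> (\<forall>x<nv. adj x (p x) \<noteq> 0)}"

text \<open>Recorded from the side of the ends only, so each variable occurs once although its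
  gadget edge is met twice.\<close>

definition used :: "(nat \<Rightarrow> nat) \<Rightarrow> nat set" where
  "used p = {var v u i |v u i. v < n \<and> u < n \<and> i < n \<and> p (pv v u) = cv v i}"

lemma finite_pairings: "finite pairings"
  by (rule finite_subset[OF _ finite_permutations[of "{..<nv}"]]) (auto simp: pairings_def)

lemma pairing_pv:
  assumes "p \<in> pairings" "v < n" "u < n"
  shows "p (pv v u) = pv u v \<or> (\<exists>i<n. i < f v \<and> E v u \<and> p (pv v u) = cv v i)"
proof -
  have x: "pv v u < nv" using assms pv_lt by blast
  have "p (pv v u) < nv" "adj (pv v u) (p (pv v u)) \<noteq> 0"
    using assms x permutes_in_image[of p "{..<nv}" "pv v u"] by (auto simp: pairings_def)
  then show ?thesis
    using assms(2,3) by (elim vertex_cases) (auto simp: adj_pp adj_pc split: if_splits)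
qed

lemma pairing_cv:
  assumes "p \<in> pairings" "v < n" "i < n"
  shows "f v \<le> i \<and> p (cv v i) = cv v i \<or> i < f v \<and> (\<exists>u<n. E v u \<and> p (cv v i) = pv v u)"
proof -
  have x: "cv v i < nv" using assms cv_lt by blast
  have "p (cv v i) < nv" "adj (cv v i) (p (cv v i)) \<noteq> 0"
    using assms x permutes_in_image[of p "{..<nv}" "cv v i"] by (auto simp: pairings_def)
  then show ?thesis
    using assms(2,3) by (elim vertex_cases) (auto simp: adj_cc adj_cp split: if_splits)
qed

lemma pairing_flip:
  assumes "p \<in> pairings"
  shows "p x = y \<longleftrightarrow> p y = x"
  using assms by (auto simp: pairings_def)

lemma prod_single:
  "(\<Prod>k\<in>K. Poly_Mapping.single (m k) 1 :: mring) = Poly_Mapping.single (\<Sum>k\<in>K. m k) 1"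
  by (induction K rule: infinite_finite_induct) (simp_all add: mult_single)

lemma prod_vertices:
  fixes g :: "nat \<Rightarrow> 'b::comm_monoid_mult"
  shows "(\<Prod>x<nv. g x) = (\<Prod>(v, u)\<in>{..<n} \<times> {..<n}. g (pv v u)) * (\<Prod>(v, i)\<in>{..<n} \<times> {..<n}. g (cv v i))"
proof -
  let ?D = "{..<n} \<times> {..<n}"
  let ?P = "(\<lambda>(v, u). pv v u) ` ?D" and ?C = "(\<lambda>(v, u). cv v u) ` ?D"
  have "{..<nv} = ?P \<union> ?C"
  proof (intro equalityI subsetI)
    fix x assume "x \<in> {..<nv}"
    then have "x < nv" by simp
    then show "x \<in> ?P \<union> ?C" by (rule vertex_cases) force+
  qed (auto intro: pv_lt cv_lt)
  moreover have "?P \<inter> ?C = {}" by (auto simp: pv_neq_cv)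
  ultimately have "(\<Prod>x<nv. g x) = prod g ?P * prod g ?C"
    by (simp add: prod.union_disjoint)
  moreover have "inj_on (\<lambda>(v, u). pv v u) ?D" "inj_on (\<lambda>(v, u). cv v u) ?D"
    by (auto simp: inj_on_def pv_inj cv_inj)
  ultimately show ?thesis
    by (simp add: prod.reindex case_prod_beta')
qed

lemma used_eq: "used p = (\<lambda>(v, u, i). var v u i) ` {(v, u, i). v < n \<and> u < n \<and> i < n \<and> p (pv v u) = cv v i}"
  unfolding used_def by force

lemma finite_triples: "finite {(v, u, i). v < n \<and> u < n \<and> i < n \<and> P v u i}"
  by (rule finite_subset[of _ "{..<n} \<times> {..<n} \<times> {..<n}"]) auto

lemma inj_on_var: "inj_on (\<lambda>(v, u, i). var v u i) {(v, u, i). v < n \<and> u < n \<and> i < n \<and> P v u i}"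
  by (auto simp: inj_on_def var_inj)

lemma finite_used: "finite (used p)"
  unfolding used_eq by (intro finite_imageI finite_triples)

lemma mset_used:
  "mset_set (used p) = (\<Sum>(v, u, i)\<in>{..<n} \<times> {..<n} \<times> {..<n}. if p (pv v u) = cv v i then {#var v u i#} else {#})"
proof -
  let ?T = "{(v, u, i). v < n \<and> u < n \<and> i < n \<and> p (pv v u) = cv v i}"
  let ?D = "{..<n} \<times> {..<n} \<times> {..<n}"
  have T: "?T = {x \<in> ?D. case x of (v, u, i) \<Rightarrow> p (pv v u) = cv v i}" by auto
  have "mset_set (used p) = (\<Sum>e\<in>used p. {#e#})"
    by (simp only: sum_multiset_singleton)
  also have "\<dots> = (\<Sum>x\<in>?T. {#case x of (v, u, i) \<Rightarrow> var v u i#})"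
    unfolding used_eq by (subst sum.reindex[OF inj_on_var]) (simp only: o_def)
  also have "\<dots> = (\<Sum>x\<in>?D. if case x of (v, u, i) \<Rightarrow> p (pv v u) = cv v i
      then {#case x of (v, u, i) \<Rightarrow> var v u i#} else {#})"
    unfolding T by (rule sum.inter_filter) simp
  also have "\<dots> = (\<Sum>(v, u, i)\<in>?D. if p (pv v u) = cv v i then {#var v u i#} else {#})"
    by (intro sum.cong refl) (simp split: prod.splits)
  finally show ?thesis .
qed

text \<open>A gadget edge between an end and a slot contributes its variable once in the row of the
  end and once in the row of the slot; all other entries of the product are 1.\<close>

lemma prod_pairing:
  assumes p: "p \<in> pairings"
  shows "(\<Prod>x<nv. adj x (p x)) = Poly_Mapping.single (mset_set (used p) + mset_set (used p)) 1"
proof -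
  have P: "adj (pv v u) (p (pv v u)) =
     Poly_Mapping.single (\<Sum>i<n. if p (pv v u) = cv v i then {#var v u i#} else {#}) 1"
    if vu: "v < n" "u < n" for v u
    using pairing_pv[OF p vu]
  proof
    assume "p (pv v u) = pv u v"
    then show ?thesis using vu by (simp add: pv_neq_cv adj_pp)
  next
    assume "\<exists>i<n. i < f v \<and> E v u \<and> p (pv v u) = cv v i"
    then obtain i where i: "i < n" "i < f v" "E v u" "p (pv v u) = cv v i" by blast
    have "(\<Sum>j<n. if p (pv v u) = cv v j then {#var v u j#} else {#}) =
      (\<Sum>j<n. if i = j then {#var v u j#} else {#})"
      using i by (intro sum.cong refl) (auto simp: cv_inj)
    then show ?thesis using vu i by (simp add: adj_pc sum.delta)
  qed
  have C: "adj (cv v i) (p (cv v i)) =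
     Poly_Mapping.single (\<Sum>u<n. if p (pv v u) = cv v i then {#var v u i#} else {#}) 1"
    if vi: "v < n" "i < n" for v i
    using pairing_cv[OF p vi]
  proof
    assume *: "f v \<le> i \<and> p (cv v i) = cv v i"
    then have "p (pv v u) \<noteq> cv v i" if "u < n" for u
      using pairing_flip[OF p, of "pv v u" "cv v i"] that vi by (auto simp: pv_neq_cv)
    then have "(\<Sum>u<n. if p (pv v u) = cv v i then {#var v u i#} else {#}) = 0"
      by (intro sum.neutral) auto
    then show ?thesis using vi * by (simp add: adj_cc)
  next
    assume "i < f v \<and> (\<exists>u<n. E v u \<and> p (cv v i) = pv v u)"
    then obtain u where u: "u < n" "i < f v" "E v u" "p (cv v i) = pv v u" by blast
    have "(\<Sum>j<n. if p (pv v j) = cv v i then {#var v j i#} else {#}) =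
      (\<Sum>j<n. if u = j then {#var v j i#} else {#})"
      using u pairing_flip[OF p, of _ "cv v i"] by (intro sum.cong refl) (auto simp: pv_inj)
    then show ?thesis using vi u by (simp add: adj_cp sum.delta)
  qed
  let ?D = "{..<n} \<times> {..<n}"
  \<comment> \<open>The same variables are summed twice: by ends in \<open>mP\<close> and by slots
    in \<open>mC\<close>.\<close>
  define mP where "mP = (\<lambda>(v, u). \<Sum>i<n. if p (pv v u) = cv v i then {#var v u i#} else {#})"
  define mC where "mC = (\<lambda>(v, i). \<Sum>u<n. if p (pv v u) = cv v i then {#var v u i#} else {#})"
  have "(\<Prod>(v, u)\<in>?D. adj (pv v u) (p (pv v u))) = (\<Prod>x\<in>?D. Poly_Mapping.single (mP x) 1)"
    by (intro prod.cong refl) (auto simp: P mP_def)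
  moreover have "(\<Prod>(v, i)\<in>?D. adj (cv v i) (p (cv v i))) = (\<Prod>x\<in>?D. Poly_Mapping.single (mC x) 1)"
    by (intro prod.cong refl) (auto simp: C mC_def)
  moreover have "sum mP ?D = mset_set (used p)"
    unfolding mset_used mP_def sum.cartesian_product[symmetric] ..
  moreover have "sum mC ?D = mset_set (used p)"
    unfolding mset_used mC_def sum.cartesian_product[symmetric]
    by (rule sum.cong[OF refl], rule sum.swap)
  ultimately show ?thesis unfolding prod_vertices by (simp only: prod_single mult_single mult_1)
qed

theorem char_fps_adj_top:
  "fps_nth (char_fps adj nv) nv = (\<Sum>p\<in>pairings. Poly_Mapping.single (mset_set (used p) + mset_set (used p)) 1)"
proof -
  have "fps_nth (char_fps adj nv) nv =
     (\<Sum>p | p permutes {..<nv} \<and> (\<forall>x. p (p x) = x). \<Prod>x<nv. adj x (p x))"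
    unfolding char_fps_nth_top[OF mring_char2]
    by (rule permanent_symmetric_char2[OF mring_char2]) (simp_all add: adj_sym)
  also have "\<dots> = (\<Sum>p\<in>pairings. \<Prod>x<nv. adj x (p x))"
    by (rule sum.mono_neutral_right)
       (auto simp: pairings_def intro: finite_subset[OF _ finite_permutations[of "{..<nv}"]] prod_zero)
  finally show ?thesis by (simp add: prod_pairing)
qed

end

section \<open>Pairings against factors of the given graph\<close>

context gadget begin

definition chosen :: "(nat \<Rightarrow> nat) \<Rightarrow> nat set set" where
  "chosen p = {{v, u} |v u. v < n \<and> u < n \<and> (\<exists>i<n. p (pv v u) = cv v i)}"

definition all_edges :: "nat set set" where
  "all_edges = {{v, u} |v u. v < n \<and> u < n \<and> E v u}"

text \<open>If one end of an edge takes a slot, the opposite end is not matched with it, and apart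
  from that partner it can only take a slot, too.\<close>

lemma link_sym:
  assumes "p \<in> pairings" "v < n" "u < n" "\<exists>i<n. p (pv v u) = cv v i"
  shows "\<exists>i<n. p (pv u v) = cv u i"
  using pairing_pv[OF assms(1,3,2)]
proof
  assume "p (pv u v) = pv v u"
  then have "p (pv v u) = pv u v" using pairing_flip[OF assms(1)] by blast
  then show ?thesis using assms(4) pv_neq_cv(1)[OF assms(3,2)] by simp
qed blast

lemma link_E:
  assumes "p \<in> pairings" "v < n" "u < n" "i < n" "p (pv v u) = cv v i"
  shows "E v u \<and> i < f v"
  using pairing_pv[OF assms(1-3)]
proof
  assume "p (pv v u) = pv u v"
  then show ?thesis using assms(5) pv_neq_cv(1)[OF assms(3,2), of v i] by simp
next
  assume "\<exists>i<n. i < f v \<and> E v u \<and> p (pv v u) = cv v i"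
  then obtain j where "j < n" "j < f v" "E v u" "cv v j = cv v i" using assms(5) by auto
  then show ?thesis using assms(4) cv_inj by blast
qed

lemma mem_chosen:
  assumes "p \<in> pairings" "v < n" "u < n"
  shows "{v, u} \<in> chosen p \<longleftrightarrow> (\<exists>i<n. p (pv v u) = cv v i)"
proof
  assume "{v, u} \<in> chosen p"
  then obtain a b where ab: "{v, u} = {a, b}" "a < n" "b < n" "\<exists>i<n. p (pv a b) = cv a i"
    unfolding chosen_def by blast
  then have "v = a \<and> u = b \<or> v = b \<and> u = a" by (simp add: doubleton_eq_iff)
  then show "\<exists>i<n. p (pv v u) = cv v i"
    using ab(4) link_sym[OF assms(1) ab(2,3,4)] by (elim disjE) simp_all
qed (use assms chosen_def in blast)

lemma chosen_subset:
  assumes "p \<in> pairings"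
  shows "chosen p \<subseteq> all_edges"
  unfolding chosen_def all_edges_def using link_E[OF assms] by blast

lemma incident_eq:
  assumes "F \<subseteq> all_edges" "v < n"
  shows "{e \<in> F. v \<in> e} = (\<lambda>u. {v, u}) ` {u. u < n \<and> {v, u} \<in> F}"
proof (intro equalityI subsetI)
  fix e assume e: "e \<in> {e \<in> F. v \<in> e}"
  then obtain a b where ab: "e = {a, b}" "a < n" "b < n" using assms unfolding all_edges_def by blast
  then consider "e = {v, a}" | "e = {v, b}" using e by blast
  then show "e \<in> (\<lambda>u. {v, u}) ` {u. u < n \<and> {v, u} \<in> F}"
  proof cases
    case 1
    with e ab show ?thesis by (intro image_eqI[of _ _ a]) simp_all
  next
    case 2
    with e ab show ?thesis by (intro image_eqI[of _ _ b]) simp_all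
  qed
qed blast

lemma card_incident:
  assumes "F \<subseteq> all_edges" "v < n"
  shows "card {e \<in> F. v \<in> e} = card {u. u < n \<and> {v, u} \<in> F}"
  unfolding incident_eq[OF assms]
  by (rule card_image) (auto simp: inj_on_def doubleton_eq_iff)

lemma edge_neq:
  assumes "F \<subseteq> all_edges" "{v, u} \<in> F"
  shows "v \<noteq> u"
proof
  assume "v = u"
  with assms obtain a b where ab: "{v} = {a, b}" "E a b" unfolding all_edges_def by auto
  then have "a = b" by auto
  with ab E_irrefl show False by blast
qed

lemma neighbours_card_lt:
  assumes "F \<subseteq> all_edges" "v < n"
  shows "card {u. u < n \<and> {v, u} \<in> F} < n"
proof -
  have "{u. u < n \<and> {v, u} \<in> F} \<subseteq> {..<n} - {v}" using edge_neq[OF assms(1)] by blast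
  then have "card {u. u < n \<and> {v, u} \<in> F} \<le> card ({..<n} - {v})" by (intro card_mono) auto
  also have "\<dots> < n" using assms(2) by simp
  finally show ?thesis .
qed

text \<open>The pairing restricts to a bijection between the active slots of \<open>v\<close> and
  its chosen neighbours.\<close>

lemma chosen_degree:
  assumes p: "p \<in> pairings" and v: "v < n"
  shows "card {e \<in> chosen p. v \<in> e} = f v"
proof -
  let ?U = "{u. u < n \<and> {v, u} \<in> chosen p}" and ?I = "{i. i < n \<and> i < f v}"
  define h where "h i = p (cv v i) - v * n" for i
  have h: "h i < n" "p (cv v i) = pv v (h i)" "{v, h i} \<in> chosen p" if i: "i \<in> ?I" for i
  proof -
    obtain u where u: "u < n" "p (cv v i) = pv v u" using pairing_cv[OF p v, of i] i unfolding mem_Collect_eq not_less[symmetric] by blast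
    then have "h i = u" by (simp add: h_def pv_def)
    moreover have "p (pv v u) = cv v i" using pairing_flip[OF p] u by blast
    moreover from this have "{v, u} \<in> chosen p" using mem_chosen[OF p v u(1)] i by blast
    ultimately show "h i < n" "p (cv v i) = pv v (h i)" "{v, h i} \<in> chosen p"
      using u by (simp_all only:)
  qed
  have "bij_betw h ?I ?U"
    unfolding bij_betw_def
  proof (intro conjI equalityI subsetI inj_onI)
    fix i j assume ij: "i \<in> ?I" "j \<in> ?I" "h i = h j"
    then have "p (cv v i) = p (cv v j)" using h(2)[OF ij(1)] h(2)[OF ij(2)] by (simp only:)
    then have "p (p (cv v i)) = p (p (cv v j))" by (simp only:)
    then have "cv v i = cv v j" using p by (simp add: pairings_def)
    then show "i = j" using ij cv_inj by blast
  next
    fix u assume u: "u \<in> ?U"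
    then obtain i where i: "i < n" "p (pv v u) = cv v i" using mem_chosen[OF p v] by blast
    then have "i < f v" using link_E[OF p v] u by blast
    moreover have "p (cv v i) = pv v u" using pairing_flip[OF p] i by blast
    ultimately show "u \<in> h ` ?I" using i by (intro image_eqI[of _ _ i]) (simp_all add: h_def pv_def)
  qed (use h in blast)
  then have card: "card ?I = card ?U" by (rule bij_betw_same_card)
  \<comment> \<open>There are \<open>min n (f v)\<close> active slots but fewer than
    \<open>n\<close> neighbours, so the minimum must be \<open>f v\<close>.\<close>
  have "card ?U < n" by (rule neighbours_card_lt[OF chosen_subset[OF p] v])
  moreover have "card ?I = min n (f v)"
  proof -
    have "?I = {..<min n (f v)}" by auto
    then show ?thesis by simp
  qed
  ultimately have "card ?U = f v" using card by simp
  then show ?thesis by (simp add: card_incident[OF chosen_subset[OF p] v])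
qed

lemma mem_used:
  assumes "v < n" "u < n" "i < n"
  shows "var v u i \<in> used p \<longleftrightarrow> p (pv v u) = cv v i"
proof
  assume "var v u i \<in> used p"
  then obtain v' u' i' where *: "var v u i = var v' u' i'" "v' < n" "u' < n" "i' < n" "p (pv v' u') = cv v' i'"
    unfolding used_def by blast
  then have "v = v' \<and> u = u' \<and> i = i'" using var_inj[of u u' i i' v v'] assms by simp
  then show "p (pv v u) = cv v i" using *(5) by simp
next
  assume "p (pv v u) = cv v i"
  then show "var v u i \<in> used p" unfolding used_def using assms by blast
qed

text \<open>The used variables fix the partners of all ends that take a slot, and hence of the
  active slots; an end that takes none can only face its opposite end, and an idle slot only its
  loop. So a unique set of minimum weight isolates a single pairing.\<close>

lemma used_inj: "inj_on used pairings"
proof (rule inj_onI, rule ext)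
  fix p p' x assume p: "p \<in> pairings" and p': "p' \<in> pairings" and eq: "used p = used p'"
  have link: "p (pv v u) = cv v i \<longleftrightarrow> p' (pv v u) = cv v i" if "v < n" "u < n" "i < n" for v u i
    using mem_used[OF that, of p] mem_used[OF that, of p'] eq by simp
  show "p x = p' x"
  proof (cases "x < nv")
    case True
    then show ?thesis
    proof (cases rule: vertex_cases)
      case (1 v u)
      show ?thesis
      proof (cases "\<exists>i<n. p (pv v u) = cv v i")
        case True
        then obtain i where i: "i < n" "p (pv v u) = cv v i" by blast
        then have "p' (pv v u) = cv v i" using link[OF 1(1,2)] by blast
        then show ?thesis using i by (simp only: 1(3))
      next
        case False
        then have "\<not> (\<exists>i<n. p' (pv v u) = cv v i)" using link[OF 1(1,2)] by blast
        with False have "p (pv v u) = pv u v" "p' (pv v u) = pv u v"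
          using pairing_pv[OF p 1(1,2)] pairing_pv[OF p' 1(1,2)] by blast+
        then show ?thesis by (simp only: 1(3))
      qed
    next
      case (2 v i)
      show ?thesis
      proof (cases "i < f v")
        case True
        then obtain u where u: "u < n" "p (cv v i) = pv v u"
          using pairing_cv[OF p 2(1,2)] unfolding not_less[symmetric] by blast
        then have "p (pv v u) = cv v i" using pairing_flip[OF p] by blast
        then have "p' (pv v u) = cv v i" using link 2 u by blast
        then have "p' (cv v i) = pv v u" using pairing_flip[OF p'] by blast
        then show ?thesis using u by (simp only: 2(3))
      next
        case False
        then have "p (cv v i) = cv v i" "p' (cv v i) = cv v i"
          using pairing_cv[OF p 2(1,2)] pairing_cv[OF p' 2(1,2)] by blast+
        then show ?thesis by (simp only: 2(3))
      qed
    qed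
  next
    case False
    then show ?thesis
      using p p' permutes_not_in[of p "{..<nv}" x] permutes_not_in[of p' "{..<nv}" x] by (simp add: pairings_def)
  qed
qed

lemma var_lt:
  assumes "v < n" "u < n" "i < n"
  shows "var v u i < n * n * n"
proof -
  have "var v u i < Suc (v * n + u) * n" using assms by (simp add: var_def)
  also have "\<dots> \<le> n * n * n" using row_lt[OF assms(1,2)] by (intro mult_le_mono1) simp
  finally show ?thesis .
qed

lemma used_subset: "used p \<subseteq> {..<n * n * n}"
  unfolding used_def using var_lt by blast

text \<open>A chosen edge uses two variables, one at each of its ends. Admitting only
  \<open>v < u\<close> counts it once.\<close>

lemma card_used_filter:
  assumes p: "p \<in> pairings"
    and P: "\<And>v u i. v < n \<Longrightarrow> u < n \<Longrightarrow> i < n \<Longrightarrow> P (var v u i) \<longleftrightarrow> v < u \<and> {v, u} \<in> K"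
  shows "card {e \<in> used p. P e} = card (chosen p \<inter> K)"
proof -
  let ?T = "{(v, u, i). v < n \<and> u < n \<and> i < n \<and> (p (pv v u) = cv v i \<and> v < u \<and> {v, u} \<in> K)}"
  have "{e \<in> used p. P e} = (\<lambda>(v, u, i). var v u i) ` ?T"
  proof (intro equalityI subsetI)
    fix e assume "e \<in> {e \<in> used p. P e}"
    then obtain v u i where "e = var v u i" "v < n" "u < n" "i < n" "p (pv v u) = cv v i" "P (var v u i)"
      unfolding used_def by blast
    then show "e \<in> (\<lambda>(v, u, i). var v u i) ` ?T"
      using P[of v u i] by (intro image_eqI[of _ _ "(v, u, i)"]) auto
  next
    fix e assume "e \<in> (\<lambda>(v, u, i). var v u i) ` ?T"
    then obtain v u i where *: "e = var v u i" "v < n" "u < n" "i < n" "p (pv v u) = cv v i" "v < u" "{v, u} \<in> K"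
      by auto
    then show "e \<in> {e \<in> used p. P e}" using mem_used[of v u i p] P[of v u i] by simp
  qed
  then have 1: "card {e \<in> used p. P e} = card ?T" using card_image[OF inj_on_var] by simp
  have "chosen p \<inter> K = (\<lambda>(v, u, i). {v, u}) ` ?T"
  proof (intro equalityI subsetI)
    fix e assume e: "e \<in> chosen p \<inter> K"
    then obtain v u where vu: "e = {v, u}" "v < n" "u < n" "\<exists>i<n. p (pv v u) = cv v i"
      unfolding chosen_def by blast
    have ne: "v \<noteq> u" using edge_neq[OF chosen_subset[OF p]] e vu by blast
    show "e \<in> (\<lambda>(v, u, i). {v, u}) ` ?T"
    proof (cases "v < u")
      case True
      from vu obtain i where "i < n" "p (pv v u) = cv v i" by blast
      then show ?thesis using True vu e by (intro image_eqI[of _ _ "(v, u, i)"]) auto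
    next
      case False
      from link_sym[OF p vu(2-4)] obtain i where "i < n" "p (pv u v) = cv u i" by blast
      then show ?thesis using False ne vu e by (intro image_eqI[of _ _ "(u, v, i)"]) (auto simp: insert_commute)
    qed
  next
    fix e assume "e \<in> (\<lambda>(v, u, i). {v, u}) ` ?T"
    then show "e \<in> chosen p \<inter> K" unfolding chosen_def by auto
  qed
  moreover have "inj_on (\<lambda>(v, u, i). {v, u}) ?T"
  proof (rule inj_onI)
    fix x y assume xy: "x \<in> ?T" "y \<in> ?T" "(case x of (v, u, i) \<Rightarrow> {v, u}) = (case y of (v, u, i) \<Rightarrow> {v, u})"
    obtain v u i v' u' i' where eq: "x = (v, u, i)" "y = (v', u', i')" by (metis prod.exhaust)
    have *: "i < n" "p (pv v u) = cv v i" "v < u" "i' < n" "p (pv v' u') = cv v' i'" "v' < u'" "{v, u} = {v', u'}"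
      using xy unfolding eq by simp_all
    then have "v = v' \<and> u = u'" by (auto simp: doubleton_eq_iff)
    then show "x = y" using * cv_inj unfolding eq by metis
  qed
  ultimately have 2: "card (chosen p \<inter> K) = card ?T" by (simp only: card_image)
  show ?thesis using 1 2 by simp
qed

lemma monom_nonzero: "Poly_Mapping.single m (1 :: bit) \<noteq> 0"
  by (metis lookup_single_eq lookup_zero zero_neq_one)

text \<open>The chosen neighbours of \<open>v\<close> are numbered by a bijection
  \<open>g v\<close>, and the number is the slot taken. All other vertices are matched along arcs of
  weight 1.\<close>

lemma pairing_exists:
  assumes F: "F \<subseteq> all_edges" and deg: "\<And>v. v < n \<Longrightarrow> card {e \<in> F. v \<in> e} = f v"
  shows "\<exists>p\<in>pairings. chosen p = F"
proof -
  define U where "U v = {u. u < n \<and> {v, u} \<in> F}" for v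
  have cardU: "card (U v) = f v" and fn: "f v < n" if "v < n" for v
    using card_incident[OF F that] neighbours_card_lt[OF F that] deg[OF that] by (simp_all add: U_def)
  have "\<exists>g. bij_betw g (U v) {0..<card (U v)}" for v
    by (rule ex_bij_betw_finite_nat) (simp add: U_def)
  then obtain g where g: "\<And>v. bij_betw (g v) (U v) {0..<card (U v)}" by metis
  \<comment> \<open>Vertices are decoded by \<open>div\<close> and \<open>mod\<close>; from
    \<open>nv\<close> on \<open>q\<close> is the identity, as a permutation of
    \<open>{..<nv}\<close> has to be.\<close>
  define q where "q = (\<lambda>x. if x < n * n then (if {x div n, x mod n} \<in> F then cv (x div n) (g (x div n) (x mod n))
        else pv (x mod n) (x div n))
      else if x < nv then (if (x - n * n) mod n < f ((x - n * n) div n) then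
          pv ((x - n * n) div n) (inv_into (U ((x - n * n) div n)) (g ((x - n * n) div n)) ((x - n * n) mod n)) else x)
      else x)"
  have qP: "q (pv v u) = (if {v, u} \<in> F then cv v (g v u) else pv u v)" if "v < n" "u < n" for v u
  proof -
    have "pv v u div n = v" "pv v u mod n = u" using that by (auto simp: pv_def)
    moreover have "pv v u < n * n" using row_lt[OF that] by (simp add: pv_def)
    ultimately show ?thesis unfolding q_def by (simp only: if_True)
  qed
  have qC: "q (cv v i) = (if i < f v then pv v (inv_into (U v) (g v) i) else cv v i)" if "v < n" "i < n" for v i
  proof -
    have "(cv v i - n * n) div n = v" "(cv v i - n * n) mod n = i" using that by (simp_all add: cv_def)
    moreover have "\<not> cv v i < n * n" "cv v i < nv" using cv_lt[OF that] by (simp_all add: cv_def)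
    ultimately show ?thesis unfolding q_def by (simp only: if_True if_False)
  qed
  have gU: "g v u < f v" "inv_into (U v) (g v) (g v u) = u" if "v < n" "u < n" "{v, u} \<in> F" for v u
  proof -
    have u: "u \<in> U v" using that by (simp add: U_def)
    have "inj_on (g v) (U v)" "g v ` U v = {0..<card (U v)}" using g[of v] by (simp_all add: bij_betw_def)
    then have "inv_into (U v) (g v) (g v u) = u" "g v u \<in> {0..<card (U v)}" using u by (simp, blast)
    then show "inv_into (U v) (g v) (g v u) = u" "g v u < f v" using cardU[OF that(1)] by simp_all
  qed
  have gI: "inv_into (U v) (g v) i < n" "{v, inv_into (U v) (g v) i} \<in> F" "g v (inv_into (U v) (g v) i) = i"
    if "v < n" "i < f v" for v i
  proof -
    have "g v ` U v = {0..<card (U v)}" using g[of v] by (simp only: bij_betw_def)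
    then have i: "i \<in> g v ` U v" using that cardU[OF that(1)] by simp
    then show "g v (inv_into (U v) (g v) i) = i" by (rule f_inv_into_f)
    have "inv_into (U v) (g v) i \<in> U v" using i by (rule inv_into_into)
    then show "inv_into (U v) (g v) i < n" "{v, inv_into (U v) (g v) i} \<in> F" by (simp_all add: U_def)
  qed
  have out: "q x = x" if "\<not> x < nv" for x
  proof -
    have "\<not> x < n * n" using that by (simp add: nv_def)
    then show ?thesis using that by (simp only: q_def if_False)
  qed
  have invol: "q (q x) = x" for x
  proof (cases "x < nv")
    case True
    then show ?thesis
    proof (cases rule: vertex_cases)
      case (1 v u)
      show ?thesis
      proof (cases "{v, u} \<in> F")
        case True
        have "g v u < n" using gU(1)[OF 1(1,2) True] fn[OF 1(1)] by simp
        then show ?thesis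
          using True gU[OF 1(1,2) True] by (simp only: 1(3) qP[OF 1(1,2)] qC[OF 1(1)] if_True)
      next
        case False
        then have "{u, v} \<notin> F" by (simp add: insert_commute)
        then show ?thesis using False by (simp only: 1(3) qP[OF 1(1,2)] qP[OF 1(2,1)] if_False)
      qed
    next
      case (2 v i)
      show ?thesis
      proof (cases "i < f v")
        case True
        then show ?thesis
          using gI[OF 2(1) True] by (simp only: 2(3) qC[OF 2(1,2)] qP[OF 2(1)] if_True)
      next
        case False
        then show ?thesis by (simp only: 2(3) qC[OF 2(1,2)] if_False)
      qed
    qed
  qed (simp add: out)
  have adj: "adj x (q x) \<noteq> 0" if "x < nv" for x
    using that
  proof (cases rule: vertex_cases)
    case (1 v u)
    show ?thesis
    proof (cases "{v, u} \<in> F")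
      case True
      then obtain a b where ab: "{v, u} = {a, b}" "E a b" using F unfolding all_edges_def by blast
      have E: "E v u" using ab E_sym unfolding doubleton_eq_iff by blast
      have "g v u < f v" "g v u < n" using gU(1)[OF 1(1,2) True] fn[OF 1(1)] by simp_all
      then show ?thesis using True E
        by (simp only: 1 qP[OF 1(1,2)] if_True adj_pc monom_nonzero simp_thms)
    next
      case False
      then show ?thesis by (simp only: 1 qP[OF 1(1,2)] if_False adj_pp simp_thms if_True zero_neq_one[symmetric])
    qed
  next
    case (2 v i)
    show ?thesis
    proof (cases "i < f v")
      case True
      let ?u = "inv_into (U v) (g v) i"
      have u: "?u < n" "{v, ?u} \<in> F" using gI[OF 2(1) True] by simp_all
      then obtain a b where ab: "{v, ?u} = {a, b}" "E a b" using F unfolding all_edges_def by blast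
      have E: "E v ?u" using ab E_sym unfolding doubleton_eq_iff by blast
      then show ?thesis using True u
        by (simp only: 2 qC[OF 2(1,2)] if_True adj_cp monom_nonzero simp_thms)
    next
      case False
      then have "f v \<le> i" by simp
      then show ?thesis using False
        by (simp only: 2 qC[OF 2(1,2)] if_False adj_cc simp_thms if_True zero_neq_one[symmetric])
    qed
  qed
  have "q permutes {..<nv}"
    unfolding permutes_def
  proof (intro conjI allI impI)
    fix y show "\<exists>!x. q x = y" by (rule ex1I[of _ "q y"]) (use invol in auto)
  qed (simp add: out)
  then have q: "q \<in> pairings" using invol adj by (simp add: pairings_def)
  have iff: "(\<exists>i<n. q (pv v u) = cv v i) \<longleftrightarrow> {v, u} \<in> F" if "v < n" "u < n" for v u
  proof (cases "{v, u} \<in> F")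
    case True
    have "g v u < n" using gU(1)[OF that True] fn[OF that(1)] by simp
    then show ?thesis using True by (simp only: qP[OF that] if_True) blast
  next
    case False
    then show ?thesis by (simp only: qP[OF that] if_False pv_neq_cv that simp_thms)
  qed
  have "chosen q = F"
  proof (intro equalityI subsetI)
    fix e assume "e \<in> chosen q"
    then obtain v u where vu: "e = {v, u}" "v < n" "u < n" "\<exists>i<n. q (pv v u) = cv v i"
      unfolding chosen_def by blast
    then show "e \<in> F" using iff[OF vu(2,3)] by (simp only:)
  next
    fix e assume e: "e \<in> F"
    then obtain v u where vu: "e = {v, u}" "v < n" "u < n" using F unfolding all_edges_def by blast
    then have "\<exists>i<n. q (pv v u) = cv v i" using iff[OF vu(2,3)] e by (simp only:)
    then show "e \<in> chosen q" unfolding chosen_def using vu by blast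
  qed
  with q show ?thesis by blast
qed

end

section \<open>The isolation lemma\<close>

lemma prob_bind_pmf_le:
  assumes "\<And>x. x \<in> set_pmf M \<Longrightarrow> measure_pmf.prob (f x) S \<le> c" "0 \<le> c"
  shows "measure_pmf.prob (bind_pmf M f) S \<le> c"
proof -
  have "emeasure (measure_pmf (bind_pmf M f)) S = (\<integral>\<^sup>+x. emeasure (measure_pmf (f x)) S \<partial>measure_pmf M)"
    by (rule emeasure_bind_pmf)
  also have "\<dots> \<le> (\<integral>\<^sup>+x. ennreal c \<partial>measure_pmf M)"
    by (intro nn_integral_mono_AE) (auto simp: AE_measure_pmf_iff measure_pmf.emeasure_eq_measure assms)
  also have "\<dots> = ennreal c" by (simp add: measure_pmf.emeasure_space_1)
  finally show ?thesis using assms(2) by (simp add: measure_pmf.emeasure_eq_measure)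
qed

definition min_weight :: "nat set set \<Rightarrow> (nat \<Rightarrow> nat) \<Rightarrow> nat set \<Rightarrow> bool" where
  "min_weight \<F> w S \<longleftrightarrow> S \<in> \<F> \<and> (\<forall>T \<in> \<F>. sum w S \<le> sum w T)"

text \<open>With the other weights fixed, a tie between a minimal set containing \<open>e\<close>
  and one avoiding it forces the weight of \<open>e\<close> to be a difference of two minima that do
  not depend on it. So it occurs for at most one value.\<close>

lemma tie_value_unique:
  assumes fin: "\<And>S. S \<in> \<F> \<Longrightarrow> finite S" and "(v::nat) < v'"
    and 1: "min_weight \<F> (w(e := v)) S" "min_weight \<F> (w(e := v)) T" "e \<in> S" "e \<notin> T"
    and 2: "min_weight \<F> (w(e := v')) S'" "min_weight \<F> (w(e := v')) T'" "e \<in> S'" "e \<notin> T'"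
  shows False
proof -
  have off: "sum (w(e := x)) U = sum w U" if "e \<notin> U" for x U
    using that by (intro sum.cong) auto
  have on: "sum (w(e := x)) U = x + sum w (U - {e})" if "e \<in> U" "finite U" for x U
  proof -
    have "sum (w(e := x)) U = (w(e := x)) e + sum (w(e := x)) (U - {e})"
      using that by (intro sum.remove) auto
    moreover have "sum (w(e := x)) (U - {e}) = sum w (U - {e})" by (intro sum.cong) auto
    ultimately show ?thesis by simp
  qed
  have f: "finite S'" using fin 2 by (auto simp: min_weight_def)
  have "v' + sum w (S' - {e}) = sum (w(e := v')) S'" using on[OF 2(3) f] by simp
  also have "\<dots> \<le> sum (w(e := v')) T" using 1 2 by (auto simp: min_weight_def)
  also have "\<dots> = sum (w(e := v)) T" using off[OF 1(4)] by simp
  also have "\<dots> \<le> sum (w(e := v)) S'" using 1 2 by (auto simp: min_weight_def)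
  also have "\<dots> = v + sum w (S' - {e})" using on[OF 2(3) f] by simp
  finally show False using \<open>v < v'\<close> by simp
qed

text \<open>If the weight of \<open>e\<close> is drawn last, at most one of the \<open>R\<close>
  values causes a tie at \<open>e\<close>; a union bound over \<open>E\<close> follows.\<close>

theorem isolation_lemma:
  assumes E: "finite E" and F: "\<F> \<subseteq> Pow E" "\<F> \<noteq> {}" and R: "R > 0"
  shows "measure_pmf.prob (Pi_pmf E 0 (\<lambda>_. pmf_of_set {..<R})) {w. \<exists>!S. min_weight \<F> w S}
           \<ge> 1 - real (card E) / real R"
proof -
  let ?M = "Pi_pmf E 0 (\<lambda>_. pmf_of_set {..<R})"
  define tie where "tie e w \<longleftrightarrow> (\<exists>S T. min_weight \<F> w S \<and> min_weight \<F> w T \<and> e \<in> S \<and> e \<notin> T)" for e w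
  have fin: "finite S" if "S \<in> \<F>" for S using that E F(1) finite_subset by blast
  have finF: "finite \<F>" using E F(1) by (meson finite_Pow_iff finite_subset)
  have tie: "measure_pmf.prob ?M {w. tie e w} \<le> 1 / R" if e: "e \<in> E" for e
  proof -
    let ?N = "Pi_pmf (E - {e}) 0 (\<lambda>_. pmf_of_set {..<R})"
    have "?M = Pi_pmf (insert e (E - {e})) 0 (\<lambda>_. pmf_of_set {..<R})"
      using e by (simp add: insert_absorb)
    also have "\<dots> = bind_pmf (pmf_of_set {..<R}) (\<lambda>y. bind_pmf ?N (\<lambda>w. return_pmf (w(e := y))))"
      using E by (subst Pi_pmf_insert') auto
    also have "\<dots> = bind_pmf ?N (\<lambda>w. map_pmf (\<lambda>y. w(e := y)) (pmf_of_set {..<R}))"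
      by (subst bind_commute_pmf) (simp add: map_pmf_def)
    finally have M: "?M = bind_pmf ?N (\<lambda>w. map_pmf (\<lambda>y. w(e := y)) (pmf_of_set {..<R}))" .
    show ?thesis
      unfolding M
    proof (rule prob_bind_pmf_le)
      fix w
      let ?B = "{y. tie e (w(e := y))}"
      have uniq: "y = y'" if "y \<in> ?B" "y' \<in> ?B" for y y'
        using that tie_value_unique[OF fin, of _ y y' w e] tie_value_unique[OF fin, of _ y' y w e]
        unfolding tie_def mem_Collect_eq by (metis linorder_neqE_nat)
      have "card ({..<R} \<inter> ?B) \<le> 1"
        using uniq card_le_Suc0_iff_eq[of "{..<R} \<inter> ?B"] by auto
      then have "measure_pmf.prob (pmf_of_set {..<R}) ?B \<le> 1 / R"
        using R by (subst measure_pmf_of_set) (auto simp: divide_right_mono lessThan_empty_iff)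
      then show "measure_pmf.prob (map_pmf (\<lambda>y. w(e := y)) (pmf_of_set {..<R})) {w. tie e w} \<le> 1 / R"
        by (simp add: vimage_def)
    qed simp
  qed
  have "measure_pmf.prob ?M (\<Union>e\<in>E. {w. tie e w}) \<le> (\<Sum>e\<in>E. measure_pmf.prob ?M {w. tie e w})"
    by (rule measure_pmf.finite_measure_subadditive_finite) (use E in auto)
  also have "\<dots> \<le> (\<Sum>e\<in>E. 1 / real R)" by (intro sum_mono tie)
  finally have bad: "measure_pmf.prob ?M (\<Union>e\<in>E. {w. tie e w}) \<le> real (card E) / real R" by simp
  \<comment> \<open>Two different minimal sets differ in some element, and there would be a tie at
    that element.\<close>
  have "UNIV - (\<Union>e\<in>E. {w. tie e w}) \<subseteq> {w. \<exists>!S. min_weight \<F> w S}"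
  proof
    fix w assume w: "w \<in> UNIV - (\<Union>e\<in>E. {w. tie e w})"
    obtain S where S: "S \<in> \<F>" "\<And>T. T \<in> \<F> \<Longrightarrow> sum w S \<le> sum w T"
      using ex_min_if_finite[of "sum w ` \<F>"] finF F(2) by (auto simp: not_less)
    then have mS: "min_weight \<F> w S" by (auto simp: min_weight_def)
    moreover have "T = S" if T: "min_weight \<F> w T" for T
    proof (rule ccontr)
      assume "T \<noteq> S"
      then obtain e where e: "e \<in> S \<and> e \<notin> T \<or> e \<in> T \<and> e \<notin> S" by blast
      moreover have "S \<subseteq> E" "T \<subseteq> E" using mS T F(1) by (auto simp: min_weight_def)
      ultimately have "e \<in> E" "tie e w" using mS T unfolding tie_def by blast+
      with w show False by blast
    qed
    ultimately show "w \<in> {w. \<exists>!S. min_weight \<F> w S}" by blast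
  qed
  then have "measure_pmf.prob ?M (UNIV - (\<Union>e\<in>E. {w. tie e w})) \<le>
     measure_pmf.prob ?M {w. \<exists>!S. min_weight \<F> w S}"
    by (intro measure_pmf.finite_measure_mono) auto
  moreover have "measure_pmf.prob ?M (UNIV - (\<Union>e\<in>E. {w. tie e w})) =
     1 - measure_pmf.prob ?M (\<Union>e\<in>E. {w. tie e w})"
    using measure_pmf.prob_compl[of "\<Union>e\<in>E. {w. tie e w}" ?M] by simp
  ultimately show ?thesis using bad by linarith
qed

section \<open>Capped counters\<close>

definition radix :: "(nat \<Rightarrow> nat) \<Rightarrow> nat \<Rightarrow> nat" where
  "radix cap i = (\<Prod>t<i. cap t + 1)"

definition state_index :: "(nat \<Rightarrow> nat) \<Rightarrow> nat \<Rightarrow> (nat \<Rightarrow> nat) \<Rightarrow> nat" where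
  "state_index cap i c = (\<Sum>t<i. min (c t) (cap t) * radix cap t)"

text \<open>Label \<open>Suc t\<close> belongs to counter \<open>t\<close>; label 0 marks variables
  that no counter watches.\<close>

definition bump :: "nat \<Rightarrow> (nat \<Rightarrow> nat) \<Rightarrow> nat \<Rightarrow> nat" where
  "bump l c = (if l = 0 then c else c(l - 1 := Suc (c (l - 1))))"

lemma radix_0 [simp]: "radix cap 0 = 1"
  by (simp add: radix_def)

lemma radix_Suc: "radix cap (Suc i) = radix cap i + cap i * radix cap i"
  by (simp add: radix_def)

lemma radix_pos [simp]: "radix cap i > 0"
  by (simp add: radix_def prod_pos)

lemma radix_mono: "i \<le> j \<Longrightarrow> radix cap i \<le> radix cap j"
  by (induction j rule: dec_induct) (simp_all add: radix_Suc)

lemma state_index_0 [simp]: "state_index cap 0 c = 0"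
  by (simp add: state_index_def)

lemma state_index_Suc: "state_index cap (Suc i) c = state_index cap i c + min (c i) (cap i) * radix cap i"
  by (simp add: state_index_def)

lemma state_index_lt: "state_index cap i c < radix cap i"
proof (induction i)
  case (Suc i)
  have "min (c i) (cap i) * radix cap i \<le> cap i * radix cap i" by simp
  with Suc show ?case unfolding state_index_Suc radix_Suc by linarith
qed simp

lemma state_index_cong: "(\<And>t. t < i \<Longrightarrow> c t = c' t) \<Longrightarrow> state_index cap i c = state_index cap i c'"
  unfolding state_index_def by (intro sum.cong) auto

text \<open>Transitions are described for counter vectors; this carries the description over to
  every state number below \<open>radix cap i\<close>.\<close>

lemma state_index_surj: "s < radix cap i \<Longrightarrow> \<exists>c. state_index cap i c = s"
proof (induction i arbitrary: s)
  case (Suc i)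
  let ?Z = "radix cap i"
  have "s mod ?Z < ?Z" by simp
  then obtain c where c: "state_index cap i c = s mod ?Z" using Suc.IH by blast
  have "s div ?Z < cap i + 1"
    using Suc.prems by (intro less_mult_imp_div_less) (simp add: radix_Suc algebra_simps)
  then have "min (s div ?Z) (cap i) = s div ?Z" by simp
  moreover have "state_index cap i (c(i := s div ?Z)) = state_index cap i c"
    by (rule state_index_cong) simp
  ultimately have "state_index cap (Suc i) (c(i := s div ?Z)) = s"
    by (simp add: state_index_Suc c mod_div_mult_eq)
  then show ?case by blast
qed simp

text \<open>The largest mixed radix number has all digits at their caps, so only one state per
  weight decides the answer.\<close>

lemma state_index_top:
  "state_index cap i c = radix cap i - 1 \<longleftrightarrow> (\<forall>t<i. cap t \<le> c t)"
proof (induction i)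
  case (Suc i)
  let ?Z = "radix cap i"
  have lt: "state_index cap i c < ?Z" by (rule state_index_lt)
  show ?case
  proof (cases "cap i \<le> c i")
    case True
    then have "state_index cap (Suc i) c = radix cap (Suc i) - 1 \<longleftrightarrow> state_index cap i c = ?Z - 1"
      using lt radix_pos[of cap i] unfolding state_index_Suc radix_Suc min_absorb2[OF True] by linarith
    then show ?thesis using Suc True by (auto simp: less_Suc_eq)
  next
    case False
    then have "Suc (c i) * ?Z \<le> cap i * ?Z" by (intro mult_le_mono1) simp
    then have "state_index cap (Suc i) c < radix cap (Suc i) - 1 \<or> state_index cap (Suc i) c < cap i * ?Z"
      using lt False by (simp add: state_index_Suc min_def)
    moreover have "cap i * ?Z \<le> radix cap (Suc i) - 1" using radix_pos[of cap i] unfolding radix_Suc by linarith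
    ultimately have "state_index cap (Suc i) c \<noteq> radix cap (Suc i) - 1" by linarith
    then show ?thesis using False by auto
  qed
qed simp

text \<open>Quantifying over uncapped counts \<open>c\<close> includes the fact that the capped
  counts alone determine the successor.\<close>

definition next_ok :: "(nat \<Rightarrow> nat) \<Rightarrow> nat \<Rightarrow> nat \<Rightarrow> (nat \<Rightarrow> nat) \<Rightarrow> bool" where
  "next_ok cap K i F \<longleftrightarrow> (\<forall>c l. l < K \<longrightarrow> F (state_index cap i c * K + l) = state_index cap i (bump l c))"

text \<open>A state is a mixed radix number, so a new counter copies the transition table of the old states
  once per value of its digit (\<open>spread\<close>); only the transitions of its own label need
  correction (\<open>mark\<close>).\<close>

definition spread :: "nat \<Rightarrow> nat \<Rightarrow> (nat \<Rightarrow> nat) \<Rightarrow> nat \<Rightarrow> nat" where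
  "spread B Z F j = F (j mod B) + (j div B) * Z"

lemma spread_block: "r < B \<Longrightarrow> spread B Z F (r + d * B) = F r + d * Z"
  by (simp add: spread_def)

definition mark :: "nat \<Rightarrow> nat \<Rightarrow> nat \<Rightarrow> nat \<Rightarrow> (nat \<Rightarrow> nat) \<Rightarrow> nat \<Rightarrow> nat" where
  "mark K l Z b F j = (if j mod K = l \<and> j div K < b then j div K + Z else F j)"

text \<open>The old table ignores label \<open>Suc i\<close>. In the new one this label increments
  the new digit, that is, adds \<open>radix cap i\<close>, unless the digit is at its cap. The
  states at the cap are exactly those from \<open>cap i * radix cap i\<close> on, and there the
  copied entry already says to stay.\<close>

lemma next_ok_step:
  assumes F: "next_ok cap K i F" and l: "Suc i < K"
    and F': "\<And>j. j < radix cap (Suc i) * K \<Longrightarrow>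
       F' j = mark K (Suc i) (radix cap i) (cap i * radix cap i) (spread (radix cap i * K) (radix cap i) F) j"
  shows "next_ok cap K (Suc i) F'"
  unfolding next_ok_def
proof (intro allI impI)
  fix c l assume lK: "l < K"
  let ?Z = "radix cap i" and ?s = "state_index cap i c" and ?d = "min (c i) (cap i)"
  have s: "?s < ?Z" by (rule state_index_lt)
  let ?j = "state_index cap (Suc i) c * K + l"
  have "state_index cap (Suc i) c < radix cap (Suc i)" by (rule state_index_lt)
  then have "Suc (state_index cap (Suc i) c) * K \<le> radix cap (Suc i) * K" by (intro mult_le_mono1) simp
  then have jlt: "?j < radix cap (Suc i) * K" using lK by simp
  have r: "?s * K + l < ?Z * K"
  proof -
    have "Suc ?s * K \<le> ?Z * K" using s by (intro mult_le_mono1) simp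
    then show ?thesis using lK by simp
  qed
  have j: "?j = (?s * K + l) + ?d * (?Z * K)" by (simp add: state_index_Suc algebra_simps)
  have sp: "spread (?Z * K) ?Z F ?j = state_index cap i (bump l c) + ?d * ?Z"
    unfolding j spread_block[OF r] using F lK by (simp add: next_ok_def)
  have dm: "?j mod K = l" "?j div K = state_index cap (Suc i) c" using lK by simp_all
  show "F' ?j = state_index cap (Suc i) (bump l c)"
  proof (cases "l = Suc i")
    case False
    then have "bump l c i = c i" by (auto simp: bump_def)
    then show ?thesis using False unfolding F'[OF jlt] mark_def dm sp by (simp add: state_index_Suc)
  next
    case True
    have b: "bump l c i = Suc (c i)" using True by (simp add: bump_def)
    have b': "state_index cap i (bump l c) = ?s" using True by (intro state_index_cong) (simp add: bump_def)
    have R: "state_index cap (Suc i) (bump l c) = ?s + min (Suc (c i)) (cap i) * ?Z"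
      unfolding state_index_Suc b b' by (rule refl)
    show ?thesis
    proof (cases "c i < cap i")
      case True2: True
      have "Suc ?d * ?Z \<le> cap i * ?Z" using True2 by (intro mult_le_mono1) simp
      then have "state_index cap (Suc i) c < cap i * ?Z" using s unfolding state_index_Suc by simp
      then show ?thesis
        using True True2 unfolding F'[OF jlt] mark_def dm R by (simp add: state_index_Suc)
    next
      case False
      then have "min (c i) (cap i) = cap i" "min (Suc (c i)) (cap i) = cap i" by simp_all
      then show ?thesis
        unfolding F'[OF jlt] mark_def dm sp R b' by (simp add: state_index_Suc)
    qed
  qed
qed

locale counters =
  fixes kp :: nat and cap lab wt :: "nat \<Rightarrow> nat" and Wc :: nat
  assumes lab_le: "lab e \<le> kp" and wt_lt: "wt e < Wc"
begin

definition Z :: nat where "Z = radix cap kp"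
definition Q :: nat where "Q = Wc * Z"
definition cnt :: "nat multiset \<Rightarrow> nat \<Rightarrow> nat" where "cnt m t = size (filter_mset (\<lambda>e. lab e = Suc t) m)"
definition weight :: "nat multiset \<Rightarrow> nat" where "weight m = sum_mset (image_mset wt m)"
text \<open>The weight is reduced modulo \<open>Wc\<close> so that every monomial has one of
  finitely many codes and the transitions are total. For pairings nothing is lost:
  \<open>hits_complete\<close> shows that their weights stay below \<open>Wc\<close>.\<close>

definition code :: "nat multiset \<Rightarrow> nat" where
  "code m = (weight m mod Wc) * Z + state_index cap kp (cnt m)"

lemma Z_pos: "Z > 0"
  by (simp add: Z_def)

lemma Wc_pos: "Wc > 0"
  using wt_lt[of 0] by simp

text \<open>\<open>wz\<close> is a weight already multiplied by \<open>Z\<close>, so adding it acts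
  on the weight digit only; one subtraction of \<open>Q = Wc * Z\<close> performs the reduction
  modulo \<open>Wc\<close>.\<close>

definition trans :: "(nat \<Rightarrow> nat) \<Rightarrow> nat \<Rightarrow> nat \<Rightarrow> nat \<Rightarrow> nat" where
  "trans F l wz q = (let q' = F (q * Suc kp + l) + wz in if q' < Q then q' else q' - Q)"

definition table_ok :: "(nat \<Rightarrow> nat) \<Rightarrow> bool" where
  "table_ok F \<longleftrightarrow> (\<forall>w c l. w < Wc \<longrightarrow> l \<le> kp \<longrightarrow>
      F ((w * Z + state_index cap kp c) * Suc kp + l) = w * Z + state_index cap kp (bump l c))"

lemma combine_lt: "w < Wc \<Longrightarrow> s < Z \<Longrightarrow> w * Z + s < Q"
proof -
  assume *: "w < Wc" "s < Z"
  then have "Suc w * Z \<le> Wc * Z" by (intro mult_le_mono1) simp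
  then show ?thesis using * by (simp add: Q_def)
qed

lemma code_lt: "code m < Q"
  unfolding code_def by (rule combine_lt) (use Wc_pos state_index_lt in \<open>simp_all add: Z_def\<close>)

lemma code_empty: "code {#} = 0"
  by (simp add: code_def weight_def cnt_def state_index_def)

lemma trans_code:
  assumes F: "table_ok F" and l: "l \<le> kp" and w: "w < Wc" and w0: "w0 < Wc"
  shows "trans F l (w * Z) (w0 * Z + state_index cap kp c) =
    ((w0 + w) mod Wc) * Z + state_index cap kp (bump l c)"
proof -
  let ?s = "state_index cap kp (bump l c)"
  have s: "?s < Z" using state_index_lt by (simp add: Z_def)
  have v: "F ((w0 * Z + state_index cap kp c) * Suc kp + l) = w0 * Z + ?s"
    using F w0 l by (simp only: table_ok_def)
  show ?thesis
  proof (cases "w0 + w < Wc")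
    case True
    then have "(w0 + w) * Z + ?s < Q" by (rule combine_lt[OF _ s])
    then show ?thesis using True unfolding trans_def v Let_def by (simp add: algebra_simps)
  next
    case False
    then have "Wc * Z \<le> (w0 + w) * Z" by (intro mult_le_mono1) simp
    then have "\<not> w0 * Z + ?s + w * Z < Q" by (simp add: Q_def algebra_simps)
    moreover have "(w0 + w) mod Wc = w0 + w - Wc" using False w w0 by (simp add: mod_if)
    moreover have "w0 * Z + ?s + w * Z - Q = (w0 + w - Wc) * Z + ?s"
      using False \<open>Wc * Z \<le> (w0 + w) * Z\<close> by (simp add: Q_def algebra_simps diff_mult_distrib)
    ultimately show ?thesis unfolding trans_def v Let_def by simp
  qed
qed

lemma trans_lt:
  assumes F: "table_ok F" and l: "l \<le> kp" and w: "w < Wc" and q: "q < Q"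
  shows "trans F l (w * Z) q < Q"
proof -
  have w0: "q div Z < Wc" using q by (intro less_mult_imp_div_less) (simp add: Q_def)
  have "q mod Z < Z" using Z_pos by simp
  then obtain c where c: "state_index cap kp c = q mod Z" using state_index_surj unfolding Z_def by blast
  have "trans F l (w * Z) q = trans F l (w * Z) (q div Z * Z + state_index cap kp c)"
    by (simp only: c div_mult_mod_eq)
  also have "\<dots> < Q" unfolding trans_code[OF F l w w0]
    using Wc_pos state_index_lt by (intro combine_lt) (simp_all add: Z_def)
  finally show ?thesis .
qed

lemma trans_var:
  assumes F: "table_ok F"
  shows "trans F (lab e) (wt e * Z) (code m) = code ({#e#} + m)"
proof -
  have "trans F (lab e) (wt e * Z) (code m) =
     ((weight m mod Wc + wt e) mod Wc) * Z + state_index cap kp (bump (lab e) (cnt m))"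
    unfolding code_def by (rule trans_code[OF F lab_le wt_lt]) (use Wc_pos in simp)
  also have "(weight m mod Wc + wt e) mod Wc = weight ({#e#} + m) mod Wc"
    by (simp add: weight_def mod_simps add.commute)
  also have "bump (lab e) (cnt m) = cnt ({#e#} + m)"
    by (auto simp: bump_def cnt_def fun_eq_iff)
  finally show ?thesis by (simp add: code_def)
qed

lemma trans_unit:
  assumes F: "table_ok F"
  shows "trans F 0 0 (code m) = code ({#} + m)"
  using trans_code[OF F, of 0 0 "weight m mod Wc" "cnt m"] Wc_pos by (simp add: code_def bump_def)

text \<open>The weight acts as one more digit with \<open>Wc\<close> values. No label moves it, so
  copying suffices and no entry needs correction.\<close>

lemma table_ok_spread:
  assumes F: "next_ok cap (Suc kp) kp F" and F': "\<And>j. j < Q * Suc kp \<Longrightarrow> F' j = spread (Z * Suc kp) Z F j"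
  shows "table_ok F'"
  unfolding table_ok_def
proof (intro allI impI)
  fix w c l assume w: "w < Wc" and l: "l \<le> kp"
  let ?s = "state_index cap kp c"
  have s: "?s < Z" using state_index_lt by (simp add: Z_def)
  have r: "?s * Suc kp + l < Z * Suc kp"
  proof -
    have "Suc ?s * Suc kp \<le> Z * Suc kp" using s by (intro mult_le_mono1) simp
    then show ?thesis using l by simp
  qed
  have "Suc (w * Z + ?s) * Suc kp \<le> Q * Suc kp" using combine_lt[OF w s] by (intro mult_le_mono1) simp
  then have "(w * Z + ?s) * Suc kp + l < Q * Suc kp" using l by simp
  then have "F' ((w * Z + ?s) * Suc kp + l) = spread (Z * Suc kp) Z F ((w * Z + ?s) * Suc kp + l)" by (rule F')
  moreover have "(w * Z + ?s) * Suc kp + l = (?s * Suc kp + l) + w * (Z * Suc kp)" by (simp add: algebra_simps)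
  moreover have "F (?s * Suc kp + l) = state_index cap kp (bump l c)"
    using F l unfolding next_ok_def less_Suc_eq_le by blast
  ultimately show "F' ((w * Z + ?s) * Suc kp + l) = w * Z + state_index cap kp (bump l c)"
    using spread_block[OF r, of Z F w] by (simp only: add.commute)
qed

end

section \<open>The table of path counts\<close>

lemma mult_add_inj:
  fixes a b c :: nat
  assumes "c < b" "c' < b"
  shows "a * b + c = a' * b + c' \<longleftrightarrow> a = a' \<and> c = c'"
proof -
  have "(a * b + c) div b = a" "(a * b + c) mod b = c" "(a' * b + c') div b = a'" "(a' * b + c') mod b = c'"
    using assms by auto
  then show ?thesis by metis
qed

lemma represents_cong:
  "represents Q \<pi> v r \<Longrightarrow> (\<And>q. q < Q \<Longrightarrow> v q = v' q) \<Longrightarrow> represents Q \<pi> v' r"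
  by (simp add: represents_def)

text \<open>
  The determinant is a sum over paths in an acyclic graph with nodes \<open>(h, l, u)\<close>.  For \<open>u < h\<close> the
  value at \<open>(h, l, u)\<close> is \<open>walks adj h l u\<close>, and at \<open>(h, l, h)\<close> it is the coefficient of \<open>t\<^sup>l\<close> in the
  characteristic series of the leading \<open>h \<times> h\<close> block; \<open>target\<close> gives the end of an edge out of row \<open>(h, l)\<close>.
\<close>

definition bumpV :: "nat \<times> nat \<times> nat \<Rightarrow> mring \<Rightarrow> (nat \<Rightarrow> nat \<Rightarrow> nat \<Rightarrow> mring) \<Rightarrow> nat \<Rightarrow> nat \<Rightarrow> nat \<Rightarrow> mring" where
  "bumpV tgt r V = (\<lambda>h l u. if (h, l, u) = tgt then V h l u + r else V h l u)"

definition target :: "nat \<Rightarrow> nat \<Rightarrow> nat \<Rightarrow> nat \<times> nat \<times> nat" where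
  "target h l y = (if y = h then (Suc h, Suc l, Suc h) else (h, Suc l, y))"

definition pushV :: "nat \<Rightarrow> nat \<Rightarrow> nat \<times> nat \<times> nat multiset \<Rightarrow>
    (nat \<Rightarrow> nat \<Rightarrow> nat \<Rightarrow> mring) \<Rightarrow> nat \<Rightarrow> nat \<Rightarrow> nat \<Rightarrow> mring" where
  "pushV h l = (\<lambda>(x, y, m) V. if x \<le> h \<and> y \<le> h
     then bumpV (target h l y) (Poly_Mapping.single m 1 * V h l x) V else V)"

text \<open>Targets lie in row \<open>Suc l\<close>, so the sources keep their values while the arcs
  are processed one after another.\<close>

lemma pushV_row: "pushV h l a V h l x = V h l x"
  by (cases a) (auto simp: pushV_def bumpV_def target_def)

lemma fold_pushV:
  "fold (pushV h l) as V h' l' u' = V h' l' u' + (\<Sum>(x, y, m) \<leftarrow> as.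
     if x \<le> h \<and> y \<le> h \<and> target h l y = (h', l', u') then Poly_Mapping.single m 1 * V h l x else 0)"
proof (induction "as" arbitrary: V)
  case (Cons a as)
  obtain x y m where a: "a = (x, y, m)" by (cases a)
  have "pushV h l a V h' l' u' = V h' l' u' +
     (if x \<le> h \<and> y \<le> h \<and> target h l y = (h', l', u') then Poly_Mapping.single m 1 * V h l x else 0)"
    by (auto simp: a pushV_def bumpV_def)
  then show ?case
    unfolding fold.simps o_apply Cons.IH[of "pushV h l a V"] pushV_row by (simp add: a add.assoc)
qed simp

lemma sum_list_by_source:
  fixes G :: "nat \<Rightarrow> mring"
  shows "(\<Sum>(x, y, m) \<leftarrow> as. if x \<le> h \<and> y = y0 then Poly_Mapping.single m 1 * G x else 0) =
    (\<Sum>x\<le>h. (\<Sum>(x', y', m) \<leftarrow> as. if x' = x \<and> y' = y0 then Poly_Mapping.single m 1 else 0) * G x)"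
proof (induction "as")
  case (Cons a as)
  obtain x y m where a: "a = (x, y, m)" by (cases a)
  have "(\<Sum>x'\<le>h. (if x = x' \<and> y = y0 then Poly_Mapping.single m 1 else 0) * G x') =
     (\<Sum>x'\<le>h. if x = x' then if y = y0 then Poly_Mapping.single m 1 * G x else 0 else 0)"
    by (intro sum.cong) auto
  also have "\<dots> = (if x \<le> h \<and> y = y0 then Poly_Mapping.single m 1 * G x else 0)"
    by (simp add: sum.delta)
  finally show ?case using Cons.IH by (simp add: a distrib_right sum.distrib)
qed simp

locale machine = gadget n f E + counters kp cap lab wt Wc
  for n f E kp cap lab wt Wc
begin

text \<open>Row \<open>nv + 1\<close> is written by the pushes out of row \<open>nv\<close> and
  never read; without room for it these writes would run into other nodes.\<close>

definition N2 :: nat where "N2 = nv + 2"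
definition nd :: "nat \<Rightarrow> nat \<Rightarrow> nat \<Rightarrow> nat" where "nd h l u = ((h * N2 + l) * N2 + u) * Q"

lemma nd_inj:
  assumes "l < N2" "l' < N2" "u < N2" "u' < N2" "q < Q" "q' < Q"
  shows "nd h l u + q = nd h' l' u' + q' \<longleftrightarrow> (h, l, u, q) = (h', l', u', q')"
  using assms by (auto simp: nd_def mult_add_inj)

definition add_block :: "nat \<Rightarrow> (nat \<Rightarrow> nat) \<Rightarrow> (nat \<Rightarrow> nat) \<Rightarrow> nat \<Rightarrow> nat" where
  "add_block tb \<delta> A = (\<lambda>j. if tb \<le> j \<and> j < tb + Q then A j + \<delta> (j - tb) else A j)"

text \<open>Nothing is claimed about levels below \<open>hm\<close>, which are finished, nor about
  row \<open>nv + 1\<close>.\<close>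

definition tab :: "nat \<Rightarrow> (nat \<Rightarrow> nat \<Rightarrow> nat \<Rightarrow> mring) \<Rightarrow> (nat \<Rightarrow> nat) \<Rightarrow> bool" where
  "tab hm V A \<longleftrightarrow> (\<forall>h l u. hm \<le> h \<longrightarrow> l \<le> nv \<longrightarrow> u < N2 \<longrightarrow>
     represents Q code (\<lambda>q. A (nd h l u + q)) (V h l u))"

lemma add_block_same: "q < Q \<Longrightarrow> add_block tb \<delta> A (tb + q) = A (tb + q) + \<delta> q"
  by (simp add: add_block_def)

lemma add_block_other:
  assumes "l < N2" "l' < N2" "u < N2" "u' < N2" "q < Q" "(h, l, u) \<noteq> (h', l', u')"
  shows "add_block (nd h' l' u') \<delta> A (nd h l u + q) = A (nd h l u + q)"
proof -
  have "\<not> (nd h' l' u' \<le> nd h l u + q \<and> nd h l u + q < nd h' l' u' + Q)"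
  proof
    assume *: "nd h' l' u' \<le> nd h l u + q \<and> nd h l u + q < nd h' l' u' + Q"
    define q' where "q' = nd h l u + q - nd h' l' u'"
    have "q' < Q" "nd h l u + q = nd h' l' u' + q'" using * by (auto simp: q'_def)
    then show False using nd_inj[OF assms(1-5), of q' h h'] assms(6) by simp
  qed
  then show ?thesis by (simp only: add_block_def if_False)
qed

lemma tab_add_block:
  assumes tab: "tab hm V A"
    and src: "hm \<le> h0" "l0 \<le> nv" "u0 < N2" and tgt: "l1 < N2" "u1 < N2"
    and tr: "\<And>m. tr (code m) = code (m0 + m)"
  shows "tab hm (bumpV (h1, l1, u1) (Poly_Mapping.single m0 1 * V h0 l0 u0) V)
    (add_block (nd h1 l1 u1) (\<lambda>q'. \<Sum>q<Q. if tr q = q' then A (nd h0 l0 u0 + q) else 0) A)"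
    (is "tab hm ?V ?A")
  unfolding tab_def
proof (intro allI impI)
  fix h l u assume hlu: "hm \<le> h" "l \<le> nv" "u < N2"
  have l: "l < N2" using hlu by (simp add: N2_def)
  have r: "represents Q code (\<lambda>q. A (nd h l u + q)) (V h l u)" using tab hlu by (simp add: tab_def)
  show "represents Q code (\<lambda>q. ?A (nd h l u + q)) (?V h l u)"
  proof (cases "(h, l, u) = (h1, l1, u1)")
    case True
    have "represents Q code (\<lambda>q. A (nd h0 l0 u0 + q)) (V h0 l0 u0)" using tab src by (simp add: tab_def)
    then have "represents Q code (\<lambda>q'. \<Sum>q<Q. if tr q = q' then A (nd h0 l0 u0 + q) else 0)
        (Poly_Mapping.single m0 1 * V h0 l0 u0)"
      by (rule represents_monom_mult) (use tr code_lt in auto)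
    from represents_add[OF r this]
    have "represents Q code (\<lambda>q. ?A (nd h l u + q)) (V h l u + Poly_Mapping.single m0 1 * V h0 l0 u0)"
      by (rule represents_cong) (use True in \<open>simp add: add_block_same\<close>)
    then show ?thesis using True by (simp add: bumpV_def)
  next
    case False
    have "represents Q code (\<lambda>q. ?A (nd h l u + q)) (V h l u)"
      using r by (rule represents_cong) (simp only: add_block_other[OF l tgt(1) hlu(3) tgt(2) _ False])
    then show ?thesis using False by (simp only: bumpV_def if_False)
  qed
qed

lemma tab_cong:
  assumes "tab hm V A" "hm \<le> hm'" "\<And>h l u. hm' \<le> h \<Longrightarrow> l \<le> nv \<Longrightarrow> V h l u = V' h l u"
  shows "tab hm' V' A"
  using assms unfolding tab_def by (metis le_trans)

text \<open>The values of the nodes at levels at least \<open>h\<close> when the program is about to process row \<open>(h, l)\<close>.\<close>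

definition VV :: "nat \<Rightarrow> nat \<Rightarrow> nat \<Rightarrow> nat \<Rightarrow> nat \<Rightarrow> mring" where
  "VV h l h' l' u' =
     (if h' = h then
        (if u' = h then fps_nth (char_fps adj h) l' else if u' < h \<and> l' \<le> l then walks adj h l' u' else 0)
      else if h' = Suc h \<and> u' = Suc h then
        (if l' < l then fps_nth (char_fps adj (Suc h)) l' else if l' = l then walks adj h l h else 0)
      else 0)"

text \<open>In characteristic 2 the subtraction of \<open>char_fps_Suc\<close> is an addition, which
  counts by natural numbers can follow.\<close>

lemma char_fps_Suc_plus:
  "fps_nth (char_fps adj (Suc h)) l = walks adj h l h + fps_nth (char_fps adj h) l"
  unfolding char_fps_Suc using char2_minus[OF mring_char2, of "walks adj h l h"]
  by (metis add.commute uminus_add_conv_diff)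

lemma walks_eq:
  assumes "\<And>x. x \<le> h \<Longrightarrow> G x = (if x = h then fps_nth (char_fps adj h) l else walks adj h l x)"
  shows "(\<Sum>(x, y, m) \<leftarrow> arcs. if x \<le> h \<and> y = y0 then Poly_Mapping.single m 1 * G x else 0) =
    walks adj h (Suc l) y0"
proof -
  have "(\<Sum>(x, y, m) \<leftarrow> arcs. if x \<le> h \<and> y = y0 then Poly_Mapping.single m 1 * G x else 0)
     = (\<Sum>x\<le>h. adj y0 x * G x)"
    unfolding sum_list_by_source adj_def ..
  also have "\<dots> = (\<Sum>x<h. adj y0 x * G x) + adj y0 h * G h"
    by (simp add: lessThan_Suc_atMost[symmetric])
  also have "(\<Sum>x<h. adj y0 x * G x) = (\<Sum>x<h. adj y0 x * walks adj h l x)"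
    by (intro sum.cong refl) (simp add: assms)
  finally show ?thesis by (simp add: assms)
qed

text \<open>Node \<open>(Suc h, l, Suc h)\<close> already holds \<open>walks adj h l h\<close>;
  copying node \<open>(h, l, h)\<close> with monomial 1 completes the coefficient of the next
  series. The arcs then fill row \<open>Suc l\<close>: targets below \<open>h\<close> stay on level
  \<open>h\<close>, target \<open>h\<close> moves up a level.\<close>

lemma VV_step:
  "fold (pushV h l) arcs (bumpV (Suc h, l, Suc h) (Poly_Mapping.single {#} 1 * VV h l h l h) (VV h l)) h' l' u' =
   VV h (Suc l) h' l' u'"
proof -
  define V1 where "V1 = bumpV (Suc h, l, Suc h) (Poly_Mapping.single {#} 1 * VV h l h l h) (VV h l)"
  have V1: "V1 h' l' u' = VV h l h' l' u' +
      (if (h', l', u') = (Suc h, l, Suc h) then fps_nth (char_fps adj h) l else 0)" for h' l' u'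
    by (auto simp: V1_def bumpV_def VV_def)
  have row: "V1 h l x = (if x = h then fps_nth (char_fps adj h) l else walks adj h l x)" if "x \<le> h" for x
    using that by (simp add: V1 VV_def)
  have F: "fold (pushV h l) arcs V1 h' l' u' = V1 h' l' u' + (\<Sum>(x, y, m) \<leftarrow> arcs.
     if x \<le> h \<and> y \<le> h \<and> target h l y = (h', l', u') then Poly_Mapping.single m 1 * V1 h l x else 0)"
    (is "_ = _ + ?S")
    by (rule fold_pushV)
  have S: "?S = (\<Sum>(x, y, m) \<leftarrow> arcs. if x \<le> h \<and> y = y0 then Poly_Mapping.single m 1 * V1 h l x else 0)"
    if "\<And>y. y \<le> h \<and> target h l y = (h', l', u') \<longleftrightarrow> y = y0" for y0
    using that by (simp only:)
  have S0: "?S = 0" if "\<And>y. y \<le> h \<Longrightarrow> target h l y \<noteq> (h', l', u')"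
  proof -
    have e: "(y \<le> h \<and> target h l y = (h', l', u')) = False" for y using that by blast
    show ?thesis unfolding e simp_thms if_False by (simp add: case_prod_unfold)
  qed
  consider (a) "h' = h" "l' = Suc l" "u' < h" | (b) "h' = Suc h" "l' = Suc l" "u' = Suc h"
    | (c) "\<not> (h' = h \<and> l' = Suc l \<and> u' < h)" "\<not> (h' = Suc h \<and> l' = Suc l \<and> u' = Suc h)"
    by blast
  then have "fold (pushV h l) arcs V1 h' l' u' = VV h (Suc l) h' l' u'"
  proof cases
    case a
    have "?S = walks adj h (Suc l) u'"
      by (subst S[of u']) (use a row in \<open>auto simp: target_def walks_eq\<close>)
    then show ?thesis unfolding F using a by (simp add: V1 VV_def)
  next
    case b
    have "?S = walks adj h (Suc l) h"
      by (subst S[of h]) (use b row in \<open>auto simp: target_def walks_eq\<close>)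
    then show ?thesis unfolding F using b by (simp add: V1 VV_def)
  next
    case c
    have t: "target h l y \<noteq> (h', l', u')" if "y \<le> h" for y
      using c that by (auto simp: target_def)
    have "V1 h' l' u' = VV h (Suc l) h' l' u'"
      using c by (auto simp: V1 VV_def char_fps_Suc_plus less_Suc_eq le_Suc_eq)
    moreover have "?S = 0" by (rule S0) (rule t)
    ultimately show ?thesis unfolding F by (simp only: add_0_right)
  qed
  then show ?thesis by (simp only: V1_def)
qed

lemma VV_next: "Suc h \<le> h' \<Longrightarrow> l' \<le> nv \<Longrightarrow> VV h (Suc nv) h' l' u' = VV (Suc h) 0 h' l' u'"
  by (auto simp: VV_def)

text \<open>The series of the empty block is 1: a single path of the empty class, and node
  \<open>(0, 0, 0)\<close> has address 0.\<close>

lemma tab_start: "tab 0 (VV 0 0) ((\<lambda>_. 0)(0 := 1))"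
  unfolding tab_def
proof (intro allI impI)
  fix h l u assume hlu: "l \<le> nv" "u < N2"
  have Q: "Q > 0" using Wc_pos Z_pos by (simp add: Q_def)
  have N: "0 < N2" "l < N2" using hlu by (simp_all add: N2_def)
  show "represents Q code (\<lambda>q. ((\<lambda>_. 0)(0 := 1)) (nd h l u + q)) (VV 0 0 h l u)"
  proof (cases "(h, l, u) = (0, 0, 0)")
    case True
    have "represents Q code (\<lambda>q. if q = 0 then 1 else 0) 1" by (rule represents_1[of code, OF code_empty])
    then have "represents Q code (\<lambda>q. ((\<lambda>_. 0)(0 := 1)) (nd h l u + q)) 1"
      by (rule represents_cong) (use True in \<open>simp add: nd_def\<close>)
    then show ?thesis using True by (simp add: VV_def char_fps_0)
  next
    case False
    have "nd h l u + q \<noteq> 0" if "q < Q" for q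
      using nd_inj[OF N(2,1) hlu(2) N(1) that Q, of h 0] False by (auto simp: nd_def)
    moreover have "VV 0 0 h l u = 0" using False by (auto simp: VV_def char_fps_0)
    ultimately show ?thesis by (simp only:) (rule represents_cong[OF represents_0], simp)
  qed
qed

theorem tab_final:
  assumes "tab nv (VV nv 0) A" "q < Q"
  shows "odd (A (nd nv nv nv + q)) \<longleftrightarrow>
    odd (card {p \<in> pairings. code (mset_set (used p) + mset_set (used p)) = q})"
proof (rule represents_sum_monoms[OF _ assms(2) finite_pairings])
  have "represents Q code (\<lambda>q. A (nd nv nv nv + q)) (VV nv 0 nv nv nv)"
    using assms(1) by (simp add: tab_def N2_def)
  then show "represents Q code (\<lambda>q. A (nd nv nv nv + q))
      (\<Sum>p\<in>pairings. Poly_Mapping.single (mset_set (used p) + mset_set (used p)) 1)"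
    by (simp add: VV_def char_fps_adj_top)
qed

end

section \<open>The program\<close>

text \<open>Register 0 takes the answer and register 1 is the counter of \<open>PMul\<close>, so the
  named registers start at 2.\<close>

abbreviation (input) r_n :: nat where "r_n \<equiv> 2"
abbreviation (input) r_kp :: nat where "r_kp \<equiv> 3"
abbreviation (input) r_mat :: nat where "r_mat \<equiv> 4"
abbreviation (input) r_n2 :: nat where "r_n2 \<equiv> 5"
abbreviation (input) r_deg :: nat where "r_deg \<equiv> 6"
abbreviation (input) r_base :: nat where "r_base \<equiv> 7"
abbreviation (input) r_n3 :: nat where "r_n3 \<equiv> 8"
abbreviation (input) r_n4 :: nat where "r_n4 \<equiv> 9"
abbreviation (input) r_nv :: nat where "r_nv \<equiv> 10"
abbreviation (input) r_range :: nat where "r_range \<equiv> 11"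
abbreviation (input) r_bits :: nat where "r_bits \<equiv> 12"
abbreviation (input) r_e :: nat where "r_e \<equiv> 13"
abbreviation (input) r_w :: nat where "r_w \<equiv> 14"
abbreviation (input) r_flip :: nat where "r_flip \<equiv> 15"
abbreviation (input) r_K :: nat where "r_K \<equiv> 16"
abbreviation (input) r_Z :: nat where "r_Z \<equiv> 17"
abbreviation (input) r_cap :: nat where "r_cap \<equiv> 18"
abbreviation (input) r_blk :: nat where "r_blk \<equiv> 19"
abbreviation (input) r_tot :: nat where "r_tot \<equiv> 20"
abbreviation (input) r_p :: nat where "r_p \<equiv> 21"
abbreviation (input) r_cz :: nat where "r_cz \<equiv> 22"
abbreviation (input) r_ptr :: nat where "r_ptr \<equiv> 23"
abbreviation (input) r_s :: nat where "r_s \<equiv> 24"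
abbreviation (input) r_t :: nat where "r_t \<equiv> 25"
abbreviation (input) r_Q :: nat where "r_Q \<equiv> 26"
abbreviation (input) r_h :: nat where "r_h \<equiv> 27"
abbreviation (input) r_l :: nat where "r_l \<equiv> 28"
abbreviation (input) r_v :: nat where "r_v \<equiv> 29"
abbreviation (input) r_u :: nat where "r_u \<equiv> 30"
abbreviation (input) r_i :: nat where "r_i \<equiv> 31"
abbreviation (input) r_x :: nat where "r_x \<equiv> 32"
abbreviation (input) r_y :: nat where "r_y \<equiv> 33"
abbreviation (input) r_lab :: nat where "r_lab \<equiv> 34"
abbreviation (input) r_wz :: nat where "r_wz \<equiv> 35"
abbreviation (input) r_q :: nat where "r_q \<equiv> 36"
abbreviation (input) r_q' :: nat where "r_q' \<equiv> 37"
abbreviation (input) r_src :: nat where "r_src \<equiv> 38"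
abbreviation (input) r_tgt :: nat where "r_tgt \<equiv> 39"
abbreviation (input) r_nv1 :: nat where "r_nv1 \<equiv> 40"
abbreviation (input) r_nv2 :: nat where "r_nv2 \<equiv> 41"
abbreviation (input) r_a :: nat where "r_a \<equiv> 42"
abbreviation (input) r_b :: nat where "r_b \<equiv> 43"
abbreviation (input) r_c :: nat where "r_c \<equiv> 44"
abbreviation (input) r_d :: nat where "r_d \<equiv> 45"
abbreviation (input) r_fv :: nat where "r_fv \<equiv> 46"
abbreviation (input) r_ent :: nat where "r_ent \<equiv> 47"
abbreviation (input) r_px :: nat where "r_px \<equiv> 48"
abbreviation (input) r_NR :: nat where "r_NR \<equiv> 49"
abbreviation (input) r_Wc :: nat where "r_Wc \<equiv> 50"
abbreviation (input) r_top :: nat where "r_top \<equiv> 51"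
abbreviation (input) r_val :: nat where "r_val \<equiv> 52"

text \<open>Above the input, the memory holds arrays interleaved with stride 4: the weights of the
  variables (offset 0), the path counts (offset 2) and the transition table (offset 3).\<close>

definition dbl :: "aexp \<Rightarrow> aexp" where "dbl a = Plus a a"

definition cell :: "nat \<Rightarrow> aexp \<Rightarrow> aexp" where
  "cell \<rho> a = Plus (Reg r_base) (Plus (Const \<rho>) (dbl (dbl a)))"

definition addr :: "nat \<Rightarrow> nat \<Rightarrow> nat \<Rightarrow> nat" where
  "addr L \<rho> i = L + (\<rho> + 4 * i)"

definition arr :: "nat \<Rightarrow> nat \<Rightarrow> (nat \<Rightarrow> nat) \<Rightarrow> nat \<Rightarrow> nat" where
  "arr L \<rho> m i = m (addr L \<rho> i)"

lemma aval_dbl [simp]: "aval (dbl a) s = 2 * aval a s"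
  by (simp add: dbl_def)

lemma aval_cell [simp]: "aval (cell \<rho> a) s = addr (fst s r_base) \<rho> (aval a s)"
  by (simp add: cell_def addr_def)

definition mem_ok :: "(nat \<Rightarrow> nat) \<Rightarrow> nat \<Rightarrow> (nat \<Rightarrow> nat) \<Rightarrow> (nat \<Rightarrow> nat) \<Rightarrow> (nat \<Rightarrow> nat) \<Rightarrow> (nat \<Rightarrow> nat) \<Rightarrow> bool"
where
  "mem_ok inp L A0 A1 A2 m \<longleftrightarrow> (\<forall>x<L. m x = inp x) \<and> arr L 0 m = A0 \<and> arr L 3 m = A1 \<and> arr L 2 m = A2"

lemma arr_upd:
  assumes "\<rho> < 4" "\<rho>' < 4"
  shows "arr L \<rho> (m(addr L \<rho>' j := v)) = (if \<rho> = \<rho>' then (arr L \<rho> m)(j := v) else arr L \<rho> m)"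
proof -
  have "addr L \<rho> i = addr L \<rho>' j \<longleftrightarrow> \<rho> = \<rho>' \<and> i = j" for i
    using assms unfolding addr_def by presburger
  then show ?thesis by (auto simp: arr_def fun_eq_iff)
qed

lemma mem_ok_store:
  assumes "mem_ok inp L A0 A1 A2 m"
  shows "mem_ok inp L (A0(j := v)) A1 A2 (m(addr L 0 j := v))"
    "mem_ok inp L A0 (A1(j := v)) A2 (m(addr L 3 j := v))"
    "mem_ok inp L A0 A1 (A2(j := v)) (m(addr L 2 j := v))"
  using assms unfolding mem_ok_def by (simp_all add: arr_upd) (simp_all add: addr_def)

lemma mem_ok_read:
  assumes "mem_ok inp L A0 A1 A2 m"
  shows "x < L \<Longrightarrow> m x = inp x" "m (addr L 0 j) = A0 j" "m (addr L 3 j) = A1 j" "m (addr L 2 j) = A2 j"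
  using assms unfolding mem_ok_def arr_def by auto

definition p_add :: prog where
  "p_add = PFor r_q r_Q (PSeq (PMul r_a r_K r_q)
     (PSeq (PAsg r_q' (Plus (Mem (cell 3 (Plus (Reg r_a) (Reg r_lab)))) (Reg r_wz)))
     (PSeq (PIf (Minus (Plus (Reg r_q') (Const 1)) (Reg r_Q)) (PAsg r_q' (Minus (Reg r_q') (Reg r_Q))) PNop)
       (PSto (cell 2 (Plus (Reg r_tgt) (Reg r_q')))
         (Plus (Mem (cell 2 (Plus (Reg r_tgt) (Reg r_q')))) (Mem (cell 2 (Plus (Reg r_src) (Reg r_q)))))))))"

text \<open>Horner evaluation of \<open>nd\<close>. The looping factors of \<open>PMul\<close> are
  \<open>nv + 2\<close> and \<open>Q\<close>, which respect the iteration bound; the other factors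
  are node numbers and need not.\<close>

definition p_node :: "nat \<Rightarrow> nat \<Rightarrow> nat \<Rightarrow> nat \<Rightarrow> nat \<Rightarrow> nat \<Rightarrow> nat \<Rightarrow> prog" where
  "p_node d r1 k1 r2 k2 r3 k3 = PSeq (PAsg r_a (Plus (Reg r1) (Const k1)))
     (PSeq (PAsg r_b (Plus (Reg r2) (Const k2))) (PSeq (PAsg r_c (Plus (Reg r3) (Const k3)))
     (PSeq (PMul r_d r_nv2 r_a) (PSeq (PAsg r_d (Plus (Reg r_d) (Reg r_b)))
     (PSeq (PMul r_a r_nv2 r_d) (PSeq (PAsg r_a (Plus (Reg r_a) (Reg r_c))) (PMul d r_Q r_a)))))))"

text \<open>\<open>Suc h - x\<close> is nonzero exactly if \<open>x \<le> h\<close>; truncated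
  subtraction serves as comparison throughout.\<close>

definition p_push :: prog where
  "p_push = PIf (Minus (Plus (Reg r_h) (Const 1)) (Reg r_x))
     (PIf (Minus (Plus (Reg r_h) (Const 1)) (Reg r_y))
       (PSeq (p_node r_src r_h 0 r_l 0 r_x 0)
         (PSeq (PIf (Minus (Reg r_h) (Reg r_y)) (p_node r_tgt r_h 0 r_l 1 r_y 0) (p_node r_tgt r_h 1 r_l 1 r_h 1))
           p_add))
       PNop) PNop"

definition p_copy :: prog where
  "p_copy = PSeq (p_node r_src r_h 0 r_l 0 r_h 0) (PSeq (p_node r_tgt r_h 1 r_l 0 r_h 1)
     (PSeq (PAsg r_lab (Const 0)) (PSeq (PAsg r_wz (Const 0)) p_add)))"

lemma mods_p_add [simp]: "mods p_add = {1, r_q, r_a, r_q'}"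
  by (auto simp: p_add_def)

lemma mods_p_node [simp]: "mods (p_node d r1 k1 r2 k2 r3 k3) = {1, r_a, r_b, r_c, r_d, d}"
  by (auto simp: p_node_def)

lemma mods_p_push [simp]: "mods p_push = {1, r_a, r_b, r_c, r_d, r_q, r_q', r_src, r_tgt}"
  by (auto simp: p_push_def)

lemma mods_p_copy [simp]: "mods p_copy = {1, r_a, r_b, r_c, r_d, r_q, r_q', r_src, r_tgt, r_lab, r_wz}"
  by (auto simp: p_copy_def)

lemma wf_p_add [simp]: "wf_prog p_add"
  by (simp add: p_add_def)

lemma wf_p_node [simp]: "d \<noteq> 1 \<Longrightarrow> d \<noteq> r_Q \<Longrightarrow> wf_prog (p_node d r1 k1 r2 k2 r3 k3)"
  by (simp add: p_node_def)

lemma wf_p_push [simp]: "wf_prog p_push"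
  by (simp add: p_push_def)

lemma wf_p_copy [simp]: "wf_prog p_copy"
  by (simp add: p_copy_def)

lemma flip_free_p_add [simp]: "flip_free p_add"
  by (simp add: p_add_def)

lemma flip_free_p_node [simp]: "flip_free (p_node d r1 k1 r2 k2 r3 k3)"
  by (simp add: p_node_def)

lemma flip_free_p_push [simp]: "flip_free p_push"
  by (simp add: p_push_def)

lemma flip_free_p_copy [simp]: "flip_free p_copy"
  by (simp add: p_copy_def)

context machine begin

lemma add_block_upd:
  assumes "t < Q"
  shows "(add_block tb \<delta> A)(tb + t := add_block tb \<delta> A (tb + t) + a) =
     add_block tb (\<lambda>q'. \<delta> q' + (if t = q' then a else 0)) A"
  using assms by (auto simp: add_block_def fun_eq_iff)

lemma add_block_0: "add_block tb (\<lambda>_. 0) A = A"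
  by (auto simp: add_block_def fun_eq_iff)

definition size_regs :: "state \<Rightarrow> bool" where
  "size_regs s \<longleftrightarrow> fst s r_K = Suc kp \<and> fst s r_Q = Q \<and> fst s r_nv2 = N2"

text \<open>Source and target blocks have to be disjoint because the target grows while the source
  is still being read.\<close>

lemma wp_p_add:
  assumes NX: "table_ok NX" and sz: "size_regs s" and L: "fst s r_base = L" and mem: "mem_ok inp L A0 NX A (snd s)"
    and lb: "fst s r_lab = lb" "lb \<le> kp" and wz: "fst s r_wz = w * Z" "w < Wc"
    and src: "fst s r_src = sb" and tgt: "fst s r_tgt = tb"
    and disj: "\<And>q q'. q < Q \<Longrightarrow> q' < Q \<Longrightarrow> sb + q \<noteq> tb + q'"
    and X: "Q \<le> X" "Suc kp \<le> X"
  shows "wp X p_add (\<lambda>s'. mem_ok inp L A0 NX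
     (add_block tb (\<lambda>q'. \<Sum>q<Q. if trans NX lb (w * Z) q = q' then A (sb + q) else 0) A) (snd s')) s"
  unfolding p_add_def
proof (rule wp_For[where N = Q and Inv = "\<lambda>k s'. mem_ok inp L A0 NX
     (add_block tb (\<lambda>q'. \<Sum>q<k. if trans NX lb (w * Z) q = q' then A (sb + q) else 0) A) (snd s')"], goal_cases)
  case (5 k s1)
  define Ak where "Ak = add_block tb (\<lambda>q'. \<Sum>q<k. if trans NX lb (w * Z) q = q' then A (sb + q) else 0) A"
  define tr where "tr = trans NX lb (w * Z) k"
  have k: "k < Q" using 5 by simp
  have m: "mem_ok inp L A0 NX Ak (snd s1)" using 5 by (simp add: Ak_def)
  have r: "fst s1 r_q = k" "fst s1 r_K = Suc kp" "fst s1 r_Q = Q" "fst s1 r_lab = lb" "fst s1 r_wz = w * Z"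
    "fst s1 r_base = L" "fst s1 r_src = sb" "fst s1 r_tgt = tb"
    using 5 sz L lb wz src tgt by (simp_all add: size_regs_def)
  have trQ: "tr < Q" unfolding tr_def by (rule trans_lt[OF NX lb(2) wz(2) k])
  have src_eq: "Ak (sb + k) = A (sb + k)"
  proof -
    have "\<not> (tb \<le> sb + k \<and> sb + k < tb + Q)"
    proof
      assume *: "tb \<le> sb + k \<and> sb + k < tb + Q"
      then have "sb + k - tb < Q" by linarith
      from disj[OF k this] * show False by simp
    qed
    then show ?thesis unfolding Ak_def add_block_def by (simp only: if_False)
  qed
  have new: "Ak(tb + tr := Ak (tb + tr) + Ak (sb + k)) =
     add_block tb (\<lambda>q'. \<Sum>q<Suc k. if trans NX lb (w * Z) q = q' then A (sb + q) else 0) A"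
    unfolding src_eq unfolding Ak_def add_block_upd[OF trQ] by (simp add: tr_def)
  have st: "mem_ok inp L A0 NX (Ak(tb + tr := Ak (tb + tr) + Ak (sb + k)))
      ((snd s1)(addr L 2 (tb + tr) := Ak (tb + tr) + Ak (sb + k)))"
    by (rule mem_ok_store(3)[OF m])
  note rd = mem_ok_read(3,4)[OF m]
  define q' where "q' = NX (Suc kp * k + lb) + w * Z"
  have tr_eq: "tr = (if q' < Q then q' else q' - Q)"
    by (simp add: tr_def trans_def q'_def Let_def mult.commute)
  show ?case
    unfolding wp.simps(5)
  proof (rule wp_PMul)
    show "wp X (PAsg r_q' (Plus (Mem (cell 3 (Plus (Reg r_a) (Reg r_lab)))) (Reg r_wz)))
       (wp X (PIf (Minus (Plus (Reg r_q') (Const 1)) (Reg r_Q)) (PAsg r_q' (Minus (Reg r_q') (Reg r_Q))) PNop)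
         (wp X (PSto (cell 2 (Plus (Reg r_tgt) (Reg r_q')))
            (Plus (Mem (cell 2 (Plus (Reg r_tgt) (Reg r_q')))) (Mem (cell 2 (Plus (Reg r_src) (Reg r_q))))))
           (\<lambda>s''. mem_ok inp L A0 NX
              (add_block tb (\<lambda>q'. \<Sum>q<Suc k. if trans NX lb (w * Z) q = q' then A (sb + q) else 0) A)
              (snd (upd r_q (Suc k) s'')))))
       (upd 1 (fst s1 r_K) (upd r_a (fst s1 r_K * fst s1 r_q) s1))"
    proof (cases "q' < Q")
      case True
      then have "Suc q' - Q = 0" by simp
      then show ?thesis using True st[unfolded new] tr_eq
        by (simp add: r rd q'_def[symmetric] del: mult_Suc sum.lessThan_Suc)
    next
      case False
      then have "Suc q' - Q \<noteq> 0" by simp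
      then show ?thesis using False st[unfolded new] tr_eq
        by (simp add: r rd q'_def[symmetric] del: mult_Suc sum.lessThan_Suc)
    qed
  qed (use r X in simp_all)
qed (use assms in \<open>simp_all add: size_regs_def add_block_0\<close>)

lemma wp_p_node:
  assumes "size_regs s" "N2 \<le> X" "Q \<le> X" "d \<notin> {1, r_Q, r_a}"
    "{r1, r2, r3} \<inter> {1, r_a, r_b, r_c, r_d} = {}"
  shows "wp X (p_node d r1 k1 r2 k2 r3 k3)
     (\<lambda>s'. snd s' = snd s \<and> fst s' d = nd (fst s r1 + k1) (fst s r2 + k2) (fst s r3 + k3)) s"
  unfolding p_node_def wp.simps(2,5)
  apply (rule wp_PMul; (use assms in \<open>simp add: size_regs_def; fail\<close>)?)
  apply (rule wp_PMul; (use assms in \<open>simp add: size_regs_def; fail\<close>)?)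
  apply (rule wp_PMul; (use assms in \<open>simp add: size_regs_def; fail\<close>)?)
  using assms by (simp add: size_regs_def nd_def algebra_simps)

end

text \<open>The matrix names subset \<open>j\<close> by \<open>j + 2\<close>, while the counters
  follow the list of positive bounds. The label is one more than the position in that list, and 0 if
  the subset has no positive bound.\<close>

primrec lookup_label :: "(nat \<Rightarrow> nat) \<Rightarrow> nat \<Rightarrow> nat \<Rightarrow> nat" where
  "lookup_label inp 0 e = 0"
| "lookup_label inp (Suc t) e = (if inp (3 + 2 * t) + 2 = e then Suc t else lookup_label inp t e)"

text \<open>The row-major position \<open>v * n + u\<close> serves three times: as gadget vertex, as
  offset of the matrix entry, and, multiplied by \<open>n\<close>, as base of the variables at this
  end.\<close>

definition p_pv :: prog where
  "p_pv = PSeq (PMul r_px r_n r_v) (PAsg r_px (Plus (Reg r_px) (Reg r_u)))"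

definition p_unit :: prog where
  "p_unit = PSeq (PMul r_y r_n r_u) (PSeq (PAsg r_y (Plus (Reg r_y) (Reg r_v)))
     (PSeq (PAsg r_x (Reg r_px)) (PSeq (PAsg r_lab (Const 0)) (PSeq (PAsg r_wz (Const 0)) p_push))))"

text \<open>Label and weight registers are still 0 from \<open>p_unit\<close>.\<close>

definition p_loop :: prog where
  "p_loop = PSeq (PAsg r_fv (Mem (Plus (Reg r_deg) (Reg r_v))))
     (PIf (Minus (Plus (Reg r_u) (Const 1)) (Reg r_fv))
       (PSeq (PAsg r_x (Plus (Reg r_n2) (Reg r_px))) (PSeq (PAsg r_y (Reg r_x)) p_push)) PNop)"

text \<open>The sum of the two truncated differences is 0 exactly on equality, so the assignment of
  the label stands in the else branch.\<close>

definition p_label :: prog where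
  "p_label = PSeq (PAsg r_lab (Const 0)) (PIf (Minus (Reg r_u) (Reg r_v))
     (PFor r_t r_kp
       (PSeq (PAsg r_a (Plus (Mem (Plus (Const 3) (dbl (Reg r_t)))) (Const 2)))
         (PIf (Plus (Minus (Reg r_a) (Reg r_ent)) (Minus (Reg r_ent) (Reg r_a))) PNop
           (PAsg r_lab (Plus (Reg r_t) (Const 1)))))) PNop)"

definition p_var :: prog where
  "p_var = PIf (Minus (Reg r_fv) (Reg r_i))
     (PSeq (PMul r_e r_n r_px) (PSeq (PAsg r_w (Mem (cell 0 (Plus (Reg r_e) (Reg r_i)))))
     (PSeq (PMul r_wz r_Z r_w) (PSeq (PAsg r_x (Reg r_px)) (PSeq (PMul r_y r_n r_v)
     (PSeq (PAsg r_y (Plus (Reg r_n2) (Plus (Reg r_y) (Reg r_i)))) (PSeq p_push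
     (PSeq (PAsg r_x (Reg r_y)) (PSeq (PAsg r_y (Reg r_px)) p_push))))))))) PNop"

definition p_vars :: prog where
  "p_vars = PSeq (PAsg r_ent (Mem (Plus (Reg r_mat) (Reg r_px))))
     (PIf (Reg r_ent) (PSeq p_label (PFor r_i r_n p_var)) PNop)"

definition p_arcs :: prog where
  "p_arcs = PFor r_v r_n (PFor r_u r_n (PSeq p_pv (PSeq p_unit (PSeq p_loop p_vars))))"

definition p_count :: prog where
  "p_count = PFor r_h r_nv (PFor r_l r_nv1 (PSeq p_copy p_arcs))"

lemma mods_arcs [simp]:
  "mods p_pv = {1, r_px}"
  "mods p_unit = {1, r_a, r_b, r_c, r_d, r_q, r_q', r_src, r_tgt, r_x, r_y, r_lab, r_wz}"
  "mods p_loop = {1, r_a, r_b, r_c, r_d, r_q, r_q', r_src, r_tgt, r_x, r_y, r_fv}"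
  "mods p_label = {r_lab, r_t, r_a}"
  "mods p_var = {1, r_a, r_b, r_c, r_d, r_q, r_q', r_src, r_tgt, r_x, r_y, r_e, r_w, r_wz}"
  by (auto simp: p_pv_def p_unit_def p_loop_def p_label_def p_var_def)

lemma mods_vars [simp]:
  "mods p_vars = {1, r_a, r_b, r_c, r_d, r_q, r_q', r_src, r_tgt, r_x, r_y, r_e, r_w, r_wz, r_lab, r_t, r_ent, r_i}"
  by (auto simp: p_vars_def)

lemma mods_p_arcs [simp]:
  "mods p_arcs = {1, r_a, r_b, r_c, r_d, r_q, r_q', r_src, r_tgt, r_x, r_y, r_e, r_w, r_wz, r_lab, r_t, r_ent, r_i,
     r_px, r_fv, r_v, r_u}"
  by (auto simp: p_arcs_def)

lemma mods_p_count [simp]: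
  "mods p_count = {1, r_a, r_b, r_c, r_d, r_q, r_q', r_src, r_tgt, r_x, r_y, r_e, r_w, r_wz, r_lab, r_t, r_ent, r_i,
     r_px, r_fv, r_v, r_u, r_h, r_l}"
  by (auto simp: p_count_def)

lemma wf_arcs [simp]: "wf_prog p_pv" "wf_prog p_unit" "wf_prog p_loop" "wf_prog p_label" "wf_prog p_var"
  by (simp_all add: p_pv_def p_unit_def p_loop_def p_label_def p_var_def)

lemma wf_vars [simp]: "wf_prog p_vars"
  by (simp add: p_vars_def)

lemma wf_p_arcs [simp]: "wf_prog p_arcs"
  by (simp add: p_arcs_def)

lemma wf_p_count [simp]: "wf_prog p_count"
  by (simp add: p_count_def)

lemma flip_free_p_count [simp]: "flip_free p_count"
  by (simp add: p_count_def p_arcs_def p_vars_def p_pv_def p_unit_def p_loop_def p_label_def p_var_def)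

context machine begin

definition holds :: "(nat \<Rightarrow> nat) \<Rightarrow> nat \<Rightarrow> (nat \<Rightarrow> nat) \<Rightarrow> nat \<Rightarrow> (nat \<Rightarrow> nat \<Rightarrow> nat \<Rightarrow> mring) \<Rightarrow> (nat \<Rightarrow> nat) \<Rightarrow> bool"
where
  "holds inp L NX h V m \<longleftrightarrow> (\<exists>A. mem_ok inp L wt NX A m \<and> tab h V A)"

lemma wp_add_tab:
  assumes NX: "table_ok NX" and sz: "size_regs s" and L: "fst s r_base = L" and mem: "holds inp L NX h V (snd s)"
    and lb: "fst s r_lab = lb" "lb \<le> kp" and wz: "fst s r_wz = w * Z" "w < Wc"
    and tr: "\<And>m. trans NX lb (w * Z) (code m) = code (m0 + m)"
    and src: "fst s r_src = nd h l0 u0" "l0 \<le> nv" "u0 < N2"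
    and tgt: "fst s r_tgt = nd h1 l1 u1" "l1 < N2" "u1 < N2"
    and ne: "(h, l0, u0) \<noteq> (h1, l1, u1)"
    and X: "Q \<le> X" "Suc kp \<le> X"
  shows "wp X p_add (\<lambda>s'. holds inp L NX h (bumpV (h1, l1, u1) (Poly_Mapping.single m0 1 * V h l0 u0) V) (snd s')) s"
proof -
  from mem obtain A where A: "mem_ok inp L wt NX A (snd s)" "tab h V A" by (auto simp: holds_def)
  have l0: "l0 < N2" using src(2) by (simp add: N2_def)
  have "wp X p_add (\<lambda>s'. mem_ok inp L wt NX (add_block (nd h1 l1 u1)
      (\<lambda>q'. \<Sum>q<Q. if trans NX lb (w * Z) q = q' then A (nd h l0 u0 + q) else 0) A) (snd s')) s"
  proof (rule wp_p_add[OF NX sz L A(1) lb wz src(1) tgt(1) _ X])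
    fix q q' assume "q < Q" "q' < Q"
    then show "nd h l0 u0 + q \<noteq> nd h1 l1 u1 + q'"
      using nd_inj[OF l0 tgt(2) src(3) tgt(3), of q q' h h1] ne by auto
  qed
  then show ?thesis
  proof (rule wp_conseq)
    fix s' assume "mem_ok inp L wt NX (add_block (nd h1 l1 u1)
      (\<lambda>q'. \<Sum>q<Q. if trans NX lb (w * Z) q = q' then A (nd h l0 u0 + q) else 0) A) (snd s')"
    moreover have "tab h (bumpV (h1, l1, u1) (Poly_Mapping.single m0 1 * V h l0 u0) V) (add_block (nd h1 l1 u1)
      (\<lambda>q'. \<Sum>q<Q. if trans NX lb (w * Z) q = q' then A (nd h l0 u0 + q) else 0) A)"
      by (rule tab_add_block[OF A(2) le_refl src(2,3) tgt(2,3) tr])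
    ultimately show "holds inp L NX h (bumpV (h1, l1, u1) (Poly_Mapping.single m0 1 * V h l0 u0) V) (snd s')"
      unfolding holds_def by blast
  qed
qed

lemma wp_p_push:
  assumes NX: "table_ok NX" and sz: "size_regs s" and L: "fst s r_base = L" and mem: "holds inp L NX h V (snd s)"
    and lb: "fst s r_lab = lb" "lb \<le> kp" and wz: "fst s r_wz = w * Z" "w < Wc"
    and tr: "\<And>m. trans NX lb (w * Z) (code m) = code (m0 + m)"
    and r: "fst s r_h = h" "fst s r_l = l" "fst s r_x = x" "fst s r_y = y" and hl: "h < nv" "l \<le> nv"
    and X: "Q \<le> X" "Suc kp \<le> X" "N2 \<le> X"
  shows "wp X p_push (\<lambda>s'. holds inp L NX h (pushV h l (x, y, m0) V) (snd s')) s"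
proof (cases "x \<le> h \<and> y \<le> h")
  case False
  then have "pushV h l (x, y, m0) V = V" by (auto simp: pushV_def)
  then show ?thesis using False mem r by (auto simp: p_push_def)
next
  case True
  obtain h1 l1 u1 where t: "target h l y = (h1, l1, u1)" by (metis prod.exhaust)
  have b: "x < N2" "l1 < N2" "u1 < N2" "l1 = Suc l"
    using True hl t by (auto simp: N2_def target_def split: if_splits)
  have pV: "pushV h l (x, y, m0) V = bumpV (h1, l1, u1) (Poly_Mapping.single m0 1 * V h l x) V"
    using True t by (simp add: pushV_def)
  have "wp X (PSeq (p_node r_src r_h 0 r_l 0 r_x 0)
         (PSeq (PIf (Minus (Reg r_h) (Reg r_y)) (p_node r_tgt r_h 0 r_l 1 r_y 0) (p_node r_tgt r_h 1 r_l 1 r_h 1))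
           p_add)) (\<lambda>s'. holds inp L NX h (pushV h l (x, y, m0) V) (snd s')) s"
  proof (rule wp_Seq[OF wp_p_node[OF sz X(3,1)]], goal_cases)
    case (3 s1)
    then have s1: "size_regs s1" "snd s1 = snd s" "fst s1 r_src = nd h l x" "fst s1 r_h = h" "fst s1 r_l = l"
      "fst s1 r_y = y" "fst s1 r_lab = lb" "fst s1 r_wz = w * Z" "fst s1 r_base = L"
      using r sz lb wz L by (simp_all add: size_regs_def)
    have T: "wp X (PIf (Minus (Reg r_h) (Reg r_y)) (p_node r_tgt r_h 0 r_l 1 r_y 0) (p_node r_tgt r_h 1 r_l 1 r_h 1))
       (\<lambda>s2. snd s2 = snd s1 \<and> fst s2 r_tgt = nd h1 l1 u1) s1"
    proof (cases "y = h")
      case True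
      have *: "wp X (p_node r_tgt r_h 1 r_l 1 r_h 1) (\<lambda>s'. snd s' = snd s1 \<and>
          fst s' r_tgt = nd (fst s1 r_h + 1) (fst s1 r_l + 1) (fst s1 r_h + 1)) s1"
        by (rule wp_p_node[OF s1(1) X(3,1)]) auto
      have "(h1, l1, u1) = (Suc h, Suc l, Suc h)" using True t by (simp add: target_def)
      then show ?thesis using * True s1 by simp
    next
      case False
      have *: "wp X (p_node r_tgt r_h 0 r_l 1 r_y 0) (\<lambda>s'. snd s' = snd s1 \<and>
          fst s' r_tgt = nd (fst s1 r_h + 0) (fst s1 r_l + 1) (fst s1 r_y + 0)) s1"
        by (rule wp_p_node[OF s1(1) X(3,1)]) auto
      have "(h1, l1, u1) = (h, Suc l, y)" using False t by (simp add: target_def)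
      moreover have "h - y \<noteq> 0" using False True by simp
      ultimately show ?thesis using * s1 by simp
    qed
    show ?case
    proof (rule wp_Seq[OF T], goal_cases)
      case (1 s2)
      have "wp X p_add (\<lambda>s'. holds inp L NX h
         (bumpV (h1, l1, u1) (Poly_Mapping.single m0 1 * V h l x) V) (snd s')) s2"
      proof (rule wp_add_tab[OF NX])
        show "size_regs s2" "fst s2 r_base = L" "fst s2 r_lab = lb" "fst s2 r_wz = w * Z" "fst s2 r_src = nd h l x"
          using 1 s1 by (simp_all add: size_regs_def)
        show "fst s2 r_tgt = nd h1 l1 u1" "holds inp L NX h V (snd s2)" using 1 s1 mem by simp_all
        show "(h, l, x) \<noteq> (h1, l1, u1)" using b by simp
      qed (use b hl lb wz tr X in simp_all)
      then show ?case by (simp only: pV)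
    qed
  qed auto
  moreover have "Suc h - x \<noteq> 0" "Suc h - y \<noteq> 0" using True by simp_all
  ultimately show ?thesis using r by (simp add: p_push_def)
qed

lemma wp_p_copy:
  assumes NX: "table_ok NX" and sz: "size_regs s" and L: "fst s r_base = L" and mem: "holds inp L NX h V (snd s)"
    and r: "fst s r_h = h" "fst s r_l = l" and hl: "h < nv" "l \<le> nv"
    and X: "Q \<le> X" "Suc kp \<le> X" "N2 \<le> X"
  shows "wp X p_copy (\<lambda>s'. holds inp L NX h
    (bumpV (Suc h, l, Suc h) (Poly_Mapping.single {#} 1 * V h l h) V) (snd s')) s"
  unfolding p_copy_def
proof (rule wp_Seq[OF wp_p_node[OF sz X(3,1)]], goal_cases)
  case (3 s1)
  then have s1: "size_regs s1" "snd s1 = snd s" "fst s1 r_src = nd h l h" "fst s1 r_h = h" "fst s1 r_l = l"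
      "fst s1 r_base = L"
    using r sz L by (simp_all add: size_regs_def)
  show ?case
  proof (rule wp_Seq[OF wp_p_node[OF s1(1) X(3,1)]], goal_cases)
    case (3 s2)
    then have s2: "size_regs s2" "snd s2 = snd s" "fst s2 r_src = nd h l h" "fst s2 r_tgt = nd (Suc h) l (Suc h)"
      "fst s2 r_base = L"
      using s1 by (simp_all add: size_regs_def)
    show ?case
      unfolding wp.simps(2,5)
    proof (rule wp_add_tab[OF NX, where lb = 0 and w = 0])
      show "size_regs (upd r_wz (aval (Const 0) (upd r_lab (aval (Const 0) s2) s2)) (upd r_lab (aval (Const 0) s2) s2))"
        using s2 by (simp add: size_regs_def)
      show "trans NX 0 (0 * Z) (code m) = code ({#} + m)" for m using trans_unit[OF NX] by simp
    qed (use s2 mem hl X Wc_pos in \<open>simp_all add: N2_def\<close>)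
  qed auto
qed auto

end

text \<open>\<open>inp\<close> is the encoded instance of length \<open>L\<close>: three numbers,
  \<open>kp\<close> pairs, the matrix and the degrees. Variables with \<open>u \<le> v\<close> get
  label 0, so that an edge is counted at one of its ends only.\<close>

locale machine_input = machine n f E kp cap lab wt Wc
  for n f E kp cap lab wt Wc +
  fixes inp :: "nat \<Rightarrow> nat" and L :: nat
  assumes L_eq: "L = 3 + 2 * kp + n * n + n"
    and inp_f: "v < n \<Longrightarrow> inp (3 + 2 * kp + n * n + v) = f v"
    and inp_E: "v < n \<Longrightarrow> u < n \<Longrightarrow> inp (3 + 2 * kp + pv v u) \<noteq> 0 \<longleftrightarrow> E v u"
    and inp_lab: "v < n \<Longrightarrow> u < n \<Longrightarrow> i < n \<Longrightarrow>
      lab (var v u i) = (if v < u then lookup_label inp kp (inp (3 + 2 * kp + pv v u)) else 0)"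
begin

definition env :: "state \<Rightarrow> bool" where
  "env s \<longleftrightarrow> size_regs s \<and> fst s r_base = L \<and> fst s r_n = n \<and> fst s r_kp = kp \<and> fst s r_mat = 3 + 2 * kp \<and>
     fst s r_n2 = n * n \<and> fst s r_deg = 3 + 2 * kp + n * n \<and> fst s r_Z = Z \<and> fst s r_nv = nv \<and> fst s r_nv1 = Suc nv"

lemma env_frame:
  assumes "env s" "\<And>x. x \<in> {r_base, r_n, r_kp, r_mat, r_n2, r_deg, r_Z, r_nv, r_nv1, r_K, r_Q, r_nv2} \<Longrightarrow> fst s' x = fst s x"
  shows "env s'"
  using assms by (simp add: env_def size_regs_def)

definition big :: "nat \<Rightarrow> bool" where
  "big X \<longleftrightarrow> Q \<le> X \<and> Suc kp \<le> X \<and> N2 \<le> X \<and> n \<le> X \<and> Z \<le> X"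

lemma wp_p_pv:
  assumes "env s" "big X" "fst s r_v = v" "fst s r_u = u"
  shows "wp X p_pv (\<lambda>s'. snd s' = snd s \<and> fst s' r_px = pv v u) s"
  unfolding p_pv_def wp.simps(2,5)
  by (rule wp_PMul) (use assms in \<open>simp_all add: env_def big_def pv_def mult.commute\<close>)

definition loop_regs :: "nat \<Rightarrow> nat \<Rightarrow> nat \<Rightarrow> nat \<Rightarrow> state \<Rightarrow> bool" where
  "loop_regs h l v u s \<longleftrightarrow> env s \<and> fst s r_h = h \<and> fst s r_l = l \<and> fst s r_v = v \<and> fst s r_u = u \<and>
     h < nv \<and> l \<le> nv \<and> v < n \<and> u < n"

lemma wp_p_unit:
  assumes NX: "table_ok NX" and lr: "loop_regs h l v u s" and X: "big X" and px: "fst s r_px = pv v u"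
    and mem: "holds inp L NX h V (snd s)"
  shows "wp X p_unit (\<lambda>s'. holds inp L NX h (pushV h l (pv v u, pv u v, {#}) V) (snd s')
     \<and> fst s' r_lab = 0 \<and> fst s' r_wz = 0) s"
  unfolding p_unit_def wp.simps(2,5)
proof (rule wp_PMul, goal_cases)
  case 7
  let ?s = "upd r_wz (aval (Const 0) s) (upd r_lab 0 (upd r_x (pv v u) (upd r_y (pv u v)
     (upd 1 n (upd r_y (n * u) s)))))"
  have "wp X p_push (\<lambda>s'. holds inp L NX h (pushV h l (pv v u, pv u v, {#}) V) (snd s')) ?s"
  proof (rule wp_p_push[OF NX, where lb = 0 and w = 0])
    show "trans NX 0 (0 * Z) (code m) = code ({#} + m)" for m using trans_unit[OF NX] by simp
  qed (use lr X mem Wc_pos in \<open>simp_all add: loop_regs_def env_def size_regs_def big_def\<close>)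
  then have "wp X p_push (\<lambda>s'. holds inp L NX h (pushV h l (pv v u, pv u v, {#}) V) (snd s')
     \<and> fst s' r_lab = 0 \<and> fst s' r_wz = 0) ?s"
    by (rule wp_conseq) simp
  then show ?case
    using lr px by (simp add: loop_regs_def env_def pv_def mult.commute)
qed (use lr X in \<open>simp_all add: loop_regs_def env_def big_def\<close>)

lemma wp_p_loop:
  assumes NX: "table_ok NX" and lr: "loop_regs h l v u s" and X: "big X" and px: "fst s r_px = pv v u"
    and mem: "holds inp L NX h V (snd s)" and z: "fst s r_lab = 0" "fst s r_wz = 0"
  shows "wp X p_loop (\<lambda>s'. holds inp L NX h
     (fold (pushV h l) (if f v \<le> u then [(cv v u, cv v u, {#})] else []) V) (snd s') \<and> fst s' r_fv = f v) s"
proof -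
  have fv: "snd s (fst s r_deg + fst s r_v) = f v"
  proof -
    obtain A where "mem_ok inp L wt NX A (snd s)" using mem by (auto simp: holds_def)
    moreover have "fst s r_deg + fst s r_v < L" using lr unfolding loop_regs_def env_def by (simp add: L_eq)
    ultimately show ?thesis using lr inp_f[of v] by (simp add: mem_ok_read(1) loop_regs_def env_def)
  qed
  show ?thesis
  proof (cases "f v \<le> u")
    case False
    then have "Suc u - f v = 0" by simp
    then show ?thesis using False fv mem lr by (simp add: p_loop_def loop_regs_def)
  next
    case True
    let ?s = "upd r_y (cv v u) (upd r_x (cv v u) (upd r_fv (f v) s))"
    have "wp X p_push (\<lambda>s'. holds inp L NX h (pushV h l (cv v u, cv v u, {#}) V) (snd s')) ?s"
    proof (rule wp_p_push[OF NX, where lb = 0 and w = 0])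
      show "trans NX 0 (0 * Z) (code m) = code ({#} + m)" for m using trans_unit[OF NX] by simp
    qed (use lr X mem Wc_pos z in \<open>simp_all add: loop_regs_def env_def size_regs_def big_def\<close>)
    then have "wp X p_push (\<lambda>s'. holds inp L NX h (pushV h l (cv v u, cv v u, {#}) V) (snd s') \<and> fst s' r_fv = f v) ?s"
      by (rule wp_conseq) simp
    moreover have "Suc u - f v \<noteq> 0" using True by simp
    moreover have "n * n + pv v u = cv v u" by (simp add: pv_def cv_def)
    ultimately show ?thesis using True fv px lr by (simp add: p_loop_def loop_regs_def env_def)
  qed
qed

lemma wp_p_label:
  assumes lr: "loop_regs h l v u s" and X: "big X" and mem: "holds inp L NX h V (snd s)" and e: "fst s r_ent = e"
  shows "wp X p_label (\<lambda>s'. snd s' = snd s \<and> fst s' r_lab = (if v < u then lookup_label inp kp e else 0)) s"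
proof (cases "v < u")
  case False
  then show ?thesis using lr by (simp add: p_label_def loop_regs_def)
next
  case True
  let ?s = "upd r_lab 0 s"
  obtain A where A: "mem_ok inp L wt NX A (snd s)" using mem by (auto simp: holds_def)
  have "wp X (PFor r_t r_kp
       (PSeq (PAsg r_a (Plus (Mem (Plus (Const 3) (dbl (Reg r_t)))) (Const 2)))
         (PIf (Plus (Minus (Reg r_a) (Reg r_ent)) (Minus (Reg r_ent) (Reg r_a))) PNop
           (PAsg r_lab (Plus (Reg r_t) (Const 1))))))
     (\<lambda>s'. snd s' = snd s \<and> fst s' r_lab = lookup_label inp kp e) ?s"
  proof (rule wp_For[where N = kp and Inv = "\<lambda>t s'. snd s' = snd s \<and> fst s' r_lab = lookup_label inp t e"], goal_cases)
    case (5 t s1)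
    then have "3 + 2 * t < L" by (simp add: L_eq)
    then have rd: "snd s1 (3 + 2 * t) = inp (3 + 2 * t)" using mem_ok_read(1)[OF A] 5 by simp
    have "inp (3 + 2 * t) + 2 - e + (e - (inp (3 + 2 * t) + 2)) = 0 \<longleftrightarrow> inp (3 + 2 * t) + 2 = e" by linarith
    then show ?case using 5 rd e by (simp del: add_2_eq_Suc add_2_eq_Suc')
  qed (use lr X in \<open>simp_all add: loop_regs_def env_def big_def\<close>)
  then show ?thesis using True lr by (simp add: p_label_def loop_regs_def)
qed

lemma wp_p_var:
  assumes NX: "table_ok NX" and lr: "loop_regs h l v u s" and X: "big X" and px: "fst s r_px = pv v u"
    and mem: "holds inp L NX h V (snd s)" and fv: "fst s r_fv = f v" and i: "fst s r_i = i" "i < n"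
    and lb: "fst s r_lab = lab (var v u i)"
  shows "wp X p_var (\<lambda>s'. holds inp L NX h (fold (pushV h l) (if i < f v then
     [(pv v u, cv v i, {#var v u i#}), (cv v i, pv v u, {#var v u i#})] else []) V) (snd s')) s"
proof (cases "i < f v")
  case False
  then show ?thesis using mem fv i by (simp add: p_var_def)
next
  case True
  let ?e = "var v u i"
  obtain A where A: "mem_ok inp L wt NX A (snd s)" using mem by (auto simp: holds_def)
  have e: "n * pv v u + i = ?e" by (simp add: var_def pv_def mult.commute)
  have c: "n * n + (n * v + i) = cv v i" by (simp add: cv_def mult.commute)
  have rd: "snd s (addr L 0 ?e) = wt ?e" by (rule mem_ok_read(2)[OF A])
  have tr: "trans NX (lab ?e) (wt ?e * Z) (code m) = code ({#?e#} + m)" for m by (rule trans_var[OF NX])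
  have Zw: "Z * wt ?e = wt ?e * Z" by (rule mult.commute)
  have regs: "fst s r_n = n" "fst s r_Z = Z" "fst s r_v = v" "fst s r_base = L" "fst s r_n2 = n * n"
    using lr by (simp_all add: loop_regs_def env_def)
  let ?s1 = "upd r_e (n * pv v u) s"
  let ?s2 = "upd r_w (wt ?e) (upd 1 n ?s1)"
  let ?s3 = "upd r_x (pv v u) (upd 1 Z (upd r_wz (wt ?e * Z) ?s2))"
  let ?s4 = "upd r_y (cv v i) (upd 1 n (upd r_y (n * v) ?s3))"
  have lr4: "loop_regs h l v u ?s4" using lr by (simp add: loop_regs_def env_def size_regs_def)
  have P1: "wp X p_push (\<lambda>s'. holds inp L NX h (pushV h l (pv v u, cv v i, {#?e#}) V) (snd s')) ?s4"
    by (rule wp_p_push[OF NX _ _ _ _ lab_le _ wt_lt tr])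
       (use lr X mem lb in \<open>simp_all add: loop_regs_def env_def size_regs_def big_def\<close>)
  have P2: "wp X (PSeq p_push (PSeq (PAsg r_x (Reg r_y)) (PSeq (PAsg r_y (Reg r_px)) p_push)))
    (\<lambda>s'. holds inp L NX h (fold (pushV h l)
     [(pv v u, cv v i, {#?e#}), (cv v i, pv v u, {#?e#})] V) (snd s')) ?s4"
  proof (rule wp_Seq[OF P1], goal_cases)
    case (1 s5)
    have r5: "fst s5 r_y = cv v i" "fst s5 r_px = pv v u" "fst s5 r_lab = lab ?e" "fst s5 r_wz = wt ?e * Z"
      using 1(2) px lb by simp_all
    have l5: "loop_regs h l v u s5" using lr4 1(2) by (simp add: loop_regs_def env_def size_regs_def)
    have "wp X p_push (\<lambda>s'. holds inp L NX h (pushV h l (cv v i, pv v u, {#?e#})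
        (pushV h l (pv v u, cv v i, {#?e#}) V)) (snd s')) (upd r_y (pv v u) (upd r_x (cv v i) s5))"
      by (rule wp_p_push[OF NX _ _ _ _ lab_le _ wt_lt tr])
         (use l5 r5 X 1(1) in \<open>simp_all add: loop_regs_def env_def size_regs_def big_def\<close>)
    then show ?case by (simp add: r5)
  qed
  have "f v - i \<noteq> 0" using True by simp
  moreover have "wp X (PSeq (PMul r_e r_n r_px) (PSeq (PAsg r_w (Mem (cell 0 (Plus (Reg r_e) (Reg r_i)))))
     (PSeq (PMul r_wz r_Z r_w) (PSeq (PAsg r_x (Reg r_px)) (PSeq (PMul r_y r_n r_v)
     (PSeq (PAsg r_y (Plus (Reg r_n2) (Plus (Reg r_y) (Reg r_i)))) (PSeq p_push
     (PSeq (PAsg r_x (Reg r_y)) (PSeq (PAsg r_y (Reg r_px)) p_push)))))))))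
    (\<lambda>s'. holds inp L NX h (fold (pushV h l)
     [(pv v u, cv v i, {#?e#}), (cv v i, pv v u, {#?e#})] V) (snd s')) s"
    apply (subst wp.simps(5))
    apply (rule wp_PMul; (use regs X in \<open>simp add: big_def; fail\<close>)?)
    apply (subst wp.simps(5), subst wp.simps(2), subst wp.simps(5))
    apply (rule wp_PMul; (use regs X in \<open>simp add: big_def; fail\<close>)?)
    apply (subst wp.simps(5), subst wp.simps(2), subst wp.simps(5))
    apply (rule wp_PMul; (use regs X in \<open>simp add: big_def; fail\<close>)?)
    apply (subst wp.simps(5), subst wp.simps(2))
    using P2 by (simp add: regs px i e rd Zw c del: wp.simps)
  ultimately show ?thesis using True fv i by (simp add: p_var_def del: wp.simps(5))
qed

lemma wp_p_vars:
  assumes NX: "table_ok NX" and lr: "loop_regs h l v u s" and X: "big X" and px: "fst s r_px = pv v u"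
    and mem: "holds inp L NX h V (snd s)" and fv: "fst s r_fv = f v"
  shows "wp X p_vars (\<lambda>s'. holds inp L NX h (fold (pushV h l)
     (if E v u then concat (map (\<lambda>i. if i < f v then
         [(pv v u, cv v i, {#var v u i#}), (cv v i, pv v u, {#var v u i#})] else []) [0..<n]) else []) V) (snd s')) s"
proof -
  let ?ent = "inp (3 + 2 * kp + pv v u)"
  let ?g = "\<lambda>i. if i < f v then [(pv v u, cv v i, {#var v u i#}), (cv v i, pv v u, {#var v u i#})] else []"
  have vu: "v < n" "u < n" using lr by (simp_all add: loop_regs_def)
  have ent: "snd s (fst s r_mat + fst s r_px) = ?ent"
  proof -
    obtain A where A: "mem_ok inp L wt NX A (snd s)" using mem by (auto simp: holds_def)
    have "pv v u < n * n" using row_lt[OF vu] by (simp add: pv_def)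
    then have "3 + 2 * kp + pv v u < L" unfolding L_eq by linarith
    then show ?thesis using mem_ok_read(1)[OF A] lr px by (simp add: loop_regs_def env_def)
  qed
  show ?thesis
  proof (cases "E v u")
    case False
    then have "?ent = 0" using inp_E[OF vu] by simp
    then show ?thesis using False ent mem by (simp add: p_vars_def)
  next
    case True
    then have ne: "?ent \<noteq> 0" using inp_E[OF vu] by simp
    let ?s = "upd r_ent ?ent s"
    have lr': "loop_regs h l v u ?s" using lr by (simp add: loop_regs_def env_def size_regs_def)
    have mem': "holds inp L NX h V (snd ?s)" using mem by simp
    have "wp X (PSeq p_label (PFor r_i r_n p_var))
      (\<lambda>s'. holds inp L NX h (fold (pushV h l) (concat (map ?g [0..<n])) V) (snd s')) ?s"
    proof (rule wp_Seq[OF wp_p_label[OF lr' X mem', of ?ent]], goal_cases)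
      case (2 s1)
      have s1: "snd s1 = snd s" "fst s1 r_lab = (if v < u then lookup_label inp kp ?ent else 0)"
        "fst s1 r_px = pv v u" "fst s1 r_fv = f v" and l1: "loop_regs h l v u s1"
        using 2 px fv lr' by (simp_all add: loop_regs_def env_def size_regs_def)
      show ?case
      proof (rule wp_For[where N = n and
            Inv = "\<lambda>i s'. holds inp L NX h (fold (pushV h l) (concat (map ?g [0..<i])) V) (snd s')"], goal_cases)
        case (5 i s2)
        have l2: "loop_regs h l v u s2" using 5(4) l1 by (simp add: loop_regs_def env_def size_regs_def)
        have r2: "fst s2 r_px = pv v u" "fst s2 r_fv = f v" "fst s2 r_lab = lab (var v u i)"
          using 5(4) s1 inp_lab[OF vu 5(1)] by simp_all
        show ?case
          by (rule wp_conseq[OF wp_p_var[OF NX l2 X r2(1) 5(2) r2(2) 5(3,1) r2(3)]]) simp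
      qed (use s1 mem l1 X in \<open>simp_all add: loop_regs_def env_def big_def\<close>)
    qed simp
    then show ?thesis
      unfolding p_vars_def by (subst wp.simps(5)) (use True ne ent in \<open>simp del: wp.simps(5,7)\<close>)
  qed
qed

lemma wp_p_arcs:
  assumes NX: "table_ok NX" and ev: "env s" and X: "big X" and hl: "fst s r_h = h" "fst s r_l = l" "h < nv" "l \<le> nv"
    and mem: "holds inp L NX h V (snd s)"
  shows "wp X p_arcs (\<lambda>s'. holds inp L NX h (fold (pushV h l) arcs V) (snd s')) s"
  unfolding p_arcs_def
proof (rule wp_For[where N = n and Inv = "\<lambda>v s'. holds inp L NX h
      (fold (pushV h l) (concat (map (\<lambda>v. concat (map (arcs_at v) [0..<n])) [0..<v])) V) (snd s')"], goal_cases)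
  case (5 v s1)
  let ?V = "fold (pushV h l) (concat (map (\<lambda>v. concat (map (arcs_at v) [0..<n])) [0..<v])) V"
  have ev1: "env s1" by (rule env_frame[OF ev]) (use 5(4) in auto)
  have r1: "fst s1 r_h = h" "fst s1 r_l = l" using 5(4) hl by simp_all
  show ?case
  proof (rule wp_For[where N = n and Inv = "\<lambda>u s'. holds inp L NX h
      (fold (pushV h l) (concat (map (arcs_at v) [0..<u])) ?V) (snd s')"], goal_cases)
    case (5 u s2)
    let ?V' = "fold (pushV h l) (concat (map (arcs_at v) [0..<u])) ?V"
    have ev2: "env s2" by (rule env_frame[OF ev1]) (use 5(4) in auto)
    have l2: "loop_regs h l v u s2"
      using ev2 5(1,3,4) r1 hl \<open>v < n\<close> \<open>fst s1 r_v = v\<close> by (simp add: loop_regs_def)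
    have vu2: "fst s2 r_v = v" "fst s2 r_u = u" using l2 by (simp_all add: loop_regs_def)
    show ?case
    proof (rule wp_Seq[OF wp_p_pv[OF ev2 X vu2]], goal_cases)
      case (1 s3)
      have l3: "loop_regs h l v u s3" using l2 1(2) by (simp add: loop_regs_def env_def size_regs_def)
      have m3: "holds inp L NX h ?V' (snd s3)" using 1(1) 5(2) by simp
      have px3: "fst s3 r_px = pv v u" using 1(1) by simp
      show ?case
      proof (rule wp_Seq[OF wp_p_unit[OF NX l3 X px3 m3]], goal_cases)
        case (1 s4)
        have l4: "loop_regs h l v u s4" using l3 1(2) by (simp add: loop_regs_def env_def size_regs_def)
        have px4: "fst s4 r_px = pv v u" using 1(2) px3 by simp
        have m4: "holds inp L NX h (pushV h l (pv v u, pv u v, {#}) ?V') (snd s4)" using 1(1) by blast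
        show ?case
        proof (rule wp_Seq[OF wp_p_loop[OF NX l4 X px4 m4]], goal_cases)
          case (3 s5)
          have l5: "loop_regs h l v u s5" using l4 3(2) by (simp add: loop_regs_def env_def size_regs_def)
          have px5: "fst s5 r_px = pv v u" using 3(2) px4 by simp
          have fv5: "fst s5 r_fv = f v" using 3(1) by blast
          show ?case
          proof (rule wp_conseq[OF wp_p_vars[OF NX l5 X px5 conjunct1[OF 3(1)] fv5]], goal_cases)
            case (1 s6)
            then show ?case by (simp add: arcs_at_def)
          qed
        qed (use 1(1) in blast)+
      qed
    qed
  qed (use ev1 X 5(2) in \<open>simp_all add: env_def big_def\<close>)
qed (use ev X mem in \<open>simp_all add: env_def big_def arcs_def\<close>)

lemma wp_p_count:
  assumes NX: "table_ok NX" and ev: "env s" and X: "big X" and mem: "holds inp L NX 0 (VV 0 0) (snd s)"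
  shows "wp X p_count (\<lambda>s'. holds inp L NX nv (VV nv 0) (snd s')) s"
  unfolding p_count_def
proof (rule wp_For[where N = nv and Inv = "\<lambda>h s'. holds inp L NX h (VV h 0) (snd s')"], goal_cases)
  case (5 h s1)
  have ev1: "env s1" by (rule env_frame[OF ev]) (use 5(4) in auto)
  show ?case
  proof (rule wp_For[where N = "Suc nv" and Inv = "\<lambda>l s'. holds inp L NX h (VV h l) (snd s')"], goal_cases)
    case (5 l s2)
    have ev2: "env s2" by (rule env_frame[OF ev1]) (use 5(4) in auto)
    have r2: "size_regs s2" "fst s2 r_base = L" "fst s2 r_h = h" "fst s2 r_l = l"
      using ev2 5(3,4) \<open>fst s1 r_h = h\<close> by (simp_all add: env_def)
    have hl: "h < nv" "l \<le> nv" using \<open>h < nv\<close> 5(1) by simp_all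
    have X': "Q \<le> X" "Suc kp \<le> X" "N2 \<le> X" using X by (simp_all add: big_def)
    show ?case
    proof (rule wp_Seq[OF wp_p_copy[OF NX r2(1,2) 5(2) r2(3,4) hl X']], goal_cases)
      case (1 s3)
      have ev3: "env s3" by (rule env_frame[OF ev2]) (use 1(2) in auto)
      have r3: "fst s3 r_h = h" "fst s3 r_l = l" using 1(2) r2 by simp_all
      show ?case
      proof (rule wp_conseq[OF wp_p_arcs[OF NX ev3 X r3 hl 1(1)]], goal_cases)
        case (1 s4)
        have "fold (pushV h l) arcs (bumpV (Suc h, l, Suc h) (Poly_Mapping.single {#} 1 * VV h l h l h) (VV h l)) =
          VV h (Suc l)"
          by (intro ext VV_step)
        with 1(1) show ?case by simp
      qed
    qed
  next
    \<comment> \<open>With rows up to \<open>nv\<close> processed, level \<open>h\<close> is dropped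
      from the claim, and what remains is the state at the start of level
      \<open>Suc h\<close>.\<close>
    case (6 s2)
    then obtain A where "mem_ok inp L wt NX A (snd s2)" "tab h (VV h (Suc nv)) A" by (auto simp: holds_def)
    then have "mem_ok inp L wt NX A (snd s2)" "tab (Suc h) (VV (Suc h) 0) A"
      by (auto intro: tab_cong[of h] VV_next)
    then show ?case by (auto simp: holds_def)
  qed (use ev1 X 5(2) in \<open>simp_all add: env_def big_def N2_def\<close>)
qed (use ev X mem in \<open>simp_all add: env_def big_def N2_def\<close>)

end

section \<open>Building the transition table and reading off the answer\<close>

definition p_spread :: prog where
  "p_spread = PFor r_p r_tot
     (PSto (cell 3 (Plus (Reg r_p) (Reg r_blk))) (Plus (Mem (cell 3 (Reg r_p))) (Reg r_Z)))"

definition p_mark :: prog where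
  "p_mark = PSeq (PAsg r_ptr (Plus (Reg r_t) (Const 1)))
     (PFor r_s r_cz (PSeq (PSto (cell 3 (Reg r_ptr)) (Plus (Reg r_s) (Reg r_Z)))
       (PAsg r_ptr (Plus (Reg r_ptr) (Reg r_K)))))"

text \<open>In truncated subtraction \<open>a - (a - b)\<close> is the minimum of \<open>a\<close>
  and \<open>b\<close>; doubled it is the cap.\<close>

definition p_stage :: prog where
  "p_stage = PSeq (PAsg r_cap (Mem (Plus (Const 4) (dbl (Reg r_t)))))
     (PSeq (PAsg r_cap (dbl (Minus (Reg r_cap) (Minus (Reg r_cap) (Plus (Reg r_n2) (Const 1))))))
     (PSeq (PMul r_blk r_K r_Z) (PSeq (PMul r_tot r_blk r_cap) (PSeq p_spread
     (PSeq (PMul r_cz r_Z r_cap) (PSeq p_mark (PAsg r_Z (Plus (Reg r_Z) (Reg r_cz)))))))))"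

definition p_sizes :: prog where
  "p_sizes = PSeq (PMul r_Q r_Z r_NR) (PSeq (PAsg r_Q (Plus (Reg r_Q) (Reg r_Z)))
     (PSeq (PSto (cell 2 (Const 0)) (Const 1)) (PSeq (PAsg r_nv1 (Plus (Reg r_nv) (Const 1)))
     (PSeq (PAsg r_nv2 (Plus (Reg r_nv) (Const 2))) (PAsg r_Wc (Plus (Reg r_NR) (Const 1)))))))"

definition p_tables :: prog where
  "p_tables = PSeq (PAsg r_K (Plus (Reg r_kp) (Const 1))) (PSeq (PAsg r_Z (Const 1))
     (PSeq (PFor r_t r_kp p_stage) (PSeq (PMul r_NR r_nv r_range) (PSeq (PMul r_blk r_K r_Z)
     (PSeq (PMul r_tot r_blk r_NR) (PSeq p_spread p_sizes))))))"

text \<open>Without a remainder operation, parity is \<open>val\<close> minus twice its half. For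
  each weight only the top counter state is inspected.\<close>

definition p_final :: prog where
  "p_final = PSeq (p_node r_tgt r_nv 0 r_nv 0 r_nv 0) (PSeq (PAsg r_top (Minus (Reg r_Z) (Const 1)))
     (PSeq (PAsg 0 (Const 0)) (PFor r_w r_Wc (PSeq (PMul r_a r_Z r_w)
       (PSeq (PAsg r_val (Mem (cell 2 (Plus (Reg r_tgt) (Plus (Reg r_a) (Reg r_top))))))
         (PIf (Minus (Reg r_val) (dbl (Half (Reg r_val)))) (PAsg 0 (Const 1)) PNop))))))"

definition p_rest :: prog where
  "p_rest = PSeq p_tables (PSeq p_count p_final)"

lemma mods_spread [simp]: "mods p_spread = {r_p}" "mods p_mark = {r_ptr, r_s}"
  by (auto simp: p_spread_def p_mark_def)

lemma mods_p_stage [simp]: "mods p_stage = {1, r_cap, r_blk, r_tot, r_p, r_cz, r_ptr, r_s, r_Z}"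
  by (auto simp: p_stage_def)

lemma mods_p_sizes [simp]: "mods p_sizes = {1, r_Q, r_nv1, r_nv2, r_Wc}"
  by (auto simp: p_sizes_def)

lemma wf_tables [simp]: "wf_prog p_spread" "wf_prog p_mark" "wf_prog p_stage" "wf_prog p_sizes"
  by (simp_all add: p_spread_def p_mark_def p_stage_def p_sizes_def)

lemma wf_p_tables [simp]: "wf_prog p_tables"
  by (simp add: p_tables_def)

lemma wf_p_rest [simp]: "wf_prog p_rest"
  by (simp add: p_rest_def p_final_def)

lemma flip_free_p_rest [simp]: "flip_free p_rest"
  by (simp add: p_rest_def p_final_def p_tables_def p_stage_def p_spread_def p_mark_def p_sizes_def)

text \<open>The copying works in place: a new cell is the cell one block earlier plus
  \<open>Z\<close>, so block \<open>d\<close> has accumulated \<open>d * Z\<close>.\<close>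

lemma wp_p_spread:
  assumes r: "fst s r_tot = tot" "fst s r_blk = B" "fst s r_Z = Z" "fst s r_base = L" "B > 0" "tot \<le> X"
    and mem: "mem_ok inp L A0 F A2 (snd s)"
  shows "wp X p_spread (\<lambda>s'. mem_ok inp L A0 (\<lambda>j. if j < B + tot then spread B Z F j else F j) A2 (snd s')) s"
  unfolding p_spread_def
proof (rule wp_For[where N = tot and Inv = "\<lambda>p s'. mem_ok inp L A0 (\<lambda>j. if j < B + p then spread B Z F j else F j) A2 (snd s')"],
    goal_cases)
  case 4
  have "(\<lambda>j. if j < B + 0 then spread B Z F j else F j) = F" by (auto simp: spread_def fun_eq_iff)
  then show ?case using mem by simp
next
  case (5 p s1)
  let ?G = "\<lambda>p j. if j < B + p then spread B Z F j else F j"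
  have r1: "fst s1 r_p = p" "fst s1 r_blk = B" "fst s1 r_Z = Z" "fst s1 r_base = L" using 5 r by simp_all
  have "?G p p = spread B Z F p" using r by simp
  moreover have "spread B Z F (p + B) = spread B Z F p + Z" using r by (simp add: spread_def)
  ultimately have "(?G p)(p + B := ?G p p + Z) = ?G (Suc p)"
    by (auto simp: fun_eq_iff less_Suc_eq add.commute[of B])
  then have "mem_ok inp L A0 (?G (Suc p)) A2 ((snd s1)(addr L 3 (p + B) := ?G p p + Z))"
    using mem_ok_store(2)[OF 5(2), of "p + B" "?G p p + Z"] by simp
  moreover have "snd s1 (addr L 3 p) = ?G p p" by (rule mem_ok_read(3)[OF 5(2)])
  ultimately show ?case by (simp add: r1 del: mult_Suc)
qed (use r in simp_all)

text \<open>The entries of label \<open>Suc t\<close> lie \<open>K\<close> cells apart, so the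
  pointer reaches them by additions alone.\<close>

lemma wp_p_mark:
  assumes r: "fst s r_t = t" "fst s r_cz = b" "fst s r_Z = Z" "fst s r_K = K" "fst s r_base = L" "Suc t < K" "b \<le> X"
    and mem: "mem_ok inp L A0 F A2 (snd s)"
  shows "wp X p_mark (\<lambda>s'. mem_ok inp L A0 (mark K (Suc t) Z b F) A2 (snd s')) s"
  unfolding p_mark_def wp.simps(2,5)
proof (rule wp_For[where N = b and Inv = "\<lambda>k s'. mem_ok inp L A0 (mark K (Suc t) Z k F) A2 (snd s') \<and>
     fst s' r_ptr = k * K + Suc t"], goal_cases)
  case 4
  have "mark K (Suc t) Z 0 F = F" by (simp add: mark_def fun_eq_iff)
  then show ?case using mem r by simp
next
  case (5 k s1)
  have r1: "fst s1 r_s = k" "fst s1 r_Z = Z" "fst s1 r_base = L" "fst s1 r_K = K" using 5 r by simp_all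
  have p: "fst s1 r_ptr = k * K + Suc t" using 5 by simp
  have m: "mem_ok inp L A0 (mark K (Suc t) Z k F) A2 (snd s1)" using 5 by simp
  have pos: "(k * K + Suc t) mod K = Suc t" "(k * K + Suc t) div K = k" using r(6) by (simp_all del: add_Suc_right)
  have iff: "j mod K = Suc t \<and> j div K < Suc k \<longleftrightarrow> j = k * K + Suc t \<or> j mod K = Suc t \<and> j div K < k" for j
    using pos by (metis div_mult_mod_eq less_Suc_eq)
  have "(mark K (Suc t) Z k F)(k * K + Suc t := k + Z) = mark K (Suc t) Z (Suc k) F"
    unfolding fun_eq_iff mark_def iff using pos by (auto simp del: add_Suc_right)
  then have "mem_ok inp L A0 (mark K (Suc t) Z (Suc k) F) A2 ((snd s1)(addr L 3 (k * K + Suc t) := k + Z))"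
    using mem_ok_store(2)[OF m, of "k * K + Suc t" "k + Z"] by simp
  then show ?case using p by (simp add: r1 add.assoc[symmetric] del: add_Suc_right)
qed (use r in simp_all)

text \<open>A pairing uses at most \<open>n * n\<close> variables of weight less than
  \<open>R\<close>, so its doubled weight is at most \<open>nv * R\<close>, as \<open>nv\<close> is
  \<open>2 * n * n\<close>; with \<open>Wc\<close> one larger, no reduction takes place. The caps
  are doubled like the counts, and \<open>n * n + 1\<close> exceeds every number of edges.\<close>

locale algorithm = machine_input n f E kp cap lab wt Wc inp L
  for n f E kp cap lab wt Wc inp L +
  fixes R :: nat
  assumes cap_eq: "t < kp \<Longrightarrow> cap t = 2 * min (inp (4 + 2 * t)) (n * n + 1)"
    and Wc_eq: "Wc = nv * R + 1"
begin

definition pre :: "state \<Rightarrow> bool" where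
  "pre s \<longleftrightarrow> fst s r_base = L \<and> fst s r_n = n \<and> fst s r_kp = kp \<and> fst s r_mat = 3 + 2 * kp \<and>
     fst s r_n2 = n * n \<and> fst s r_deg = 3 + 2 * kp + n * n \<and> fst s r_nv = nv \<and> fst s r_range = R"

text \<open>\<open>Q * Suc kp\<close> is the size of the final transition table; the loops over
  classes, states or labels are no longer than that.\<close>

definition enough :: "nat \<Rightarrow> bool" where
  "enough X \<longleftrightarrow> Q * Suc kp \<le> X \<and> N2 \<le> X \<and> n \<le> X"

lemma Wc_Suc: "Suc (nv * R) = Wc"
  by (subst Wc_eq) simp

lemma Q_eq: "Q = Z * (nv * R) + Z"
proof -
  have "Wc * Z = Suc (nv * R) * Z" by (simp only: Wc_Suc)
  then show ?thesis unfolding Q_def by (simp add: mult.commute)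
qed

lemma Q_pos: "Q > 0"
  using Wc_pos Z_pos by (simp add: Q_def)

lemma Z_le_Q: "Z \<le> Q"
  using Wc_pos by (simp add: Q_def)

lemma Wc_le_Q: "Wc \<le> Q"
  using Z_pos by (simp add: Q_def)

lemma Q_le: "enough X \<Longrightarrow> Q \<le> X"
proof -
  have "Q * 1 \<le> Q * Suc kp" by (intro mult_le_mono2) simp
  then show "enough X \<Longrightarrow> Q \<le> X" by (simp add: enough_def)
qed

lemma kp_le: "enough X \<Longrightarrow> Suc kp \<le> X"
proof -
  have "1 * Suc kp \<le> Q * Suc kp" using Q_pos by (intro mult_le_mono1) simp
  then show "enough X \<Longrightarrow> Suc kp \<le> X" by (simp add: enough_def)
qed

lemma enough_big: "enough X \<Longrightarrow> big X"
  using Q_le kp_le Z_le_Q by (auto simp: big_def enough_def)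

lemma radix_block_le:
  assumes "enough X" "t \<le> kp"
  shows "radix cap t * Suc kp \<le> X"
proof -
  have "radix cap t \<le> Q" using radix_mono[OF assms(2), of cap] Z_le_Q by (simp add: Z_def)
  then have "radix cap t * Suc kp \<le> Q * Suc kp" by (rule mult_le_mono1)
  then show ?thesis using assms(1) by (simp add: enough_def)
qed

lemma wp_p_stage:
  assumes X: "enough X" and t: "t < kp" and P: "pre s" and K: "fst s r_K = Suc kp" and rt: "fst s r_t = t"
    and rZ: "fst s r_Z = radix cap t"
    and mem: "mem_ok inp L A0 F A2 (snd s)" and F: "next_ok cap (Suc kp) t F"
  shows "wp X p_stage (\<lambda>s'. fst s' r_Z = radix cap (Suc t) \<and>
     (\<exists>F'. mem_ok inp L A0 F' A2 (snd s') \<and> next_ok cap (Suc kp) (Suc t) F')) s"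
proof -
  let ?Z = "radix cap t" and ?B = "radix cap t * Suc kp"
  have Zpos: "?Z > 0" by simp
  have le: "?Z \<le> ?B" using mult_le_mono2[of 1 "Suc kp" ?Z] by simp
  have BX: "?B \<le> X" using radix_block_le[OF X, of t] t by simp
  have SX: "radix cap (Suc t) * Suc kp \<le> X" using radix_block_le[OF X, of "Suc t"] t by simp
  have bt: "?B + ?B * cap t = radix cap (Suc t) * Suc kp" by (simp add: radix_Suc algebra_simps)
  then have tX: "?B * cap t \<le> X" using SX by linarith
  have cX: "?Z * cap t \<le> X"
    using mult_le_mono1[OF le, of "cap t"] tX by (rule le_trans)
  have "4 + 2 * t < L" using t by (simp add: L_eq)
  then have rd: "snd s (4 + 2 * t) = inp (4 + 2 * t)" by (rule mem_ok_read(1)[OF mem])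
  have cap: "2 * (inp (4 + 2 * t) - (inp (4 + 2 * t) - (n * n + 1))) = cap t"
    unfolding cap_eq[OF t] by (simp add: min_def)
  have r: "fst s r_n2 = n * n" "fst s r_base = L" using P by (simp_all add: pre_def)
  let ?s1 = "upd r_cap (cap t) (upd r_cap (inp (4 + 2 * t)) s)"
  let ?s2 = "upd 1 (Suc kp) (upd r_blk (Suc kp * ?Z) ?s1)"
  let ?s3 = "upd 1 (Suc kp * ?Z) (upd r_tot (Suc kp * ?Z * cap t) ?s2)"
  have S: "wp X (PSeq p_spread (PSeq (PMul r_cz r_Z r_cap) (PSeq p_mark (PAsg r_Z (Plus (Reg r_Z) (Reg r_cz))))))
     (\<lambda>s'. fst s' r_Z = radix cap (Suc t) \<and>
     (\<exists>F'. mem_ok inp L A0 F' A2 (snd s') \<and> next_ok cap (Suc kp) (Suc t) F')) ?s3"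
  proof (rule wp_Seq[OF wp_p_spread[where tot = "?B * cap t" and B = ?B and Z = ?Z and L = L and inp = inp and F = F and ?A0.0 = A0 and ?A2.0 = A2]], goal_cases)
    case (8 s4)
    let ?G = "\<lambda>j. if j < ?B + ?B * cap t then spread ?B ?Z F j else F j"
    have r4: "fst s4 r_Z = ?Z" "fst s4 r_cap = cap t" "fst s4 r_t = t" "fst s4 r_K = Suc kp" "fst s4 r_base = L"
      using 8(2) rZ rt K r by simp_all
    show ?case
      unfolding wp.simps(5)
    proof (rule wp_PMul, goal_cases)
      case 7
      let ?s5 = "upd 1 (fst s4 r_Z) (upd r_cz (fst s4 r_Z * fst s4 r_cap) s4)"
      have "wp X p_mark (\<lambda>s'. mem_ok inp L A0 (mark (Suc kp) (Suc t) ?Z (?Z * cap t) ?G) A2 (snd s')) ?s5"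
        by (rule wp_p_mark[where L = L]) (use r4 t cX 8(1) in simp_all)
      then show ?case
      proof (rule wp_conseq, goal_cases)
        case (1 s6)
        have "next_ok cap (Suc kp) (Suc t) (mark (Suc kp) (Suc t) ?Z (?Z * cap t) ?G)"
        proof (rule next_ok_step[OF F])
          fix j assume "j < radix cap (Suc t) * Suc kp"
          then have "j < ?B + ?B * cap t" unfolding bt .
          then show "mark (Suc kp) (Suc t) ?Z (?Z * cap t) ?G j =
              mark (Suc kp) (Suc t) ?Z (cap t * ?Z) (spread ?B ?Z F) j"
            by (simp only: mark_def if_True mult.commute[of "cap t"])
        qed (use t in simp)
        moreover have "fst s6 r_Z + fst s6 r_cz = radix cap (Suc t)"
          using 1(2) r4 by (simp add: radix_Suc mult.commute)
        ultimately show ?case using 1(1) by auto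
      qed
    qed (use r4 BX le in simp_all)
  qed (use r rZ Zpos tX mem in \<open>simp_all add: mult.commute\<close>)
  have b: "aval (Mem (Plus (Const 4) (dbl (Reg r_t)))) s = inp (4 + 2 * t)" using rt rd by simp
  have a: "aval (dbl (Minus (Reg r_cap) (Minus (Reg r_cap) (Plus (Reg r_n2) (Const 1)))))
     (upd r_cap (inp (4 + 2 * t)) s) = cap t"
    using cap r by simp
  show ?thesis
    unfolding p_stage_def
    apply (subst wp.simps(5), subst wp.simps(2), subst wp.simps(5), subst wp.simps(2), subst wp.simps(5))
    apply (rule wp_PMul; (use K kp_le[OF X] in \<open>simp; fail\<close>)?)
    apply (subst wp.simps(5))
    apply (rule wp_PMul; (use K rZ BX in \<open>simp add: mult.commute; fail\<close>)?)
    apply (unfold a b)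
    using S by (simp add: K rZ del: wp.simps mult_Suc)
qed

lemma wp_p_sizes:
  assumes X: "enough X" and P: "pre s" and K: "fst s r_K = Suc kp"
    and r: "fst s r_Z = Z" "fst s r_NR = nv * R"
    and mem: "mem_ok inp L wt NX (\<lambda>_. 0) (snd s)"
  shows "wp X p_sizes (\<lambda>s'. env s' \<and> fst s' r_Wc = Wc \<and> holds inp L NX 0 (VV 0 0) (snd s')) s"
  unfolding p_sizes_def wp.simps(5)
proof (rule wp_PMul, goal_cases)
  case 7
  have "mem_ok inp L wt NX ((\<lambda>_. 0)(0 := 1)) ((snd s)(addr L 2 0 := 1))" by (rule mem_ok_store(3)[OF mem])
  then have "holds inp L NX 0 (VV 0 0) ((snd s)(addr L 2 0 := 1))"
    unfolding holds_def using tab_start by blast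
  then show ?case
    using P K r by (simp add: env_def size_regs_def pre_def Wc_Suc N2_def Q_eq[symmetric])
qed (use r le_trans[OF Z_le_Q Q_le[OF X]] in simp_all)

lemma wp_p_tables:
  assumes X: "enough X" and P: "pre s" and mem: "mem_ok inp L wt (\<lambda>_. 0) (\<lambda>_. 0) (snd s)"
  shows "wp X p_tables (\<lambda>s'. env s' \<and> fst s' r_Wc = Wc \<and> (\<exists>NX. table_ok NX \<and> holds inp L NX 0 (VV 0 0) (snd s'))) s"
proof -
  let ?s = "upd r_Z 1 (upd r_K (Suc kp) s)"
  have "wp X (PFor r_t r_kp p_stage) (\<lambda>s'. fst s' r_Z = Z \<and>
     (\<exists>F. mem_ok inp L wt F (\<lambda>_. 0) (snd s') \<and> next_ok cap (Suc kp) kp F)) ?s"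
  proof (rule wp_For[where N = kp and Inv = "\<lambda>t s'. fst s' r_Z = radix cap t \<and>
     (\<exists>F. mem_ok inp L wt F (\<lambda>_. 0) (snd s') \<and> next_ok cap (Suc kp) t F)"], goal_cases)
    case 4
    have "next_ok cap (Suc kp) 0 (\<lambda>_. 0)" by (simp add: next_ok_def)
    then show ?case using mem by auto
  next
    case (5 t s1)
    then obtain F where F: "mem_ok inp L wt F (\<lambda>_. 0) (snd s1)" "next_ok cap (Suc kp) t F" by blast
    have P1: "pre s1" "fst s1 r_K = Suc kp" using P 5(4) by (simp_all add: pre_def)
    have "wp X p_stage (\<lambda>s'. fst s' r_Z = radix cap (Suc t) \<and>
       (\<exists>F'. mem_ok inp L wt F' (\<lambda>_. 0) (snd s') \<and> next_ok cap (Suc kp) (Suc t) F')) s1"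
      using 5(2) by (intro wp_p_stage[OF X 5(1) P1 5(3) _ F]) simp
    then show ?case by (rule wp_conseq) simp
  next
    case (6 s1)
    then show ?case by (simp add: Z_def)
  qed (use P kp_le[OF X] in \<open>simp_all add: pre_def\<close>)
  then have "wp X (PSeq (PFor r_t r_kp p_stage) (PSeq (PMul r_NR r_nv r_range) (PSeq (PMul r_blk r_K r_Z)
     (PSeq (PMul r_tot r_blk r_NR) (PSeq p_spread p_sizes)))))
     (\<lambda>s'. env s' \<and> fst s' r_Wc = Wc \<and> (\<exists>NX. table_ok NX \<and> holds inp L NX 0 (VV 0 0) (snd s'))) ?s"
  proof (rule wp_Seq, goal_cases)
    case (1 s1)
    then obtain F where F: "mem_ok inp L wt F (\<lambda>_. 0) (snd s1)" "next_ok cap (Suc kp) kp F" and Z1: "fst s1 r_Z = Z"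
      by blast
    have P1: "pre s1" "fst s1 r_K = Suc kp" using P 1(2) by (simp_all add: pre_def)
    let ?B = "Z * Suc kp"
    have Bpos: "?B > 0" using Z_pos by simp
    have BX: "?B \<le> X" using radix_block_le[OF X, of kp] by (simp add: Z_def)
    have bt: "?B + ?B * (nv * R) = Q * Suc kp" by (simp add: Q_eq algebra_simps)
    then have tX: "?B * (nv * R) \<le> X" using X unfolding enough_def by linarith
    let ?s2 = "upd 1 (Suc kp * Z) (upd r_tot (Suc kp * Z * (nv * R)) (upd 1 (Suc kp) (upd r_blk (Suc kp * Z)
       (upd 1 nv (upd r_NR (nv * R) s1)))))"
    have S: "wp X (PSeq p_spread p_sizes)
       (\<lambda>s'. env s' \<and> fst s' r_Wc = Wc \<and> (\<exists>NX. table_ok NX \<and> holds inp L NX 0 (VV 0 0) (snd s'))) ?s2"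
    proof (rule wp_Seq[OF wp_p_spread[where tot = "?B * (nv * R)" and B = ?B and Z = Z and L = L and inp = inp and F = F
          and ?A0.0 = wt and ?A2.0 = "\<lambda>_. 0"]], goal_cases)
      case (8 s3)
      let ?G = "\<lambda>j. if j < ?B + ?B * (nv * R) then spread ?B Z F j else F j"
      have tab: "table_ok ?G"
      proof (rule table_ok_spread[OF F(2)])
        fix j assume "j < Q * Suc kp"
        then have "j < ?B + ?B * (nv * R)" unfolding bt .
        then show "?G j = spread ?B Z F j" by (simp only: if_True)
      qed
      have "wp X p_sizes (\<lambda>s'. env s' \<and> fst s' r_Wc = Wc \<and> holds inp L ?G 0 (VV 0 0) (snd s')) s3"
      proof (rule wp_p_sizes[OF X])
        show "pre s3" "fst s3 r_K = Suc kp" "fst s3 r_Z = Z" "fst s3 r_NR = nv * R"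
          using 8(2) P1 Z1 by (simp_all add: pre_def)
      qed (rule 8(1))
      then show ?case by (rule wp_conseq) (use tab in blast)
    qed (use P1 Z1 Bpos tX F(1) in \<open>simp_all add: pre_def mult.commute\<close>)
    have NX: "nv \<le> X" using X by (simp add: enough_def N2_def)
    show ?case
      apply (subst wp.simps(5))
      apply (rule wp_PMul; (use P1 NX in \<open>simp add: pre_def; fail\<close>)?)
      apply (subst wp.simps(5))
      apply (rule wp_PMul; (use P1 kp_le[OF X] in \<open>simp add: pre_def; fail\<close>)?)
      apply (subst wp.simps(5))
      apply (rule wp_PMul; (use P1 Z1 BX in \<open>simp add: pre_def mult.commute; fail\<close>)?)
      using S P1 Z1 by (simp add: pre_def del: wp.simps mult_Suc)
  qed
  then show ?thesis
    unfolding p_tables_def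
    apply (subst wp.simps(5), subst wp.simps(2), subst wp.simps(5), subst wp.simps(2))
    using P by (simp add: pre_def del: wp.simps)
qed

definition hits :: "nat \<Rightarrow> nat" where
  "hits q = card {p \<in> pairings. code (mset_set (used p) + mset_set (used p)) = q}"

lemma wp_p_final:
  assumes X: "enough X" and ev: "env s" and Wc: "fst s r_Wc = Wc" and mem: "holds inp L NX nv (VV nv 0) (snd s)"
  shows "wp X p_final (\<lambda>s'. fst s' 0 \<noteq> 0 \<longleftrightarrow> (\<exists>w<Wc. odd (hits (w * Z + (Z - 1))))) s"
proof -
  obtain A where A: "mem_ok inp L wt NX A (snd s)" "tab nv (VV nv 0) A" using mem by (auto simp: holds_def)
  have sz: "size_regs s" using ev by (simp add: env_def)
  have X': "N2 \<le> X" "Q \<le> X" "Z \<le> X" "Wc \<le> X" using X Q_le Z_le_Q Wc_le_Q by (auto simp: enough_def intro: le_trans)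
  show ?thesis
    unfolding p_final_def
  proof (rule wp_Seq[OF wp_p_node[OF sz X'(1,2)]], goal_cases)
    case (3 s1)
    have r1: "snd s1 = snd s" "fst s1 r_tgt = nd nv nv nv" "fst s1 r_Z = Z" "fst s1 r_Wc = Wc" "fst s1 r_base = L"
      using 3 ev Wc by (simp_all add: env_def)
    let ?s2 = "upd 0 0 (upd r_top (Z - 1) s1)"
    have "wp X (PFor r_w r_Wc (PSeq (PMul r_a r_Z r_w)
       (PSeq (PAsg r_val (Mem (cell 2 (Plus (Reg r_tgt) (Plus (Reg r_a) (Reg r_top))))))
         (PIf (Minus (Reg r_val) (dbl (Half (Reg r_val)))) (PAsg 0 (Const 1)) PNop))))
       (\<lambda>s'. fst s' 0 \<noteq> 0 \<longleftrightarrow> (\<exists>w<Wc. odd (hits (w * Z + (Z - 1))))) ?s2"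
    proof (rule wp_For[where N = Wc and Inv = "\<lambda>k s'. snd s' = snd s \<and>
         (fst s' 0 \<noteq> 0 \<longleftrightarrow> (\<exists>w<k. odd (hits (w * Z + (Z - 1)))))"], goal_cases)
      case (5 k s3)
      have r3: "fst s3 r_w = k" "fst s3 r_tgt = nd nv nv nv" "fst s3 r_Z = Z" "fst s3 r_base = L" "fst s3 r_top = Z - 1"
        using 5(3,4) r1 by simp_all
      let ?q = "k * Z + (Z - 1)"
      define val where "val = A (nd nv nv nv + ?q)"
      have qQ: "?q < Q" by (rule combine_lt) (use 5(1) Z_pos in simp_all)
      have rd: "snd s3 (addr L 2 (nd nv nv nv + ?q)) = val"
        unfolding val_def using mem_ok_read(4)[OF A(1)] 5(2) by simp
      have odd: "odd val \<longleftrightarrow> odd (hits ?q)" unfolding val_def hits_def by (rule tab_final[OF A(2) qQ])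
      have par: "val - 2 * (val div 2) \<noteq> 0 \<longleftrightarrow> odd val" by presburger
      have ex: "(\<exists>w<Suc k. odd (hits (w * Z + (Z - 1)))) \<longleftrightarrow> (\<exists>w<k. odd (hits (w * Z + (Z - 1)))) \<or> odd (hits ?q)"
        by (auto simp: less_Suc_eq)
      show ?case
        unfolding wp.simps(5)
      proof (rule wp_PMul, goal_cases)
        case 7
        have "fst s3 r_tgt + (fst s3 r_Z * fst s3 r_w + fst s3 r_top) = nd nv nv nv + ?q"
          by (simp add: r3 mult.commute)
        then show ?case using 5(2) odd par rd by (simp add: ex[unfolded One_nat_def] r3(4))
      qed (use r3 X' in simp_all)
    qed (use r1 X' in simp_all)
    then show ?case
      apply (subst wp.simps(5), subst wp.simps(2), subst wp.simps(5), subst wp.simps(2))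
      using r1 by (simp del: wp.simps)
  qed auto
qed

theorem wp_p_rest:
  assumes X: "enough X" and P: "pre s" and mem: "mem_ok inp L wt (\<lambda>_. 0) (\<lambda>_. 0) (snd s)"
  shows "wp X p_rest (\<lambda>s'. fst s' 0 \<noteq> 0 \<longleftrightarrow> (\<exists>w<Wc. odd (hits (w * Z + (Z - 1))))) s"
  unfolding p_rest_def
proof (rule wp_Seq[OF wp_p_tables[OF X P mem]], goal_cases)
  case (1 s1)
  then obtain NX where NX: "table_ok NX" "holds inp L NX 0 (VV 0 0) (snd s1)" and ev: "env s1" "fst s1 r_Wc = Wc" by blast
  show ?case
  proof (rule wp_Seq[OF wp_p_count[OF NX(1) ev(1) enough_big[OF X] NX(2)]], goal_cases)
    case (1 s2)
    show ?case
    proof (rule wp_p_final[OF X _ _ 1(1)])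
      show "env s2" by (rule env_frame[OF ev(1)]) (use 1(2) in auto)
      show "fst s2 r_Wc = Wc" using 1(2) ev(2) by simp
    qed
  qed
qed

end

section \<open>Isolation and random weights\<close>

context gadget begin

text \<open>\<open>e div n\<close> identifies the end of the gadget edge, and an end takes at most
  one slot.\<close>

lemma card_used_le:
  assumes "p \<in> pairings"
  shows "card (used p) \<le> n * n"
proof -
  have "inj_on (\<lambda>e. e div n) (used p)"
  proof (rule inj_onI)
    fix e e' assume e: "e \<in> used p" "e' \<in> used p" "e div n = e' div n"
    then obtain v u i v' u' i' where *: "e = var v u i" "e' = var v' u' i'" "v < n" "u < n" "i < n" "v' < n" "u' < n" "i' < n"
      "p (pv v u) = cv v i" "p (pv v' u') = cv v' i'" unfolding used_def by blast
    have "e div n = v * n + u" "e' div n = v' * n + u'" using * by (simp_all add: var_def)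
    then have "v = v' \<and> u = u'" using e(3) row_inj[OF *(4,7), of v v'] by simp
    moreover from this have "cv v i = cv v i'" using *(9,10) by simp
    then have "i = i'" using cv_inj[OF *(5,8), of v v] by simp
    ultimately show "e = e'" using * by simp
  qed
  moreover have "(\<lambda>e. e div n) ` used p \<subseteq> {..<n * n}"
    using used_subset[of p] by (auto intro!: less_mult_imp_div_less)
  ultimately have "card (used p) \<le> card {..<n * n}" by (intro card_inj_on_le) auto
  then show ?thesis by simp
qed

lemma card_all_edges: "card all_edges \<le> n * n" "finite all_edges"
proof -
  have sub: "all_edges \<subseteq> (\<lambda>(v, u). {v, u}) ` ({..<n} \<times> {..<n})" by (auto simp: all_edges_def)
  have "card all_edges \<le> card ((\<lambda>(v, u). {v, u}) ` ({..<n} \<times> {..<n}))" by (rule card_mono[OF _ sub]) simp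
  also have "\<dots> \<le> card ({..<n} \<times> {..<n})" by (rule card_image_le) simp
  finally show "card all_edges \<le> n * n" by simp
  show "finite all_edges" by (rule finite_subset[OF sub]) simp
qed

end

context algorithm begin

text \<open>Every edge of a pairing is visited from both ends, so counters and weights count everything twice.\<close>

definition full :: "(nat \<Rightarrow> nat) \<Rightarrow> bool" where
  "full p \<longleftrightarrow> (\<forall>t<kp. min (inp (4 + 2 * t)) (n * n + 1) \<le> card {e \<in> used p. lab e = Suc t})"

lemma code_used:
  assumes "w < Wc"
  shows "code (mset_set (used p) + mset_set (used p)) = w * Z + (Z - 1) \<longleftrightarrow>
    (2 * sum wt (used p)) mod Wc = w \<and> full p"
proof -
  let ?M = "mset_set (used p) + mset_set (used p)"
  have W: "weight ?M = 2 * sum wt (used p)" 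
    unfolding weight_def image_mset_union sum_mset.union sum_unfold_sum_mset[symmetric] by simp
  have C: "cnt ?M t = 2 * card {e \<in> used p. lab e = Suc t}" for t by (simp add: cnt_def finite_used)
  have "state_index cap kp (cnt ?M) = Z - 1 \<longleftrightarrow> (\<forall>t<kp. cap t \<le> cnt ?M t)"
    unfolding Z_def by (rule state_index_top)
  also have "\<dots> \<longleftrightarrow> full p" unfolding full_def C by (auto simp: cap_eq simp del: min_less_iff_conj)
  finally have S: "state_index cap kp (cnt ?M) = Z - 1 \<longleftrightarrow> full p" .
  have "state_index cap kp (cnt ?M) < Z" "Z - 1 < Z" using state_index_lt Z_pos by (simp_all add: Z_def)
  then show ?thesis unfolding code_def W by (simp only: mult_add_inj S)
qed

lemma hits_eq: "w < Wc \<Longrightarrow> hits (w * Z + (Z - 1)) = card {p \<in> pairings. (2 * sum wt (used p)) mod Wc = w \<and> full p}"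
  unfolding hits_def by (simp only: code_used)

text \<open>An odd number is not 0. As this holds for all weights, a wrong TRUE is impossible rather
  than merely unlikely.\<close>

lemma hits_sound:
  assumes "w < Wc" "odd (hits (w * Z + (Z - 1)))"
  shows "\<exists>p\<in>pairings. full p"
proof (rule ccontr)
  assume "\<not> (\<exists>p\<in>pairings. full p)"
  then have "{p \<in> pairings. (2 * sum wt (used p)) mod Wc = w \<and> full p} = {}" by blast
  with hits_eq[OF assms(1)] assms(2) show False by simp
qed

lemma hits_complete:
  assumes iso: "\<exists>!S. min_weight (used ` {p \<in> pairings. full p}) wt S" and R: "\<And>e. wt e < R"
  shows "\<exists>w<Wc. odd (hits (w * Z + (Z - 1)))"
proof -
  \<comment> \<open>No weight of a pairing wraps around modulo \<open>Wc\<close>, so equal weight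
    digits mean equal weights.\<close>
  have small: "2 * sum wt (used p) < Wc" if "p \<in> pairings" for p
  proof -
    have "sum wt (used p) \<le> (\<Sum>e\<in>used p. R)" using R by (intro sum_mono) (simp add: less_imp_le)
    also have "\<dots> = card (used p) * R" by simp
    also have "\<dots> \<le> n * n * R" using card_used_le[OF that] by (intro mult_le_mono1)
    finally have "2 * sum wt (used p) \<le> nv * R" by (simp add: nv_def algebra_simps)
    then show ?thesis using Wc_Suc by linarith
  qed
  obtain p where p: "p \<in> pairings" "full p" "min_weight (used ` {p \<in> pairings. full p}) wt (used p)"
    using iso unfolding min_weight_def by blast
  let ?w = "2 * sum wt (used p)"
  \<comment> \<open>A full pairing in the class of \<open>p\<close> has the weight of
    \<open>p\<close>, hence is minimal too, and by uniqueness uses the same variables.\<close>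
  have "{p' \<in> pairings. (2 * sum wt (used p')) mod Wc = ?w \<and> full p'} = {p}"
  proof (intro equalityI subsetI)
    fix p' assume "p' \<in> {p' \<in> pairings. (2 * sum wt (used p')) mod Wc = ?w \<and> full p'}"
    then have p': "p' \<in> pairings" "full p'" "(2 * sum wt (used p')) mod Wc = ?w" by simp_all
    then have "sum wt (used p') = sum wt (used p)" using small[OF p'(1)] by simp
    then have "min_weight (used ` {p \<in> pairings. full p}) wt (used p')"
      using p(3) p' unfolding min_weight_def by auto
    then have "used p' = used p" using iso p(3) by blast
    then show "p' \<in> {p}" using used_inj p(1) p'(1) by (auto dest: inj_onD)
  qed (use p small in simp)
  then have "hits (?w * Z + (Z - 1)) = 1" unfolding hits_eq[OF small[OF p(1)]] by simp
  then show ?thesis using small[OF p(1)] by (intro exI[of _ ?w]) simp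
qed

end

definition p_setup :: prog where
  "p_setup = PSeq (PAsg r_n (Mem (Const 0))) (PSeq (PAsg r_kp (Mem (Const 2)))
     (PSeq (PAsg r_mat (Plus (Const 3) (dbl (Reg r_kp)))) (PSeq (PMul r_n2 r_n r_n)
     (PSeq (PAsg r_deg (Plus (Reg r_mat) (Reg r_n2))) (PSeq (PAsg r_base (Plus (Reg r_deg) (Reg r_n)))
     (PSeq (PMul r_n3 r_n r_n2) (PSeq (PMul r_n4 r_n r_n3) (PSeq (PAsg r_nv (Plus (Reg r_n2) (Reg r_n2)))
     (PSeq (PAsg r_range (Const 1)) (PSeq (PAsg r_bits (Const 0))
     (PFor r_i r_n4 (PIf (Minus (Reg r_n4) (Reg r_range))
        (PSeq (PAsg r_range (dbl (Reg r_range))) (PAsg r_bits (Plus (Reg r_bits) (Const 1)))) PNop))))))))))))"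

lemma wf_p_setup [simp]: "wf_prog p_setup"
  by (simp add: p_setup_def)

lemma flip_free_p_setup [simp]: "flip_free p_setup"
  by (simp add: p_setup_def)

text \<open>The range is a power of two so that weights can be drawn bit by bit. It is doubled only
  while below \<open>n^4\<close>, hence the upper bound; the \<open>+ 1\<close> covers
  \<open>n = 0\<close>, where the range is 1.\<close>

definition setup_regs :: "nat \<Rightarrow> nat \<Rightarrow> state \<Rightarrow> bool" where
  "setup_regs n kp s \<longleftrightarrow> fst s r_n = n \<and> fst s r_kp = kp \<and> fst s r_mat = 3 + 2 * kp \<and> fst s r_n2 = n * n \<and>
     fst s r_deg = 3 + 2 * kp + n * n \<and> fst s r_base = 3 + 2 * kp + n * n + n \<and> fst s r_n3 = n * n * n \<and>
     fst s r_nv = n * n + n * n \<and> fst s r_range = 2 ^ fst s r_bits \<and> n * n * n * n \<le> fst s r_range \<and>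
     fst s r_range \<le> 2 * (n * n * n * n) + 1 \<and> fst s r_bits \<le> n * n * n * n"

lemma wp_p_setup:
  assumes m: "snd s 0 = n" "snd s 2 = kp" and X: "n \<le> X" "n * n * n * n \<le> X"
  shows "wp X p_setup (\<lambda>s'. snd s' = snd s \<and> setup_regs n kp s') s"
proof -
  let ?s = "upd r_bits 0 (upd r_range 1 (upd r_nv (n * n + n * n) (upd 1 n (upd r_n4 (n * (n * (n * n))) (upd 1 n
    (upd r_n3 (n * (n * n)) (upd r_base (3 + 2 * kp + n * n + n) (upd r_deg (3 + 2 * kp + n * n)
    (upd 1 n (upd r_n2 (n * n) (upd r_mat (3 + 2 * kp) (upd r_kp kp (upd r_n n s)))))))))))))"
  let ?N = "n * (n * (n * n))"
  have X': "?N \<le> X" using X(2) by (simp only: mult.assoc)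
  have S: "wp X (PFor r_i r_n4 (PIf (Minus (Reg r_n4) (Reg r_range))
        (PSeq (PAsg r_range (dbl (Reg r_range))) (PAsg r_bits (Plus (Reg r_bits) (Const 1)))) PNop))
      (\<lambda>s'. snd s' = snd s \<and> setup_regs n kp s') ?s"
  proof (rule wp_For[where N = ?N and Inv = "\<lambda>i s'. snd s' = snd s \<and> fst s' r_range = 2 ^ fst s' r_bits \<and>
      fst s' r_bits \<le> i \<and> fst s' r_range \<le> 2 * ?N + 1 \<and> (?N \<le> fst s' r_range \<or> fst s' r_bits = i)"], goal_cases)
    case (5 i s1)
    then have r4: "fst s1 r_n4 = ?N" by simp
    show ?case
    proof (cases "?N \<le> fst s1 r_range")
      case True
      then show ?thesis using 5(2) r4 by simp
    next
      case False
      then have "?N - fst s1 r_range \<noteq> 0" by simp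
      then show ?thesis using 5(2) r4 False by simp
    qed
  next
    case (6 s1)
    \<comment> \<open>If the range was doubled in all \<open>?N\<close> rounds, it is
      \<open>2 ^ ?N\<close>, which exceeds \<open>?N\<close>.\<close>
    have "?N \<le> fst s1 r_range"
    proof (cases "fst s1 r_bits = ?N")
      case True
      then have "fst s1 r_range = 2 ^ ?N" using 6(1) by simp
      then show ?thesis using less_exp[of ?N] by linarith
    qed (use 6(1) in auto)
    then show ?case using 6 unfolding setup_regs_def mult.assoc by simp
  qed (use X' in simp_all)
  show ?thesis
    unfolding p_setup_def
    apply (subst wp.simps(5), subst wp.simps(2), subst wp.simps(5), subst wp.simps(2), subst wp.simps(5), subst wp.simps(2))
    apply (subst wp.simps(5))
    apply (rule wp_PMul; (use m X(1) in \<open>simp; fail\<close>)?)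
    apply (subst wp.simps(5), subst wp.simps(2), subst wp.simps(5), subst wp.simps(2))
    apply (subst wp.simps(5))
    apply (rule wp_PMul; (use m X(1) in \<open>simp; fail\<close>)?)
    apply (subst wp.simps(5))
    apply (rule wp_PMul; (use m X(1) in \<open>simp; fail\<close>)?)
    apply (subst wp.simps(5), subst wp.simps(2), subst wp.simps(5), subst wp.simps(2), subst wp.simps(5), subst wp.simps(2))
    using S m by (simp del: wp.simps)
qed

definition p_weight :: prog where
  "p_weight = PSeq (PAsg r_w (Const 0)) (PSeq
     (PFor r_i r_bits (PSeq (PFlip r_flip) (PAsg r_w (Plus (dbl (Reg r_w)) (Reg r_flip)))))
     (PSto (cell 0 (Reg r_e)) (Reg r_w)))"

definition p_weights :: prog where
  "p_weights = PFor r_e r_n3 p_weight"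

lemma mods_p_weight [simp]: "mods p_weight = {r_w, r_i, r_flip}"
  by (auto simp: p_weight_def)

lemma mods_p_weights [simp]: "mods p_weights = {r_w, r_i, r_flip, r_e}"
  by (auto simp: p_weights_def)

lemma wf_p_weights [simp]: "wf_prog p_weight" "wf_prog p_weights"
  by (simp_all add: p_weights_def p_weight_def)

text \<open>The program logic yields only the range of the weight; its distribution is computed in
  \<open>p_weight_dist\<close>.\<close>

lemma wp_p_weight:
  assumes "fst s r_bits = b" "b \<le> X"
  shows "wp X p_weight (\<lambda>s'. \<exists>w<2 ^ b. snd s' = (snd s)(addr (fst s r_base) 0 (fst s r_e) := w)) s"
proof -
  let ?s = "upd r_w 0 s"
  have "wp X (PFor r_i r_bits (PSeq (PFlip r_flip) (PAsg r_w (Plus (dbl (Reg r_w)) (Reg r_flip)))))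
     (\<lambda>s'. snd s' = snd s \<and> fst s' r_w < 2 ^ b) ?s"
    by (rule wp_For[where N = b and Inv = "\<lambda>i s'. snd s' = snd s \<and> fst s' r_w < 2 ^ i"]) (use assms in auto)
  then show ?thesis
    unfolding p_weight_def wp.simps(2,5) aval.simps
    by (rule wp_conseq) auto
qed

lemma wp_p_weights:
  assumes r: "fst s r_n3 = k" "fst s r_bits = b" "fst s r_base = L" and X: "k \<le> X" "b \<le> X"
    and mem: "mem_ok inp L (\<lambda>_. 0) A1 A2 (snd s)"
  shows "wp X p_weights (\<lambda>s'. \<exists>w. (\<forall>e. w e < 2 ^ b) \<and> mem_ok inp L w A1 A2 (snd s')) s"
  unfolding p_weights_def
proof (rule wp_For[where N = k and Inv = "\<lambda>_ s'. \<exists>w. (\<forall>e. w e < 2 ^ b) \<and> mem_ok inp L w A1 A2 (snd s')"], goal_cases)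
  case 4
  then show ?case using mem by (intro exI[of _ "\<lambda>_. 0"]) simp
next
  case (5 i s1)
  then obtain w where w: "\<forall>e. w e < 2 ^ b" "mem_ok inp L w A1 A2 (snd s1)" by blast
  have r1: "fst s1 r_bits = b" "fst s1 r_base = L" using 5(4) r by simp_all
  show ?case
  proof (rule wp_conseq[OF wp_p_weight[OF r1(1) X(2)]], goal_cases)
    case (1 s2)
    then obtain v where v: "v < 2 ^ b" "snd s2 = (snd s1)(addr L 0 i := v)" using r1 5(3) by auto
    have "\<forall>e. (w(i := v)) e < 2 ^ b" using w v by simp
    moreover have "mem_ok inp L (w(i := v)) A1 A2 (snd s2)" unfolding v(2) by (rule mem_ok_store(1)[OF w(2)])
    ultimately show ?case unfolding upd_simps by blast
  qed
qed (use r X in simp_all)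

abbreviation uniform :: "nat \<Rightarrow> nat pmf" where
  "uniform b \<equiv> pmf_of_set {..<2 ^ b}"

text \<open>The fresh bit is the leading one, as in \<open>p_weight\<close>, where the first flip is
  shifted by all later ones.\<close>

lemma uniform_Suc:
  "uniform (Suc b) = bind_pmf (bernoulli_pmf (1 / 2)) (\<lambda>c. map_pmf (\<lambda>x. of_bool c * 2 ^ b + x) (uniform b))"
proof -
  let ?g = "\<lambda>(c, x). of_bool c * 2 ^ b + x :: nat"
  let ?D = "(UNIV :: bool set) \<times> {..<2 ^ b :: nat}"
  have inj: "inj_on ?g ?D" by (auto simp: inj_on_def of_bool_def split: if_splits)
  have "?g ` ?D \<subseteq> {..<2 ^ Suc b}" by (auto simp: of_bool_def)
  moreover have "card (?g ` ?D) = card {..<2 ^ Suc b :: nat}" by (simp add: card_image[OF inj] card_cartesian_product)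
  ultimately have img: "?g ` ?D = {..<2 ^ Suc b}" by (intro card_subset_eq) auto
  have ne: "{..<2 ^ b :: nat} \<noteq> {}" by (auto simp: lessThan_empty_iff)
  have "uniform (Suc b) = map_pmf ?g (pmf_of_set ?D)"
    using inj ne by (subst map_pmf_of_set_inj) (simp_all add: img)
  also have "pmf_of_set ?D = pair_pmf (bernoulli_pmf (1 / 2)) (uniform b)"
  proof -
    have u: "pmf (uniform b) x = indicator {..<2 ^ b} x / 2 ^ b" for x
      using ne by (subst pmf_of_set) simp_all
    have "pmf (pmf_of_set ?D) y = indicator ?D y / (2 * 2 ^ b)" for y
      using ne by (subst pmf_of_set) (simp_all add: card_cartesian_product)
    then show ?thesis
      unfolding bernoulli_pmf_half_conv_pmf_of_set
      by (intro pmf_eqI) (auto simp: pmf_pair u indicator_def)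
  qed
  finally show ?thesis
    unfolding pair_pmf_def map_bind_pmf map_return_pmf prod.case by (simp only: map_pmf_def)
qed

text \<open>The projection keeps what the following store reads, together with the memory. The
  registers of the last flip and of the loop counter are left out, as they are of no interest to the
  distribution of the weight.\<close>

lemma weight_loop_dist:
  "map_pmf (\<lambda>s'. (fst s' r_w, fst s' r_base, fst s' r_e, snd s'))
     (loop (psem (PSeq (PFlip r_flip) (PAsg r_w (Plus (dbl (Reg r_w)) (Reg r_flip))))) r_i k s) =
   map_pmf (\<lambda>x. (fst s r_w * 2 ^ k + x, fst s r_base, fst s r_e, snd s)) (uniform k)"
proof (induction k arbitrary: s)
  case 0
  have "{..<1 :: nat} = {0}" by auto
  then show ?case by (simp add: pmf_of_set_singleton)
next
  case (Suc k)
  let ?P = "psem (PSeq (PFlip r_flip) (PAsg r_w (Plus (dbl (Reg r_w)) (Reg r_flip))))"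
  let ?g = "\<lambda>s'. (fst s' r_w, fst s' r_base, fst s' r_e, snd s') :: nat \<times> nat \<times> nat \<times> (nat \<Rightarrow> nat)"
  have "map_pmf ?g (loop ?P r_i (Suc k) s) =
     bind_pmf (?P s) (\<lambda>s'. map_pmf ?g (loop ?P r_i k (upd r_i (Suc (fst s' r_i)) s')))"
    by (simp only: loop.simps map_bind_pmf)
  also have "\<dots> = bind_pmf (?P s) (\<lambda>s'. map_pmf (\<lambda>x. (fst s' r_w * 2 ^ k + x, fst s' r_base, fst s' r_e, snd s')) (uniform k))"
    unfolding Suc.IH by simp
  also have "\<dots> = bind_pmf (bernoulli_pmf (1 / 2)) (\<lambda>c.
      map_pmf (\<lambda>x. ((2 * fst s r_w + of_bool c) * 2 ^ k + x, fst s r_base, fst s r_e, snd s)) (uniform k))"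
    by (simp add: bind_map_pmf bind_assoc_pmf bind_return_pmf)
  also have "\<dots> = map_pmf (\<lambda>x. (fst s r_w * 2 ^ Suc k + x, fst s r_base, fst s r_e, snd s)) (uniform (Suc k))"
    unfolding uniform_Suc map_bind_pmf pmf.map_comp o_def by (simp add: algebra_simps)
  finally show ?case .
qed

lemma p_weight_dist:
  assumes "fst s r_bits = b"
  shows "map_pmf snd (psem p_weight s) =
    map_pmf (\<lambda>x. (snd s)(addr (fst s r_base) 0 (fst s r_e) := x)) (uniform b)"
proof -
  let ?L = "loop (psem (PSeq (PFlip r_flip) (PAsg r_w (Plus (dbl (Reg r_w)) (Reg r_flip))))) r_i b (upd r_i 0 (upd r_w 0 s))"
  have "psem p_weight s = bind_pmf ?L (psem (PSto (cell 0 (Reg r_e)) (Reg r_w)))"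
    unfolding p_weight_def
    by (subst psem.simps(5), subst psem.simps(2), subst bind_return_pmf, subst psem.simps(5), subst psem.simps(7))
       (simp add: assms del: psem.simps)
  then have "map_pmf snd (psem p_weight s) =
     bind_pmf ?L (\<lambda>s'. return_pmf ((snd s')(addr (fst s' r_base) 0 (fst s' r_e) := fst s' r_w)))"
    by (simp add: map_bind_pmf del: psem.simps(5))
  also have "\<dots> =
    map_pmf (\<lambda>(w, L, e, m). m(addr L 0 e := w)) (map_pmf (\<lambda>s'. (fst s' r_w, fst s' r_base, fst s' r_e, snd s')) ?L)"
    unfolding pmf.map_comp o_def prod.case by (simp only: map_pmf_def)
  also have "\<dots> = map_pmf (\<lambda>x. (snd s)(addr (fst s r_base) 0 (fst s r_e) := x)) (uniform b)"
    unfolding weight_loop_dist by (simp add: pmf.map_comp o_def)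
  finally show ?thesis .
qed

text \<open>Each round writes one fresh weight independent of the earlier ones, so the written
  interval carries a product distribution.\<close>

lemma p_weights_loop_dist:
  assumes "fst s r_bits = b" "fst s r_base = L" "fst s r_e = e"
  shows "map_pmf (\<lambda>s'. arr L 0 (snd s')) (loop (psem p_weight) r_e k s) =
    map_pmf (\<lambda>w i. if e \<le> i \<and> i < e + k then w i else arr L 0 (snd s) i) (Pi_pmf {e..<e + k} 0 (\<lambda>_. uniform b))"
  using assms
proof (induction k arbitrary: s e)
  case 0
  have "(\<lambda>i. if e \<le> i \<and> i < e + 0 then w i else arr L 0 (snd s) i) = arr L 0 (snd s)" for w :: "nat \<Rightarrow> nat" by auto
  then show ?case by (simp add: map_pmf_const)
next
  case (Suc k)
  let ?Pi = "Pi_pmf {Suc e..<Suc e + k} 0 (\<lambda>_. uniform b)"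
  define H where "H m = map_pmf (\<lambda>w i. if Suc e \<le> i \<and> i < Suc e + k then w i else arr L 0 m i) ?Pi" for m
  have fr: "fst s' r_bits = b" "fst s' r_base = L" "fst s' r_e = e" if "s' \<in> set_pmf (psem p_weight s)" for s'
  proof -
    \<comment> \<open>The frame property holds on the support of \<open>psem\<close> by way of
      \<open>wp\<close>, here with the iteration bound \<open>b\<close>.\<close>
    have "wp b p_weight (\<lambda>s'. \<forall>x. x \<notin> mods p_weight \<longrightarrow> fst s' x = fst s x) s"
      by (rule wp_conseq[OF wp_p_weight[OF Suc.prems(1) le_refl]])
    from compile_correct[OF wf_p_weights(1) this] that
    have "\<forall>x. x \<notin> mods p_weight \<longrightarrow> fst s' x = fst s x" by blast
    then show "fst s' r_bits = b" "fst s' r_base = L" "fst s' r_e = e" using Suc.prems by simp_all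
  qed
  have "map_pmf (\<lambda>s'. arr L 0 (snd s')) (loop (psem p_weight) r_e (Suc k) s) =
     bind_pmf (psem p_weight s) (\<lambda>s'. map_pmf (\<lambda>s'. arr L 0 (snd s')) (loop (psem p_weight) r_e k (upd r_e (Suc (fst s' r_e)) s')))"
    by (simp only: loop.simps map_bind_pmf)
  also have "\<dots> = bind_pmf (psem p_weight s) (\<lambda>s'. H (snd s'))"
  proof (intro bind_pmf_cong refl)
    fix s' assume "s' \<in> set_pmf (psem p_weight s)"
    note f = fr[OF this]
    show "map_pmf (\<lambda>s'. arr L 0 (snd s')) (loop (psem p_weight) r_e k (upd r_e (Suc (fst s' r_e)) s')) = H (snd s')"
      unfolding H_def f by (subst Suc.IH[where e = "Suc e"]) (use f in \<open>simp_all only: upd_simps\<close>, simp_all)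
  qed
  also have "\<dots> = bind_pmf (map_pmf snd (psem p_weight s)) H" by (simp add: bind_map_pmf)
  also have "\<dots> = bind_pmf (uniform b) (\<lambda>x. H ((snd s)(addr L 0 e := x)))"
    unfolding p_weight_dist[OF Suc.prems(1)] Suc.prems(2,3) by (simp add: bind_map_pmf)
  also have "\<dots> = map_pmf (\<lambda>w i. if e \<le> i \<and> i < e + Suc k then w i else arr L 0 (snd s) i)
      (Pi_pmf {e..<e + Suc k} 0 (\<lambda>_. uniform b))"
  proof -
    have eq: "(\<lambda>i. if e \<le> i \<and> i < e + Suc k then (w(e := x)) i else arr L 0 (snd s) i) =
       (\<lambda>i. if Suc e \<le> i \<and> i < Suc e + k then w i else arr L 0 ((snd s)(addr L 0 e := x)) i)" for w :: "nat \<Rightarrow> nat" and x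
      by (auto simp: arr_upd fun_eq_iff)
    have "{e..<e + Suc k} = insert e {Suc e..<Suc e + k}" by auto
    then have "Pi_pmf {e..<e + Suc k} 0 (\<lambda>_. uniform b) =
       bind_pmf (uniform b) (\<lambda>y. bind_pmf ?Pi (\<lambda>w. return_pmf (w(e := y))))"
      by (simp add: Pi_pmf_insert')
    then show ?thesis unfolding H_def by (simp only: map_bind_pmf map_return_pmf eq) (simp only: map_pmf_def)
  qed
  finally show ?case .
qed

text \<open>The array is 0 beyond the \<open>k\<close> weights, in agreement with the default value
  of \<open>Pi_pmf\<close>.\<close>

lemma p_weights_dist:
  assumes "fst s r_bits = b" "fst s r_base = L" "fst s r_n3 = k" "arr L 0 (snd s) = (\<lambda>_. 0)"
  shows "map_pmf (\<lambda>s'. arr L 0 (snd s')) (psem p_weights s) = Pi_pmf {..<k} 0 (\<lambda>_. uniform b)"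
proof -
  have "map_pmf (\<lambda>s'. arr L 0 (snd s')) (psem p_weights s) =
     map_pmf (\<lambda>w i. if 0 \<le> i \<and> i < 0 + k then w i else 0) (Pi_pmf {0..<0 + k} 0 (\<lambda>_. uniform b))"
    unfolding p_weights_def psem.simps assms(3)
    by (subst p_weights_loop_dist[where e = 0 and b = b]) (use assms in \<open>simp_all only: upd_simps\<close>, simp_all)
  also have "\<dots> = map_pmf (\<lambda>w. w) (Pi_pmf {..<k} 0 (\<lambda>_. uniform b))"
  proof (rule map_pmf_cong)
    fix w assume "w \<in> set_pmf (Pi_pmf {..<k} 0 (\<lambda>_. uniform b))"
    then have "w i = 0" if "\<not> i < k" for i using that by (auto simp: set_Pi_pmf PiE_dflt_def)
    then show "(\<lambda>i. if 0 \<le> i \<and> i < 0 + k then w i else 0) = w" by auto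
  qed (simp add: atLeast0LessThan)
  finally show ?thesis by simp
qed

section \<open>Instances\<close>

definition mem_of :: "nat list \<Rightarrow> nat \<Rightarrow> nat" where
  "mem_of w i = (if i < length w then w ! i else 0)"

lemma nth_concat_pairs:
  assumes "t < length xs"
  shows "concat (map (\<lambda>j. [a j, b j]) xs) ! (2 * t) = a (xs ! t)"
    "concat (map (\<lambda>j. [a j, b j]) xs) ! Suc (2 * t) = b (xs ! t)"
  using assms
proof (induction xs arbitrary: t)
  case (Cons x xs)
  { case 1 then show ?case using Cons.IH(1)[of "t - 1"] by (cases t) auto }
  { case 2 then show ?case using Cons.IH(2)[of "t - 1"] by (cases t) auto }
qed simp_all

lemma length_concat_pairs: "length (concat (map (\<lambda>j. [a j, b j]) xs)) = 2 * length xs"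
  by (induction xs) auto

lemma length_concat_rows: "(\<And>v. length (g v) = n) \<Longrightarrow> length (concat (map g [0..<k])) = k * n"
  by (induction k) (auto simp: algebra_simps)

lemma nth_concat_rows:
  assumes "\<And>v. length (g v) = n" "v < k" "u < n"
  shows "concat (map g [0..<k]) ! (v * n + u) = g v ! u"
  using assms(2)
proof (induction k)
  case (Suc k)
  have len: "length (concat (map g [0..<k])) = k * n" by (rule length_concat_rows) (rule assms(1))
  show ?case
  proof (cases "v < k")
    case True
    then have "Suc v * n \<le> k * n" by (intro mult_le_mono1) simp
    then have "v * n + u < k * n" using assms(3) by simp
    then show ?thesis using Suc.IH[OF True] len by (simp add: nth_append)
  next
    case False
    then have "v = k" using Suc.prems by simp
    then show ?thesis using len by (simp add: nth_append)
  qed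
qed simp

lemma dm_encode_len:
  "length (dm_encode I) = 3 + 2 * length (positive_bounds I) + nverts I * nverts I"
  unfolding dm_encode_def by (simp add: length_concat_pairs length_concat_rows)

lemma df_encode_len:
  "length (degs I) = nverts I \<Longrightarrow>
   length (df_encode I) = 3 + 2 * length (positive_bounds I) + nverts I * nverts I + nverts I"
  by (simp add: df_encode_def dm_encode_len)

lemma dm_encode_nth:
  shows "dm_encode I ! 0 = nverts I" "dm_encode I ! 2 = length (positive_bounds I)"
    and "t < length (positive_bounds I) \<Longrightarrow> dm_encode I ! (3 + 2 * t) = positive_bounds I ! t"
    and "t < length (positive_bounds I) \<Longrightarrow> dm_encode I ! (4 + 2 * t) = bounds I ! (positive_bounds I ! t)"
    and "v < nverts I \<Longrightarrow> u < nverts I \<Longrightarrow>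
      dm_encode I ! (3 + 2 * length (positive_bounds I) + (v * nverts I + u)) = edge_entry I v u"
proof -
  let ?A = "[nverts I, length (bounds I), length (positive_bounds I)]"
  let ?B = "concat (map (\<lambda>j. [j, bounds I ! j]) (positive_bounds I))"
  let ?C = "concat (map (\<lambda>u. map (\<lambda>v. edge_entry I u v) [0..<nverts I]) [0..<nverts I])"
  have enc: "dm_encode I = ?A @ (?B @ ?C)" by (simp add: dm_encode_def)
  have lenB: "length ?B = 2 * length (positive_bounds I)" by (rule length_concat_pairs)
  have shift: "dm_encode I ! (3 + k) = (?B @ ?C) ! k" for k
    unfolding enc by (subst nth_append_right) simp_all
  show "dm_encode I ! 0 = nverts I" "dm_encode I ! 2 = length (positive_bounds I)"
    unfolding enc by (simp_all add: numeral_2_eq_2)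
  show "dm_encode I ! (3 + 2 * t) = positive_bounds I ! t" if "t < length (positive_bounds I)"
    unfolding shift using that lenB nth_concat_pairs(1)[OF that, of "\<lambda>j. j"] by (simp add: nth_append)
  show "dm_encode I ! (4 + 2 * t) = bounds I ! (positive_bounds I ! t)" if "t < length (positive_bounds I)"
  proof -
    have "dm_encode I ! (4 + 2 * t) = dm_encode I ! (3 + Suc (2 * t))" by simp
    also have "\<dots> = (?B @ ?C) ! Suc (2 * t)" by (rule shift)
    also have "\<dots> = ?B ! Suc (2 * t)" using that lenB by (simp add: nth_append)
    also have "\<dots> = bounds I ! (positive_bounds I ! t)" by (rule nth_concat_pairs(2)[OF that])
    finally show ?thesis .
  qed
  show "dm_encode I ! (3 + 2 * length (positive_bounds I) + (v * nverts I + u)) = edge_entry I v u"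
    if "v < nverts I" "u < nverts I"
  proof -
    have "dm_encode I ! (3 + 2 * length (positive_bounds I) + (v * nverts I + u)) = ?C ! (v * nverts I + u)"
      using shift[of "2 * length (positive_bounds I) + (v * nverts I + u)"] lenB
      by (simp only: add.assoc nth_append_length_plus) (simp add: nth_append)
    also have "\<dots> = map (\<lambda>v'. edge_entry I v v') [0..<nverts I] ! u"
      by (rule nth_concat_rows) (use that in simp_all)
    finally show ?thesis using that by simp
  qed
qed

lemma df_encode_nth:
  assumes "length (degs I) = nverts I"
  defines "inp \<equiv> mem_of (df_encode I)"
  shows "inp 0 = nverts I" "inp 2 = length (positive_bounds I)"
    and "t < length (positive_bounds I) \<Longrightarrow> inp (3 + 2 * t) = positive_bounds I ! t"
    and "t < length (positive_bounds I) \<Longrightarrow> inp (4 + 2 * t) = bounds I ! (positive_bounds I ! t)"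
    and "v < nverts I \<Longrightarrow> u < nverts I \<Longrightarrow>
      inp (3 + 2 * length (positive_bounds I) + (v * nverts I + u)) = edge_entry I v u"
    and "v < nverts I \<Longrightarrow> inp (3 + 2 * length (positive_bounds I) + nverts I * nverts I + v) = degs I ! v"
    and "3 + 2 * length (positive_bounds I) + nverts I * nverts I + nverts I \<le> i \<Longrightarrow> inp i = 0"
proof -
  have low: "inp i = dm_encode I ! i" if "i < length (dm_encode I)" for i
    using that by (simp add: inp_def mem_of_def df_encode_def nth_append)
  show "inp 0 = nverts I" "inp 2 = length (positive_bounds I)"
    by (simp_all add: low dm_encode_len dm_encode_nth del: One_nat_def)
  show "inp (3 + 2 * t) = positive_bounds I ! t" if t: "t < length (positive_bounds I)"
  proof -
    have "3 + 2 * t < length (dm_encode I)" unfolding dm_encode_len using t by linarith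
    from low[OF this] dm_encode_nth(3)[OF t] show ?thesis by (rule trans)
  qed
  show "inp (4 + 2 * t) = bounds I ! (positive_bounds I ! t)" if t: "t < length (positive_bounds I)"
  proof -
    have "4 + 2 * t < length (dm_encode I)" unfolding dm_encode_len using t by linarith
    from low[OF this] dm_encode_nth(4)[OF t] show ?thesis by (rule trans)
  qed
  show "inp (3 + 2 * length (positive_bounds I) + (v * nverts I + u)) = edge_entry I v u"
    if "v < nverts I" "u < nverts I"
  proof -
    have "Suc v * nverts I \<le> nverts I * nverts I" using that by (intro mult_le_mono1) simp
    then have "v * nverts I + u < nverts I * nverts I" using that by simp
    then have "3 + 2 * length (positive_bounds I) + (v * nverts I + u) < length (dm_encode I)"
      unfolding dm_encode_len by linarith
    from low[OF this] dm_encode_nth(5)[OF that] show ?thesis by (rule trans)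
  qed
  show "inp (3 + 2 * length (positive_bounds I) + nverts I * nverts I + v) = degs I ! v" if "v < nverts I"
    unfolding dm_encode_len[symmetric] using that assms(1)
    by (simp add: inp_def mem_of_def df_encode_def nth_append)
  show "inp i = 0" if "3 + 2 * length (positive_bounds I) + nverts I * nverts I + nverts I \<le> i"
    using that by (simp add: inp_def mem_of_def df_encode_len[OF assms(1)])
qed

lemma lookup_label_le: "lookup_label inp k e \<le> k"
  by (induction k) auto

text \<open>The last match wins in \<open>lookup_label\<close>; injectivity makes it the only
  one.\<close>

lemma lookup_label_iff:
  assumes "inj_on (\<lambda>t. inp (3 + 2 * t)) {..<k}" "t < k"
  shows "lookup_label inp k e = Suc t \<longleftrightarrow> inp (3 + 2 * t) + 2 = e"
  using assms
proof (induction k)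
  case (Suc k)
  show ?case
  proof (cases "t = k")
    case True
    then show ?thesis using lookup_label_le[of inp k e] by auto
  next
    case False
    then have t: "t < k" using Suc.prems by simp
    have "inp (3 + 2 * k) \<noteq> inp (3 + 2 * t)"
      using inj_onD[OF Suc.prems(1), of k t] t False by auto
    moreover have "inj_on (\<lambda>t. inp (3 + 2 * t)) {..<k}" using Suc.prems(1) by (auto simp: inj_on_def)
    ultimately show ?thesis using Suc.IH[OF _ t] False by auto
  qed
qed simp

lemma edge_entry_iff:
  assumes "dm_wf I" "j < length (esets I)"
  shows "edge_entry I u v = j + 2 \<longleftrightarrow> {u, v} \<in> esets I ! j"
proof
  have uniq: "j' = j''" if "j' < length (esets I)" "{u, v} \<in> esets I ! j'" "j'' < length (esets I)" "{u, v} \<in> esets I ! j''" for j' j''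
    using assms(1) that unfolding dm_wf_def disjoint_family_on_def by blast
  show "{u, v} \<in> esets I ! j" if "edge_entry I u v = j + 2"
  proof -
    have ex: "\<exists>j<length (esets I). {u, v} \<in> esets I ! j"
      and the: "(THE j. j < length (esets I) \<and> {u, v} \<in> esets I ! j) = j"
      using that by (auto simp: edge_entry_def split: if_splits)
    from ex obtain j' where j': "j' < length (esets I)" "{u, v} \<in> esets I ! j'" by blast
    have "(THE j. j < length (esets I) \<and> {u, v} \<in> esets I ! j) = j'"
      by (rule the_equality) (use j' uniq in blast)+
    then show ?thesis using the j' by simp
  qed
  show "edge_entry I u v = j + 2" if "{u, v} \<in> esets I ! j"
  proof -
    have "(THE j. j < length (esets I) \<and> {u, v} \<in> esets I ! j) = j"
      by (rule the_equality) (use that assms(2) uniq in blast)+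
    moreover have "{u, v} \<in> edges I" using assms that unfolding dm_wf_def by blast
    ultimately show ?thesis using that assms(2) unfolding edge_entry_def by auto
  qed
qed

lemma edge_entry_nonzero: "edge_entry I u v \<noteq> 0 \<longleftrightarrow> {u, v} \<in> edges I"
  by (auto simp: edge_entry_def)

definition caps :: "'a dm_instance_scheme \<Rightarrow> nat \<Rightarrow> nat" where
  "caps I t = 2 * min (bounds I ! (positive_bounds I ! t)) (nverts I * nverts I + 1)"

text \<open>One summand per size of loop: \<open>n\<close>, the \<open>n^3\<close> weights, the
  \<open>n^4\<close> rounds of doubling, \<open>nv + 2\<close>, and the transition table of size
  \<open>Q * Suc k\<close>, in which \<open>2 * n^4 + 1\<close> bounds the range of the
  weights.\<close>

definition loop_bound :: "'a dm_instance_scheme \<Rightarrow> nat" where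
  "loop_bound I = (let n = nverts I; k = length (positive_bounds I) in
     n + n * n * n + n * n * n * n + (n * n + n * n + 2) +
     ((n * n + n * n) * (2 * (n * n * n * n) + 1) + 1) * radix (caps I) k * Suc k)"

lemma meets_bounds_iff:
  "meets_bounds I F \<longleftrightarrow> (\<forall>t < length (positive_bounds I).
     bounds I ! (positive_bounds I ! t) \<le> card (F \<inter> esets I ! (positive_bounds I ! t)))"
proof -
  have "set (positive_bounds I) = {j. j < length (bounds I) \<and> 0 < bounds I ! j}"
    by (auto simp: positive_bounds_def)
  then have "meets_bounds I F \<longleftrightarrow> (\<forall>j \<in> set (positive_bounds I). bounds I ! j \<le> card (F \<inter> esets I ! j))"
    unfolding meets_bounds_def by (auto simp: not_less)
  then show ?thesis by (simp only: all_set_conv_all_nth)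
qed

lemma positive_bounds_nth:
  assumes "t < length (positive_bounds I)"
  shows "positive_bounds I ! t < length (bounds I)"
  using nth_mem[OF assms] by (auto simp: positive_bounds_def)

lemma distinct_positive_bounds: "distinct (positive_bounds I)"
  by (simp add: positive_bounds_def)

text \<open>The family \<open>\<F>\<close> depends on the instance alone and is fixed before the
  weights: this order of quantifiers is what the isolation lemma needs.\<close>

theorem rest_correct:
  fixes I :: df_instance
  assumes wf: "df_wf I"
  defines "n \<equiv> nverts I" and "k \<equiv> length (positive_bounds I)" and "inp \<equiv> mem_of (df_encode I)"
  shows "\<exists>\<F>. \<F> \<subseteq> Pow {..<n * n * n} \<and> (df_solvable I \<longrightarrow> \<F> \<noteq> {}) \<and>
    (\<forall>w s X. setup_regs n k s \<longrightarrow> mem_ok inp (3 + 2 * k + n * n + n) w (\<lambda>_. 0) (\<lambda>_. 0) (snd s) \<longrightarrow>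
       (\<forall>e. w e < fst s r_range) \<longrightarrow> loop_bound I \<le> X \<longrightarrow>
       wp X p_rest (\<lambda>s'. (fst s' 0 \<noteq> 0 \<longrightarrow> df_solvable I) \<and> ((\<exists>!S. min_weight \<F> w S) \<longrightarrow> fst s' 0 \<noteq> 0)) s)"
proof -
  define f where "f v = degs I ! v" for v
  define E where "E v u \<longleftrightarrow> {v, u} \<in> edges I" for v u
  \<comment> \<open>Decodes \<open>e = (v * n + u) * n + i\<close>. The definition is total because
    the counters assign a label to every number \<open>e\<close>.\<close>
  define lab where "lab e = (if e div n div n < e div n mod n
     then lookup_label inp k (inp (3 + 2 * k + e div n)) else 0)" for e
  have dwf: "dm_wf I" and len: "length (degs I) = nverts I" using wf by (simp_all add: df_wf_def)
  have edges: "\<And>e. e \<in> edges I \<Longrightarrow> e \<subseteq> {..<n} \<and> card e = 2" using dwf unfolding dm_wf_def n_def by blast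
  note enc = df_encode_nth[OF len, folded inp_def k_def n_def]
  interpret gadget n f E
  proof
    show "E u v \<Longrightarrow> E v u" for u v by (simp add: E_def insert_commute)
    show "\<not> E v v" for v using edges[of "{v}"] by (auto simp: E_def)
  qed
  have all: "all_edges = edges I"
  proof
    show "all_edges \<subseteq> edges I" by (auto simp: all_edges_def E_def)
    show "edges I \<subseteq> all_edges"
    proof
      fix e assume e: "e \<in> edges I"
      then obtain a b where "e = {a, b}" using edges by (metis card_2_iff)
      then show "e \<in> all_edges" using e edges[OF e] unfolding all_edges_def E_def by blast
    qed
  qed
  have labvar: "lab (var v u i) = (if v < u then lookup_label inp k (inp (3 + 2 * k + pv v u)) else 0)"
    if "v < n" "u < n" "i < n" for v u i
  proof -
    have "var v u i div n = v * n + u" using that by (simp add: var_def)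
    moreover have "(v * n + u) div n = v" "(v * n + u) mod n = u" using that by simp_all
    ultimately show ?thesis by (simp only: lab_def pv_def)
  qed
  have inj: "inj_on (\<lambda>t. inp (3 + 2 * t)) {..<k}"
  proof (rule inj_onI)
    fix s t assume "s \<in> {..<k}" "t \<in> {..<k}" "inp (3 + 2 * s) = inp (3 + 2 * t)"
    then show "s = t" using distinct_positive_bounds[of I] by (simp add: enc(3) k_def nth_eq_iff_index_eq)
  qed
  have count: "card {e \<in> used p. lab e = Suc t} = card (chosen p \<inter> esets I ! (positive_bounds I ! t))"
    if p: "p \<in> pairings" and t: "t < k" for p t
  proof (rule card_used_filter[OF p])
    fix v u i assume vui: "v < n" "u < n" "i < n"
    have j: "positive_bounds I ! t < length (esets I)"
      using positive_bounds_nth[of t I] t dwf by (simp add: k_def dm_wf_def)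
    have "lab (var v u i) = Suc t \<longleftrightarrow> v < u \<and> inp (3 + 2 * t) + 2 = inp (3 + 2 * k + pv v u)"
      using lookup_label_iff[OF inj t] by (simp add: labvar[OF vui])
    also have "\<dots> \<longleftrightarrow> v < u \<and> edge_entry I v u = positive_bounds I ! t + 2"
      unfolding pv_def enc(5)[OF vui(1,2)] enc(3)[OF t] by metis
    also have "\<dots> \<longleftrightarrow> v < u \<and> {v, u} \<in> esets I ! (positive_bounds I ! t)"
      by (simp only: edge_entry_iff[OF dwf j])
    finally show "lab (var v u i) = Suc t \<longleftrightarrow> v < u \<and> {v, u} \<in> esets I ! (positive_bounds I ! t)" .
  qed
  define \<F> where "\<F> = used ` {p \<in> pairings. meets_bounds I (chosen p)}"
  have solv: "df_solvable I \<longleftrightarrow> (\<exists>p\<in>pairings. meets_bounds I (chosen p))"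
  proof
    assume "df_solvable I"
    then obtain F where F: "F \<subseteq> edges I" "\<forall>v < n. card {e \<in> F. v \<in> e} = f v" "meets_bounds I F"
      unfolding df_solvable_def f_factor_def n_def f_def by blast
    then obtain p where "p \<in> pairings" "chosen p = F" using pairing_exists[of F] all by blast
    then show "\<exists>p\<in>pairings. meets_bounds I (chosen p)" using F(3) by blast
  next
    assume "\<exists>p\<in>pairings. meets_bounds I (chosen p)"
    then obtain p where p: "p \<in> pairings" "meets_bounds I (chosen p)" by blast
    have "f_factor I (chosen p)"
      unfolding f_factor_def using chosen_subset[OF p(1)] chosen_degree[OF p(1)] all by (simp add: n_def f_def)
    then show "df_solvable I" unfolding df_solvable_def using p(2) by blast
  qed
  have "wp X p_rest (\<lambda>s'. (fst s' 0 \<noteq> 0 \<longrightarrow> df_solvable I) \<and> ((\<exists>!S. min_weight \<F> w S) \<longrightarrow> fst s' 0 \<noteq> 0)) s"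
    if regs: "setup_regs n k s" and mem: "mem_ok inp (3 + 2 * k + n * n + n) w (\<lambda>_. 0) (\<lambda>_. 0) (snd s)"
      and w: "\<forall>e. w e < fst s r_range" and X: "loop_bound I \<le> X" for w s X
  proof -
    define R where "R = fst s r_range"
    define Wc where "Wc = nv * R + 1"
    \<comment> \<open>For \<open>n = 0\<close> there are no gadget vertices, but then the range and
      \<open>Wc\<close> are both 1.\<close>
    have R1: "R \<le> Wc"
    proof (cases "n = 0")
      case True
      then show ?thesis using regs by (simp add: setup_regs_def R_def Wc_def)
    next
      case False
      then have "0 < nv" by (simp add: nv_def)
      then have "1 * R \<le> nv * R" by (intro mult_le_mono1) linarith
      then show ?thesis unfolding Wc_def by linarith
    qed
    interpret algorithm n f E k "caps I" lab w Wc inp "3 + 2 * k + n * n + n" R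
    proof
      show "lab e \<le> k" for e by (simp add: lab_def lookup_label_le)
      show "w e < Wc" for e using w R1 unfolding R_def by (meson less_le_trans)
      show "inp (3 + 2 * k + n * n + v) = f v" if "v < n" for v using enc(6)[OF that] by (simp add: f_def)
      show "inp (3 + 2 * k + pv v u) \<noteq> 0 \<longleftrightarrow> E v u" if "v < n" "u < n" for v u
        unfolding pv_def enc(5)[OF that] edge_entry_nonzero E_def ..
      show "lab (var v u i) = (if v < u then lookup_label inp k (inp (3 + 2 * k + pv v u)) else 0)"
        if "v < n" "u < n" "i < n" for v u i by (rule labvar[OF that])
      show "caps I t = 2 * min (inp (4 + 2 * t)) (n * n + 1)" if "t < k" for t
        unfolding enc(4)[OF that] by (simp add: caps_def n_def)
    qed (rule refl Wc_def)+
    have Rle: "R \<le> 2 * (n * n * n * n) + 1" using regs by (simp add: setup_regs_def R_def)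
    have "enough X"
    proof -
      have "Wc \<le> (n * n + n * n) * (2 * (n * n * n * n) + 1) + 1"
        unfolding Wc_def nv_def using Rle by (intro add_le_mono1 mult_le_mono2)
      then have "Q * Suc k \<le> ((n * n + n * n) * (2 * (n * n * n * n) + 1) + 1) * radix (caps I) k * Suc k"
        unfolding Q_def Z_def by (intro mult_le_mono1)
      then show ?thesis
        using X unfolding enough_def loop_bound_def Let_def n_def[symmetric] k_def[symmetric] N2_def nv_def by linarith
    qed
    moreover have "pre s"
      unfolding pre_def using regs by (simp add: setup_regs_def nv_def R_def)
    ultimately have wpr: "wp X p_rest (\<lambda>s'. fst s' 0 \<noteq> 0 \<longleftrightarrow> (\<exists>x<Wc. odd (hits (x * Z + (Z - 1))))) s"
      by (rule wp_p_rest[OF _ _ mem])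
    have full: "full p \<longleftrightarrow> meets_bounds I (chosen p)" if p: "p \<in> pairings" for p
    proof -
      have "card (chosen p \<inter> K) < n * n + 1" for K
      proof -
        have "card (chosen p \<inter> K) \<le> card all_edges"
          using chosen_subset[OF p] card_all_edges(2) by (intro card_mono) auto
        then show ?thesis using card_all_edges(1) by linarith
      qed
      \<comment> \<open>Where the minimum differs from \<open>m\<close>, both exceed the number of
        edges and both comparisons fail.\<close>
      then have "min m (n * n + 1) \<le> card (chosen p \<inter> K) \<longleftrightarrow> m \<le> card (chosen p \<inter> K)" for m K
        by (metis leD min_le_iff_disj)
      then show ?thesis
        unfolding full_def meets_bounds_iff k_def[symmetric] using enc(4) count[OF p] by simp
    qed
    have fam: "used ` {p \<in> pairings. full p} = \<F>" unfolding \<F>_def using full by blast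
    show ?thesis
    proof (rule wp_conseq[OF wpr], intro conjI impI)
      fix s' assume *: "fst s' 0 \<noteq> 0 \<longleftrightarrow> (\<exists>x<Wc. odd (hits (x * Z + (Z - 1))))"
      show "df_solvable I" if "fst s' 0 \<noteq> 0"
        using * that hits_sound solv full by blast
      show "fst s' 0 \<noteq> 0" if "\<exists>!S. min_weight \<F> w S"
        unfolding * by (rule hits_complete) (use that w in \<open>simp_all only: fam R_def\<close>)
    qed
  qed
  moreover have "\<F> \<subseteq> Pow {..<n * n * n}" unfolding \<F>_def using used_subset by blast
  moreover have "df_solvable I \<longrightarrow> \<F> \<noteq> {}" unfolding solv \<F>_def by blast
  ultimately show ?thesis by blast
qed

section \<open>The two algorithms\<close>

definition df_prog :: prog where
  "df_prog = PSeq p_setup (PSeq p_weights p_rest)"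

definition p_ones :: prog where
  "p_ones = PSeq (PAsg r_n (Mem (Const 0))) (PSeq (PAsg r_kp (Mem (Const 2)))
     (PSeq (PMul r_n2 r_n r_n) (PSeq (PAsg r_deg (Plus (Plus (Const 3) (dbl (Reg r_kp))) (Reg r_n2)))
     (PFor r_v r_n (PSto (Plus (Reg r_deg) (Reg r_v)) (Const 1))))))"

definition dm_prog :: prog where
  "dm_prog = PSeq p_ones df_prog"

lemma wf_df_prog: "wf_prog df_prog"
  by (simp add: df_prog_def)

lemma wf_p_ones: "wf_prog p_ones" "flip_free p_ones"
  by (simp_all add: p_ones_def)

lemma wf_dm_prog: "wf_prog dm_prog"
  by (simp add: dm_prog_def wf_df_prog wf_p_ones)

lemma loop_bound_ge:
  fixes I :: "'a dm_instance_scheme"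
  assumes "loop_bound I \<le> X"
  shows "nverts I \<le> X" "nverts I * nverts I * nverts I \<le> X" "nverts I * nverts I * nverts I * nverts I \<le> X"
  using assms unfolding loop_bound_def Let_def by linarith+

lemma initial_mem_ok:
  fixes I :: df_instance
  assumes "df_wf I" "m = mem_of (df_encode I)"
  shows "mem_ok (mem_of (df_encode I)) (3 + 2 * length (positive_bounds I) + nverts I * nverts I + nverts I)
    (\<lambda>_. 0) (\<lambda>_. 0) (\<lambda>_. 0) m"
proof -
  have "length (degs I) = nverts I" using assms(1) by (simp add: df_wf_def)
  note z = df_encode_nth(7)[OF this]
  have "arr (3 + 2 * length (positive_bounds I) + nverts I * nverts I + nverts I) \<rho> m = (\<lambda>_. 0)" for \<rho>
    unfolding arr_def assms(2) by (intro ext z) (simp add: addr_def)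
  then show ?thesis unfolding mem_ok_def assms(2) by blast
qed

lemma wp_weights_rest:
  fixes I :: df_instance
  assumes wf: "df_wf I" and X: "loop_bound I \<le> X"
    and regs: "setup_regs (nverts I) (length (positive_bounds I)) s" and m: "snd s = mem_of (df_encode I)"
  shows "wp X p_weights (\<lambda>s'. setup_regs (nverts I) (length (positive_bounds I)) s' \<and>
     (\<exists>w. (\<forall>e. w e < fst s' r_range) \<and> mem_ok (mem_of (df_encode I))
       (3 + 2 * length (positive_bounds I) + nverts I * nverts I + nverts I) w (\<lambda>_. 0) (\<lambda>_. 0) (snd s'))) s"
proof -
  have "fst s r_n3 = nverts I * nverts I * nverts I" "fst s r_bits \<le> X"
    "fst s r_base = 3 + 2 * length (positive_bounds I) + nverts I * nverts I + nverts I"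
    using regs loop_bound_ge[OF X] by (simp_all add: setup_regs_def)
  from wp_p_weights[OF this(1) refl this(3) loop_bound_ge(2)[OF X] this(2) initial_mem_ok[OF wf m]]
  show ?thesis
  proof (rule wp_conseq)
    fix s' assume 1: "\<exists>w. (\<forall>e. w e < 2 ^ fst s r_bits) \<and> mem_ok (mem_of (df_encode I))
       (3 + 2 * length (positive_bounds I) + nverts I * nverts I + nverts I) w (\<lambda>_. 0) (\<lambda>_. 0) (snd s')"
      and fr: "\<forall>x. x \<notin> mods p_weights \<longrightarrow> fst s' x = fst s x"
    have 2: "setup_regs (nverts I) (length (positive_bounds I)) s'" using regs fr by (simp add: setup_regs_def)
    have "fst s' r_range = 2 ^ fst s r_bits" using regs fr by (simp add: setup_regs_def)
    with 1 2 show "setup_regs (nverts I) (length (positive_bounds I)) s' \<and>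
     (\<exists>w. (\<forall>e. w e < fst s' r_range) \<and> mem_ok (mem_of (df_encode I))
       (3 + 2 * length (positive_bounds I) + nverts I * nverts I + nverts I) w (\<lambda>_. 0) (\<lambda>_. 0) (snd s'))"
      by simp
  qed
qed

lemma wp_df_prog:
  fixes I :: df_instance
  assumes wf: "df_wf I" and X: "loop_bound I \<le> X" and m: "snd s = mem_of (df_encode I)"
  shows "wp X df_prog (\<lambda>s'. fst s' 0 \<noteq> 0 \<longrightarrow> df_solvable I) s"
proof -
  have len: "length (degs I) = nverts I" using wf by (simp add: df_wf_def)
  have m02: "snd s 0 = nverts I" "snd s 2 = length (positive_bounds I)"
    unfolding m using df_encode_nth(1,2)[OF len] by simp_all
  show ?thesis
    unfolding df_prog_def
  proof (rule wp_Seq[OF wp_p_setup[OF m02 loop_bound_ge(1,3)[OF X]]], goal_cases)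
    case (1 s1)
    then have regs: "setup_regs (nverts I) (length (positive_bounds I)) s1" and m1: "snd s1 = mem_of (df_encode I)"
      using m by simp_all
    show ?case
    proof (rule wp_Seq[OF wp_weights_rest[OF wf X regs m1]], goal_cases)
      case (1 s2)
      then obtain w where w: "\<forall>e. w e < fst s2 r_range" "mem_ok (mem_of (df_encode I))
       (3 + 2 * length (positive_bounds I) + nverts I * nverts I + nverts I) w (\<lambda>_. 0) (\<lambda>_. 0) (snd s2)"
        and regs2: "setup_regs (nverts I) (length (positive_bounds I)) s2" by blast
      from rest_correct[OF wf] obtain \<F> where "wp X p_rest (\<lambda>s'. (fst s' 0 \<noteq> 0 \<longrightarrow> df_solvable I) \<and>
          ((\<exists>!S. min_weight \<F> w S) \<longrightarrow> fst s' 0 \<noteq> 0)) s2"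
        using w regs2 X by blast
      then show ?case by (rule wp_conseq) blast
    qed
  qed
qed

lemma prob_bind_pmf_ge:
  assumes "\<And>x. x \<in> set_pmf M \<Longrightarrow> x \<in> G \<Longrightarrow> measure_pmf.prob (f x) S = 1"
  shows "measure_pmf.prob M G \<le> measure_pmf.prob (bind_pmf M f) S"
proof -
  have "ennreal (measure_pmf.prob M G) = (\<integral>\<^sup>+x. indicator G x \<partial>measure_pmf M)"
    by (simp add: measure_pmf.emeasure_eq_measure)
  also have "\<dots> \<le> (\<integral>\<^sup>+x. emeasure (measure_pmf (f x)) S \<partial>measure_pmf M)"
    by (intro nn_integral_mono_AE)
       (auto simp: AE_measure_pmf_iff measure_pmf.emeasure_eq_measure indicator_def assms)
  also have "\<dots> = emeasure (measure_pmf (bind_pmf M f)) S"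
    by (rule emeasure_bind_pmf[symmetric])
  also have "\<dots> = ennreal (measure_pmf.prob (bind_pmf M f) S)"
    by (rule measure_pmf.emeasure_eq_measure)
  finally show ?thesis by simp
qed

text \<open>Setup and counting are deterministic, so success is at least as likely as the event that
  the weights isolate a member of \<open>\<F>\<close>: there are \<open>n^3\<close> variables
  against a range of at least \<open>n^4\<close>.\<close>

lemma df_prog_prob:
  fixes I :: df_instance
  assumes wf: "df_wf I" and sol: "df_solvable I" and m: "snd s = mem_of (df_encode I)"
  shows "measure_pmf.prob (psem df_prog s) {s'. fst s' 0 \<noteq> 0} \<ge> 1 - 1 / real (nverts I)"
proof -
  define X where "X = loop_bound I"
  let ?n = "nverts I" and ?k = "length (positive_bounds I)"
  let ?L = "3 + 2 * ?k + ?n * ?n + ?n"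
  have X: "loop_bound I \<le> X" by (simp add: X_def)
  have len: "length (degs I) = ?n" using wf by (simp add: df_wf_def)
  have m02: "snd s 0 = ?n" "snd s 2 = ?k" unfolding m using df_encode_nth(1,2)[OF len] by simp_all
  obtain s1 where s1: "psem p_setup s = return_pmf s1" using psem_flip_free[OF flip_free_p_setup] by blast
  have "\<forall>s' \<in> set_pmf (psem p_setup s). snd s' = snd s \<and> setup_regs ?n ?k s'"
    using compile_correct[OF wf_p_setup wp_p_setup[OF m02 loop_bound_ge(1,3)[OF X]]] by blast
  then have m1: "snd s1 = mem_of (df_encode I)" and regs: "setup_regs ?n ?k s1" by (simp_all add: s1 m)
  obtain \<F> where F: "\<F> \<subseteq> Pow {..<?n * ?n * ?n}" "\<F> \<noteq> {}"
    and rest: "\<And>w s. setup_regs ?n ?k s \<Longrightarrow> mem_ok (mem_of (df_encode I)) ?L w (\<lambda>_. 0) (\<lambda>_. 0) (snd s) \<Longrightarrow>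
       (\<forall>e. w e < fst s r_range) \<Longrightarrow>
       wp X p_rest (\<lambda>s'. (fst s' 0 \<noteq> 0 \<longrightarrow> df_solvable I) \<and> ((\<exists>!S. min_weight \<F> w S) \<longrightarrow> fst s' 0 \<noteq> 0)) s"
    using rest_correct[OF wf] sol X by blast
  define b where "b = fst s1 r_bits"
  have r1: "fst s1 r_bits = b" "fst s1 r_base = ?L" "fst s1 r_n3 = ?n * ?n * ?n"
    and pow: "?n * ?n * ?n * ?n \<le> 2 ^ b"
    using regs by (simp_all add: setup_regs_def b_def)
  have arr0: "arr ?L 0 (snd s1) = (\<lambda>_. 0)" using initial_mem_ok[OF wf m1] by (simp add: mem_ok_def)
  let ?G = "{s2. \<exists>!S. min_weight \<F> (arr ?L 0 (snd s2)) S}"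
  have good: "measure_pmf.prob (psem p_rest s2) {s'. fst s' 0 \<noteq> 0} = 1"
    if s2: "s2 \<in> set_pmf (psem p_weights s1)" "s2 \<in> ?G" for s2
  proof -
    from compile_correct[OF wf_p_weights(2) wp_weights_rest[OF wf X regs m1]] s2(1)
    obtain w where regs2: "setup_regs ?n ?k s2" and w: "\<forall>e. w e < fst s2 r_range"
      "mem_ok (mem_of (df_encode I)) ?L w (\<lambda>_. 0) (\<lambda>_. 0) (snd s2)" by blast
    have "arr ?L 0 (snd s2) = w" using w(2) by (simp add: mem_ok_def)
    then have iso: "\<exists>!S. min_weight \<F> w S" using s2(2) by simp
    obtain s3 where s3: "psem p_rest s2 = return_pmf s3" using psem_flip_free[OF flip_free_p_rest] by blast
    from compile_correct[OF wf_p_rest rest[OF regs2 w(2,1)]] iso have "fst s3 0 \<noteq> 0" by (simp add: s3)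
    then show ?thesis by (simp add: s3)
  qed
  have "1 - real (card {..<?n * ?n * ?n}) / real (2 ^ b) \<le>
     measure_pmf.prob (Pi_pmf {..<?n * ?n * ?n} 0 (\<lambda>_. uniform b)) {w. \<exists>!S. min_weight \<F> w S}"
    by (rule isolation_lemma[OF _ F]) simp_all
  also have "\<dots> = measure_pmf.prob (map_pmf (\<lambda>s'. arr ?L 0 (snd s')) (psem p_weights s1)) {w. \<exists>!S. min_weight \<F> w S}"
    by (simp only: p_weights_dist[OF r1 arr0])
  also have "\<dots> = measure_pmf.prob (psem p_weights s1) ?G"
    by (simp add: vimage_def)
  also have "\<dots> \<le> measure_pmf.prob (bind_pmf (psem p_weights s1) (psem p_rest)) {s'. fst s' 0 \<noteq> 0}"
    by (rule prob_bind_pmf_ge) (rule good)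
  also have "bind_pmf (psem p_weights s1) (psem p_rest) = psem df_prog s"
    by (simp add: df_prog_def s1 bind_return_pmf)
  finally have main: "1 - real (card {..<?n * ?n * ?n}) / real (2 ^ b) \<le>
    measure_pmf.prob (psem df_prog s) {s'. fst s' 0 \<noteq> 0}" .
  \<comment> \<open>For \<open>?n = 0\<close> both quotients are 0, the right one because division
    by zero yields 0.\<close>
  have "real (card {..<?n * ?n * ?n}) / real (2 ^ b) \<le> 1 / real ?n"
  proof (cases "?n = 0")
    case False
    have "real (?n * ?n * ?n) * real ?n \<le> real (2 ^ b)" using pow by (metis of_nat_le_iff of_nat_mult)
    then show ?thesis using False by (simp add: field_simps)
  qed simp
  then show ?thesis using main by linarith
qed

section \<open>From the program logic to runs of the machine\<close>

lemma run_add: "run (t + t') cfg = bind_pmf (run t cfg) (run t')"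
proof (induction t arbitrary: cfg)
  case (Suc t)
  have "run (t + t') = (\<lambda>cfg. bind_pmf (run t cfg) (run t'))" by (rule ext) (rule Suc.IH)
  then show ?case by (simp add: bind_assoc_pmf)
qed (simp add: bind_return_pmf)

lemma start_eq: "start A w = (A, (\<lambda>_. 0), mem_of w)"
  by (simp add: start_def mem_of_def fun_eq_iff)

lemma compile_halts:
  assumes "wf_prog p" "wp X p Q ((\<lambda>_. 0), mem_of w)" "time_bound X p \<le> t"
  shows "halts_within (compile p) w t"
  using compile_correct[OF assms(1,2)] assms(3)
  by (auto simp: halts_within_def start_eq execs_def halted_def)

text \<open>A run that has returned TRUE stays halted, so it can be prolonged beyond the time bound,
  where \<open>compile_correct\<close> describes it.\<close>

lemma compile_true_sound:
  assumes "wf_prog p" "wp X p (\<lambda>s'. fst s' 0 \<noteq> 0 \<longrightarrow> P) ((\<lambda>_. 0), mem_of w)" "can_return_true (compile p) w"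
  shows P
proof -
  obtain t cfg where cfg: "cfg \<in> set_pmf (run t (start (compile p) w))" "returned_true cfg"
    using assms(3) by (auto simp: can_return_true_def)
  obtain s where s: "cfg = (Skip, s)" "fst s 0 \<noteq> 0"
    using cfg(2) by (metis returned_true_def halted_def prod.collapse snd_conv)
  have "cfg \<in> set_pmf (run (t + time_bound X p) (start (compile p) w))"
    unfolding run_add using cfg(1) s by (auto intro!: bexI[of _ cfg])
  also have "run (t + time_bound X p) (start (compile p) w) = map_pmf (Pair Skip) (psem p ((\<lambda>_. 0), mem_of w))"
    using compile_correct[OF assms(1,2)] by (simp add: execs_def start_eq)
  finally have "s \<in> set_pmf (psem p ((\<lambda>_. 0), mem_of w))" using s by auto
  then show P using compile_correct[OF assms(1,2)] s(2) by blast
qed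

lemma compile_prob_true:
  assumes "wf_prog p" "wp X p Q ((\<lambda>_. 0), mem_of w)"
  shows "measure_pmf.prob (psem p ((\<lambda>_. 0), mem_of w)) {s'. fst s' 0 \<noteq> 0} \<le> prob_true (compile p) w"
proof -
  have "run (time_bound X p) (start (compile p) w) = map_pmf (Pair Skip) (psem p ((\<lambda>_. 0), mem_of w))"
    using compile_correct[OF assms] by (simp add: execs_def start_eq)
  then have "measure_pmf.prob (run (time_bound X p) (start (compile p) w)) {cfg. returned_true cfg}
      = measure_pmf.prob (psem p ((\<lambda>_. 0), mem_of w)) {s'. fst s' 0 \<noteq> 0}"
    by (simp add: vimage_def returned_true_def halted_def)
  moreover have "measure_pmf.prob (run (time_bound X p) (start (compile p) w)) {cfg. returned_true cfg}
      \<le> prob_true (compile p) w"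
    unfolding prob_true_def by (rule cSUP_upper) (auto intro!: bdd_aboveI[of _ 1])
  ultimately show ?thesis by simp
qed

section \<open>Polynomial bounds on the running time\<close>

lemma poly_nat_mono:
  fixes q :: "nat poly"
  assumes "x \<le> y"
  shows "poly q x \<le> poly q y"
  by (induction q) (auto intro!: add_mono mult_mono assms)

lemma loop_bound_poly:
  fixes a b :: "nat poly"
  shows "\<exists>r :: nat poly. \<forall>I :: 'a dm_instance_scheme. length (positive_bounds I) \<le> poly a (nverts I) \<longrightarrow>
     radix (caps I) (length (positive_bounds I)) \<le> poly b (nverts I) \<longrightarrow> loop_bound I \<le> poly r (nverts I)"
proof -
  define x :: "nat poly" where "x = [:0, 1:]"
  have px: "poly x k = k" for k by (simp add: x_def)
  define r where "r = x + x * x * x + x * x * x * x + (x * x + x * x + [:2:]) +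
     ((x * x + x * x) * ([:2:] * (x * x * x * x) + 1) + 1) * b * (a + 1)"
  have "loop_bound I \<le> poly r (nverts I)"
    if "length (positive_bounds I) \<le> poly a (nverts I)"
      "radix (caps I) (length (positive_bounds I)) \<le> poly b (nverts I)" for I :: "'a dm_instance_scheme"
  proof -
    have e: "poly r m = m + m * m * m + m * m * m * m + (m * m + m * m + 2) +
       ((m * m + m * m) * (2 * (m * m * m * m) + 1) + 1) * poly b m * (poly a m + 1)" for m
    proof -
      have "poly [:2:] m = (2 :: nat)" by simp
      then show ?thesis by (simp only: r_def poly_add poly_mult px poly_1)
    qed
    show ?thesis
      unfolding e loop_bound_def Let_def
      by (intro add_le_mono mult_le_mono le_refl) (use that in simp_all)
  qed
  then show ?thesis by blast
qed

text \<open>\<open>2 * m + 1 \<le> (m + 1) ^ 2\<close>: doubling the caps at most squares the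
  product, which stays polynomial.\<close>

lemma radix_caps_le:
  "radix (caps I) (length (positive_bounds I)) \<le> (\<Prod>t<length (positive_bounds I). (bounds I ! (positive_bounds I ! t) + 1) ^ 2)"
  unfolding radix_def
proof (intro prod_mono conjI)
  fix t
  let ?m = "bounds I ! (positive_bounds I ! t)"
  have "caps I t \<le> 2 * ?m" by (simp add: caps_def)
  moreover have "(?m + 1) ^ 2 = ?m * ?m + 2 * ?m + 1" by (simp add: power2_eq_square)
  ultimately show "caps I t + 1 \<le> (?m + 1) ^ 2" by linarith
qed simp

lemma prod_positive_bounds:
  "(\<Prod>t<length (positive_bounds I). bounds I ! (positive_bounds I ! t) + 1) = bound_prod I"
proof -
  have "(\<Prod>t<length (positive_bounds I). bounds I ! (positive_bounds I ! t) + 1) =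
     prod_list (map (\<lambda>j. bounds I ! j + 1) (positive_bounds I))"
    by (simp add: prod.list_conv_set_nth atLeast0LessThan)
  also have "\<dots> = (\<Prod>j\<in>set (positive_bounds I). bounds I ! j + 1)"
    by (rule prod.distinct_set_conv_list[symmetric]) (rule distinct_positive_bounds)
  also have "\<dots> = bound_prod I"
    unfolding bound_prod_def
    by (rule prod.mono_neutral_left) (auto simp: positive_bounds_def)
  finally show ?thesis .
qed

text \<open>Each positive bound contributes a factor of at least 2, and
  \<open>k < 2 ^ k\<close>.\<close>

lemma positive_bounds_le_prod: "length (positive_bounds I) \<le> bound_prod I"
proof -
  let ?k = "length (positive_bounds I)"
  have "(2::nat) ^ ?k = (\<Prod>t<?k. 2)" by simp
  also have "\<dots> \<le> (\<Prod>t<?k. bounds I ! (positive_bounds I ! t) + 1)"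
  proof (intro prod_mono conjI)
    fix t assume "t \<in> {..<?k}"
    then have "positive_bounds I ! t \<in> set (positive_bounds I)" by simp
    then have "0 < bounds I ! (positive_bounds I ! t)" by (auto simp: positive_bounds_def)
    then show "2 \<le> bounds I ! (positive_bounds I ! t) + 1" by simp
  qed simp
  finally show ?thesis using less_exp[of ?k] unfolding prod_positive_bounds by linarith
qed

text \<open>Rounding up \<open>c\<close> times the absolute value of each coefficient gives
  \<open>d\<close>.\<close>

lemma real_poly_dominated:
  fixes p :: "real poly"
  assumes "c \<ge> 0"
  shows "\<exists>d :: nat poly. \<forall>k. c * \<bar>poly p (real k)\<bar> \<le> real (poly d k)"
proof (induction p)
  case 0
  show ?case by (rule exI[of _ 0]) simp
next
  case (pCons a p)
  then obtain d :: "nat poly" where d: "\<And>k. c * \<bar>poly p (real k)\<bar> \<le> real (poly d k)" by blast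
  have "c * \<bar>poly (pCons a p) (real k)\<bar> \<le> real (poly (pCons (nat \<lceil>c * \<bar>a\<bar>\<rceil>) d) k)" for k
  proof -
    have "c * \<bar>a + real k * poly p (real k)\<bar> \<le> c * (\<bar>a\<bar> + real k * \<bar>poly p (real k)\<bar>)"
      using assms by (intro mult_left_mono) (auto simp: abs_mult intro: order_trans[OF abs_triangle_ineq])
    also have "\<dots> = c * \<bar>a\<bar> + real k * (c * \<bar>poly p (real k)\<bar>)" by (simp add: algebra_simps)
    also have "\<dots> \<le> real (nat \<lceil>c * \<bar>a\<bar>\<rceil>) + real k * real (poly d k)"
      using d[of k] by (intro add_mono mult_left_mono real_nat_ceiling_ge) simp_all
    finally show ?thesis by simp
  qed
  then show ?case by blast
qed

text \<open>The finitely many \<open>n\<close> before the asymptotic estimate sets in are absorbed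
  by the constant \<open>C\<close>.\<close>

lemma bigo_poly_dominated:
  fixes p :: "real poly" and B :: "nat \<Rightarrow> real"
  assumes "B \<in> O(\<lambda>n. poly p (real n))"
  shows "\<exists>r :: nat poly. \<forall>n. B n \<le> real (poly r n)"
proof -
  obtain c where c: "c > 0" "eventually (\<lambda>n. norm (B n) \<le> c * norm (poly p (real n))) at_top"
    using landau_o.bigE[OF assms] by blast
  then obtain n0 where n0: "\<And>n. n \<ge> n0 \<Longrightarrow> \<bar>B n\<bar> \<le> c * \<bar>poly p (real n)\<bar>"
    by (auto simp: eventually_at_top_linorder)
  obtain d :: "nat poly" where d: "\<And>k. c * \<bar>poly p (real k)\<bar> \<le> real (poly d k)"
    using real_poly_dominated[of c p] c by auto
  define C where "C = (\<Sum>n<n0. nat \<lceil>\<bar>B n\<bar>\<rceil>)"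
  have "B n \<le> real (poly ([:C:] + d) n)" for n
  proof (cases "n < n0")
    case True
    have "B n \<le> real (nat \<lceil>\<bar>B n\<bar>\<rceil>)" by (rule order_trans[OF abs_ge_self real_nat_ceiling_ge])
    also have "nat \<lceil>\<bar>B n\<bar>\<rceil> \<le> C" unfolding C_def using True by (intro member_le_sum) auto
    finally have "B n \<le> real C" by simp
    then show ?thesis by simp
  next
    case False
    then have "B n \<le> real (poly d n)" using n0[of n] d[of n] by simp
    then show ?thesis by simp
  qed
  then show ?thesis by blast
qed

lemma loop_bound_small_prod:
  fixes r :: "nat poly"
  shows "\<exists>q :: nat poly. \<forall>I :: 'a dm_instance_scheme. bound_prod I \<le> poly r (nverts I) \<longrightarrow> loop_bound I \<le> poly q (nverts I)"
proof -
  obtain q :: "nat poly" where q: "\<And>I :: 'a dm_instance_scheme. length (positive_bounds I) \<le> poly r (nverts I) \<Longrightarrow>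
     radix (caps I) (length (positive_bounds I)) \<le> poly (r ^ 2) (nverts I) \<Longrightarrow> loop_bound I \<le> poly q (nverts I)"
    using loop_bound_poly[of r "r ^ 2"] by blast
  have "loop_bound I \<le> poly q (nverts I)" if "bound_prod I \<le> poly r (nverts I)" for I :: "'a dm_instance_scheme"
  proof (rule q)
    show "length (positive_bounds I) \<le> poly r (nverts I)" using positive_bounds_le_prod[of I] that by linarith
    have "radix (caps I) (length (positive_bounds I)) \<le> bound_prod I ^ 2"
      using radix_caps_le[of I] unfolding prod_power_distrib[symmetric] prod_positive_bounds .
    also have "\<dots> \<le> poly (r ^ 2) (nverts I)" using that by (simp add: power_mono)
    finally show "radix (caps I) (length (positive_bounds I)) \<le> poly (r ^ 2) (nverts I)" .
  qed
  then show ?thesis by blast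
qed

lemma positive_bounds_le: "length (positive_bounds I) \<le> length (bounds I)"
  unfolding positive_bounds_def by (rule order_trans[OF length_filter_le]) simp

text \<open>Every cap is at most \<open>2 * (n * n + 1)\<close> whatever the bounds are, so bounds
  beyond the number of edges need no exception here.\<close>

lemma loop_bound_few_sets:
  "\<exists>q :: nat poly. \<forall>I :: 'a dm_instance_scheme. dm_wf I \<and> length (esets I) \<le> K \<longrightarrow> loop_bound I \<le> poly q (nverts I)"
proof -
  define b :: "nat poly" where "b = [:3, 0, 2:] ^ K"
  obtain q :: "nat poly" where q: "\<And>I :: 'a dm_instance_scheme. length (positive_bounds I) \<le> poly [:K:] (nverts I) \<Longrightarrow>
     radix (caps I) (length (positive_bounds I)) \<le> poly b (nverts I) \<Longrightarrow> loop_bound I \<le> poly q (nverts I)"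
    using loop_bound_poly[of "[:K:]" b] by blast
  have "loop_bound I \<le> poly q (nverts I)" if I: "dm_wf I" "length (esets I) \<le> K" for I :: "'a dm_instance_scheme"
  proof (rule q)
    have k: "length (positive_bounds I) \<le> K" using positive_bounds_le[of I] I by (simp add: dm_wf_def)
    then show "length (positive_bounds I) \<le> poly [:K:] (nverts I)" by simp
    have "radix (caps I) (length (positive_bounds I)) \<le> (\<Prod>t<length (positive_bounds I). 2 * (nverts I * nverts I) + 3)"
      unfolding radix_def by (intro prod_mono conjI) (auto simp: caps_def min_def)
    also have "\<dots> = (2 * (nverts I * nverts I) + 3) ^ length (positive_bounds I)" by simp
    also have "\<dots> \<le> (2 * (nverts I * nverts I) + 3) ^ K" using k by (intro power_increasing) simp_all
    also have "\<dots> = poly b (nverts I)" by (simp add: b_def algebra_simps)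
    finally show "radix (caps I) (length (positive_bounds I)) \<le> poly b (nverts I)" .
  qed
  then show ?thesis by blast
qed

lemma card_edges_le:
  assumes "dm_wf I"
  shows "card (edges I) \<le> nverts I * nverts I"
proof -
  have sub: "edges I \<subseteq> (\<lambda>(v, u). {v, u}) ` ({..<nverts I} \<times> {..<nverts I})"
  proof
    fix e assume "e \<in> edges I"
    then have "e \<subseteq> {..<nverts I}" "card e = 2" using assms unfolding dm_wf_def by blast+
    then obtain a b where "e = {a, b}" "a < nverts I" "b < nverts I" by (auto simp: card_2_iff)
    then show "e \<in> (\<lambda>(v, u). {v, u}) ` ({..<nverts I} \<times> {..<nverts I})"
      by (intro image_eqI[of _ _ "(a, b)"]) simp_all
  qed
  have "card (edges I) \<le> card ((\<lambda>(v, u). {v, u}) ` ({..<nverts I} \<times> {..<nverts I}))" by (rule card_mono[OF _ sub]) simp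
  also have "\<dots> \<le> card ({..<nverts I} \<times> {..<nverts I})" by (rule card_image_le) simp
  finally show ?thesis by simp
qed

lemma small_prod_few_sets_dm_wf:
  assumes "\<And>I. valid I \<Longrightarrow> dm_wf I"
  shows "small_prod_few_sets valid"
  unfolding small_prod_few_sets_def
proof
  fix K
  define b :: "nat poly" where "b = [:1, 0, 1:] ^ K"
  have "bound_prod I \<le> poly b (nverts I)"
    if I: "valid I" "length (esets I) \<le> K" "\<forall>m \<in> set (bounds I). m \<le> card (edges I)" for I
  proof -
    have wf: "dm_wf I" using assms I(1) .
    have "bound_prod I \<le> (\<Prod>j<length (bounds I). nverts I * nverts I + 1)"
      unfolding bound_prod_def
    proof (intro prod_mono conjI)
      fix j assume "j \<in> {..<length (bounds I)}"
      then have "bounds I ! j \<le> card (edges I)" using I(3) by simp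
      then show "bounds I ! j + 1 \<le> nverts I * nverts I + 1" using card_edges_le[OF wf] by simp
    qed simp
    also have "\<dots> = (nverts I * nverts I + 1) ^ length (bounds I)" by simp
    also have "\<dots> \<le> (nverts I * nverts I + 1) ^ K" using I(2) wf by (intro power_increasing) (simp_all add: dm_wf_def)
    also have "\<dots> = poly b (nverts I)" by (simp add: b_def algebra_simps)
    finally show ?thesis .
  qed
  then show "\<exists>p :: nat poly. \<forall>I. valid I \<and> length (esets I) \<le> K \<and> (\<forall>m \<in> set (bounds I). m \<le> card (edges I)) \<longrightarrow>
      bound_prod I \<le> poly p (nverts I)" by blast
qed

text \<open>The iteration bound exists only in the analysis: \<open>X\<close> is taken to be
  \<open>loop_bound I\<close>, a number the program never computes.\<close>

lemma algorithm_properties: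
  fixes valid :: "'a dm_instance_scheme \<Rightarrow> bool"
  assumes p: "wf_prog p" and wf: "\<And>I. valid I \<Longrightarrow> dm_wf I"
    and wp: "\<And>I X. valid I \<Longrightarrow> loop_bound I \<le> X \<Longrightarrow>
       wp X p (\<lambda>s'. fst s' 0 \<noteq> 0 \<longrightarrow> solvable I) ((\<lambda>_. 0), mem_of (enc I))"
    and pr: "\<And>I. valid I \<Longrightarrow> solvable I \<Longrightarrow>
       measure_pmf.prob (psem p ((\<lambda>_. 0), mem_of (enc I))) {s'. fst s' 0 \<noteq> 0} \<ge> 1 - 1 / real (nverts I)"
  shows "poly_time_small_prod valid enc (compile p)" "poly_time_few_sets valid enc (compile p)"
    "true_is_correct valid enc solvable (compile p)" "solvable_true_whp valid enc solvable (compile p)"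
proof -
  obtain tb :: "nat poly" where tb: "\<And>X. time_bound X p = poly tb X" using time_bound_poly by blast
  have halts: "halts_within (compile p) (enc I) (poly (pcompose tb q) (nverts I))"
    if "valid I" "loop_bound I \<le> poly q (nverts I)" for I and q :: "nat poly"
    by (rule compile_halts[OF p wp[OF that(1) le_refl]]) (simp add: tb poly_pcompose poly_nat_mono[OF that(2)])
  show "poly_time_small_prod valid enc (compile p)"
    unfolding poly_time_small_prod_def
  proof (intro allI impI)
    fix pp :: "real poly" and B :: "nat \<Rightarrow> real"
    assume "B \<in> O(\<lambda>n. poly pp (real n))"
    then obtain r :: "nat poly" where r: "\<And>n. B n \<le> real (poly r n)" using bigo_poly_dominated by blast
    obtain q :: "nat poly" where q: "\<And>I :: 'a dm_instance_scheme. bound_prod I \<le> poly r (nverts I) \<Longrightarrow> loop_bound I \<le> poly q (nverts I)"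
      using loop_bound_small_prod[of r] by blast
    have "halts_within (compile p) (enc I) (poly (pcompose tb q) (nverts I))"
      if "valid I" "real (bound_prod I) \<le> B (nverts I)" for I
    proof (rule halts[OF that(1) q])
      have "real (bound_prod I) \<le> real (poly r (nverts I))" using that(2) r by (rule order_trans)
      then show "bound_prod I \<le> poly r (nverts I)" by simp
    qed
    then show "\<exists>q :: nat poly. \<forall>I. valid I \<and> real (bound_prod I) \<le> B (nverts I) \<longrightarrow>
          halts_within (compile p) (enc I) (poly q (nverts I))" by blast
  qed
  show "poly_time_few_sets valid enc (compile p)"
    unfolding poly_time_few_sets_def
  proof
    fix K
    obtain q :: "nat poly" where q: "\<And>I :: 'a dm_instance_scheme. dm_wf I \<Longrightarrow> length (esets I) \<le> K \<Longrightarrow> loop_bound I \<le> poly q (nverts I)"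
      using loop_bound_few_sets[of K] by blast
    have "halts_within (compile p) (enc I) (poly (pcompose tb q) (nverts I))"
      if "valid I" "length (esets I) \<le> K" for I
      by (rule halts[OF that(1) q[OF wf[OF that(1)] that(2)]])
    then show "\<exists>q :: nat poly. \<forall>I. valid I \<and> length (esets I) \<le> K \<longrightarrow>
        halts_within (compile p) (enc I) (poly q (nverts I))" by blast
  qed
  show "true_is_correct valid enc solvable (compile p)"
    unfolding true_is_correct_def using compile_true_sound[OF p wp[OF _ le_refl]] by blast
  have "(\<lambda>n. 1 - 1 / real n) \<longlonglongrightarrow> 1 - 0"
    by (intro tendsto_diff tendsto_const lim_1_over_n)
  moreover have "1 - 1 / real (nverts I) \<le> prob_true (compile p) (enc I)" if "valid I" "solvable I" for I
    using pr[OF that] compile_prob_true[OF p wp[OF that(1) le_refl]] by (rule order_trans)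
  ultimately show "solvable_true_whp valid enc solvable (compile p)"
    unfolding solvable_true_whp_def by auto
qed

section \<open>Perfect matchings as factors with all degrees 1\<close>

definition to_df :: "dm_instance \<Rightarrow> df_instance" where
  "to_df I = \<lparr>nverts = nverts I, edges = edges I, esets = esets I, bounds = bounds I, degs = replicate (nverts I) 1\<rparr>"

lemma to_df_sel [simp]:
  "nverts (to_df I) = nverts I" "edges (to_df I) = edges I" "esets (to_df I) = esets I" "bounds (to_df I) = bounds I"
  "degs (to_df I) = replicate (nverts I) 1"
  by (simp_all add: to_df_def)

lemma to_df_same [simp]:
  "positive_bounds (to_df I) = positive_bounds I" "dm_wf (to_df I) = dm_wf I" "edge_entry (to_df I) = edge_entry I"
  "meets_bounds (to_df I) = meets_bounds I" "caps (to_df I) = caps I"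
proof -
  show pb: "positive_bounds (to_df I) = positive_bounds I" by (simp add: positive_bounds_def)
  show "caps (to_df I) = caps I" by (intro ext) (simp add: caps_def pb)
  show "edge_entry (to_df I) = edge_entry I" by (intro ext) (simp only: edge_entry_def to_df_sel)
qed (simp_all add: dm_wf_def meets_bounds_def fun_eq_iff)

lemma to_df_encode: "df_encode (to_df I) = dm_encode I @ replicate (nverts I) 1"
  by (simp add: df_encode_def dm_encode_def)

lemma to_df_loop_bound: "loop_bound (to_df I) = loop_bound I"
  by (simp add: loop_bound_def)

lemma to_df_wf: "df_wf (to_df I) = dm_wf I"
  by (simp add: df_wf_def)

lemma to_df_solvable: "df_solvable (to_df I) \<longleftrightarrow> dm_solvable I"
proof -
  have "card {e \<in> M. v \<in> e} = 1 \<longleftrightarrow> (\<exists>!e. e \<in> M \<and> v \<in> e)" for M :: "nat set set" and v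
  proof -
    have "card {e \<in> M. v \<in> e} = 1 \<longleftrightarrow> (\<exists>e. {e \<in> M. v \<in> e} = {e})" by (simp add: card_1_singleton_iff)
    also have "\<dots> \<longleftrightarrow> (\<exists>!e. e \<in> M \<and> v \<in> e)"
    proof
      assume "\<exists>e. {e \<in> M. v \<in> e} = {e}"
      then obtain e where "{e \<in> M. v \<in> e} = {e}" by blast
      then show "\<exists>!e. e \<in> M \<and> v \<in> e" by (intro ex1I[of _ e]) blast+
    next
      assume "\<exists>!e. e \<in> M \<and> v \<in> e"
      then obtain e where "e \<in> M" "v \<in> e" "\<And>e'. e' \<in> M \<Longrightarrow> v \<in> e' \<Longrightarrow> e' = e" by blast
      then have "{e \<in> M. v \<in> e} = {e}" by blast
      then show "\<exists>e. {e \<in> M. v \<in> e} = {e}" by blast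
    qed
    finally show ?thesis .
  qed
  then have "f_factor (to_df I) M \<longleftrightarrow> perfect_matching I M" for M
    unfolding f_factor_def perfect_matching_def by simp
  then show ?thesis by (simp add: df_solvable_def dm_solvable_def)
qed

text \<open>The two encodings differ only in the degrees at the end, so writing \<open>n\<close>
  ones behind the input turns one into the other.\<close>

lemma wp_p_ones:
  assumes X: "nverts I \<le> X" and m: "snd s = mem_of (dm_encode I)"
  shows "wp X p_ones (\<lambda>s'. snd s' = mem_of (df_encode (to_df I))) s"
proof -
  let ?n = "nverts I" and ?k = "length (positive_bounds I)"
  let ?D = "3 + 2 * ?k + ?n * ?n"
  have m02: "snd s 0 = ?n" "snd s 2 = ?k"
    unfolding m mem_of_def dm_encode_len by (simp_all add: dm_encode_nth)
  let ?s = "upd r_deg ?D (upd 1 ?n (upd r_n2 (?n * ?n) (upd r_kp ?k (upd r_n ?n s))))"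
  have S: "wp X (PFor r_v r_n (PSto (Plus (Reg r_deg) (Reg r_v)) (Const 1)))
     (\<lambda>s'. snd s' = mem_of (df_encode (to_df I))) ?s"
  proof (rule wp_For[where N = ?n and Inv = "\<lambda>k s'. snd s' = (\<lambda>i. if ?D \<le> i \<and> i < ?D + k then 1 else snd s i)"], goal_cases)
    case (5 k s1)
    then have r: "fst s1 r_deg = ?D" "fst s1 r_v = k" by simp_all
    have "(\<lambda>i. if ?D \<le> i \<and> i < ?D + k then 1 else snd s i)(?D + k := 1) =
       (\<lambda>i. if ?D \<le> i \<and> i < ?D + Suc k then 1 else snd s i)" by (auto simp: fun_eq_iff)
    then show ?case using 5(2) r by simp
  next
    case (6 s1)
    have "mem_of (df_encode (to_df I)) i = (if ?D \<le> i \<and> i < ?D + ?n then 1 else snd s i)" for i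
      unfolding m to_df_encode mem_of_def by (auto simp: nth_append dm_encode_len)
    then show ?case using 6(1) by (simp add: fun_eq_iff)
  qed (use X in \<open>auto simp: fun_eq_iff\<close>)
  show ?thesis
    unfolding p_ones_def
    apply (subst wp.simps(5), subst wp.simps(2), subst wp.simps(5), subst wp.simps(2), subst wp.simps(5))
    apply (rule wp_PMul; (use m02 X in \<open>simp; fail\<close>)?)
    apply (subst wp.simps(5), subst wp.simps(2))
    using S m02 by (simp del: wp.simps)
qed

lemma wp_dm_prog:
  assumes wf: "dm_wf I" and X: "loop_bound I \<le> X" and m: "snd s = mem_of (dm_encode I)"
  shows "wp X dm_prog (\<lambda>s'. fst s' 0 \<noteq> 0 \<longrightarrow> dm_solvable I) s"
  unfolding dm_prog_def
proof (rule wp_Seq[OF wp_p_ones[OF loop_bound_ge(1)[OF X] m]], goal_cases)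
  case (1 s1)
  have "wp X df_prog (\<lambda>s'. fst s' 0 \<noteq> 0 \<longrightarrow> df_solvable (to_df I)) s1"
    by (rule wp_df_prog[OF _ _ 1(1)]) (use wf X in \<open>simp_all add: to_df_wf to_df_loop_bound\<close>)
  then show ?case by (simp add: to_df_solvable)
qed

lemma dm_prog_prob:
  assumes wf: "dm_wf I" and sol: "dm_solvable I" and m: "snd s = mem_of (dm_encode I)"
  shows "measure_pmf.prob (psem dm_prog s) {s'. fst s' 0 \<noteq> 0} \<ge> 1 - 1 / real (nverts I)"
proof -
  obtain s1 where s1: "psem p_ones s = return_pmf s1" using psem_flip_free[OF wf_p_ones(2)] by blast
  have "snd s1 = mem_of (df_encode (to_df I))"
    using compile_correct[OF wf_p_ones(1) wp_p_ones[OF le_refl m]] by (simp add: s1)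
  from df_prog_prob[OF _ _ this] show ?thesis
    using wf sol by (simp add: dm_prog_def s1 bind_return_pmf to_df_wf to_df_solvable)
qed

theorem theorem1:
  shows "(\<exists>A. poly_time_small_prod (dm_wf :: dm_instance \<Rightarrow> bool) dm_encode A \<and>
              poly_time_few_sets (dm_wf :: dm_instance \<Rightarrow> bool) dm_encode A \<and>
              true_is_correct dm_wf dm_encode dm_solvable A \<and>
              solvable_true_whp dm_wf dm_encode dm_solvable A) \<and>
         (\<exists>A. poly_time_small_prod df_wf df_encode A \<and>
              poly_time_few_sets df_wf df_encode A \<and>
              true_is_correct df_wf df_encode df_solvable A \<and>
              solvable_true_whp df_wf df_encode df_solvable A) \<and>
         small_prod_few_sets (dm_wf :: dm_instance \<Rightarrow> bool) \<and>
         small_prod_few_sets df_wf"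
proof (intro conjI)
  note dm = algorithm_properties[of dm_prog dm_wf dm_solvable dm_encode, OF wf_dm_prog _
      wp_dm_prog[where s = "((\<lambda>_. 0), mem_of (dm_encode _))"] dm_prog_prob[where s = "((\<lambda>_. 0), mem_of (dm_encode _))"]]
  show "\<exists>A. poly_time_small_prod (dm_wf :: dm_instance \<Rightarrow> bool) dm_encode A \<and>
              poly_time_few_sets (dm_wf :: dm_instance \<Rightarrow> bool) dm_encode A \<and>
              true_is_correct dm_wf dm_encode dm_solvable A \<and>
              solvable_true_whp dm_wf dm_encode dm_solvable A"
    by (intro exI[of _ "compile dm_prog"] conjI dm) simp_all
  have wf: "df_wf I \<Longrightarrow> dm_wf I" for I by (simp add: df_wf_def)
  note df = algorithm_properties[of df_prog df_wf df_solvable df_encode, OF wf_df_prog wf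
      wp_df_prog[where s = "((\<lambda>_. 0), mem_of (df_encode _))"] df_prog_prob[where s = "((\<lambda>_. 0), mem_of (df_encode _))"]]
  show "\<exists>A. poly_time_small_prod df_wf df_encode A \<and>
              poly_time_few_sets df_wf df_encode A \<and>
              true_is_correct df_wf df_encode df_solvable A \<and>
              solvable_true_whp df_wf df_encode df_solvable A"
    by (intro exI[of _ "compile df_prog"] conjI df) simp_all
  show "small_prod_few_sets (dm_wf :: dm_instance \<Rightarrow> bool)" by (rule small_prod_few_sets_dm_wf)
  show "small_prod_few_sets df_wf" by (rule small_prod_few_sets_dm_wf) (rule wf)
qed

end
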